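(* Let $n\ge 2$, let $I$ be an inner function in $B_n$, let $b: B_n\to\mathbb{D}$ be a non-constant holomorphic function, and let $\alpha\in\mathbb{T}$. Let $\sigma=\sigma_\alpha[I]$ and $\mu=\sigma_\alpha[b]$ be the corresponding Clark measures on $\partial B_n$. For $w\in B_n$ let $K_w(z)=K(z,w)=(1-I(z)\overline{I(w)})\,C(z,w)$, $z\in B_n$, where $K(z,w)$ is the reproducing kernel of $I^*(H^2)=H^2\ominus I H^2$. Then the following properties are equivalent: (i) $\sigma\ll\mu$ and $\frac{d\sigma}{d\mu}\in L^2(\mu)$; (ii) the function $\frac{\alpha-b}{\alpha-I}K_w$ is in the de Branges--Rovnyak space $\mathcal{H}(b)$ for all $w\in B_n$; (iii) the function $\frac{\alpha-b}{\alpha-I}K_w$ is in $\mathcal{H}(b)$ for some $w\in B_n$.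
   Context: $B_n$ is the open unit ball of $\mathbb{C}^n$ and $\partial B_n$ the unit sphere; $\mathbb{D}=B_1$, $\mathbb{T}=\partial B_1$. $\Sigma$ is the normalized Lebesgue measure on $\partial B_n$. Cauchy kernel: $C(z,\zeta)=(1-\langle z,\zeta\rangle)^{-n}$, where $\langle z,\zeta\rangle=\sum_j z_j\overline{\zeta_j}$ (used for $z,\zeta\in\overline{B_n}$ with at least one of them in $B_n$). Poisson kernel: $P(z,\zeta)=\frac{C(z,\zeta)C(\zeta,z)}{C(z,z)}$ for $z\in B_n$, $\zeta\in\partial B_n$; for a complex Borel measure $\mu$ on $\partial B_n$, $P[\mu](z)=\int_{\partial B_n}P(z,\zeta)\,d\mu(\zeta)$. Clark measure: for a holomorphic $b:B_n\to\mathbb{D}$ and $\alpha\in\mathbb{T}$, $\sigma_\alpha[b]$ is the unique positive Borel measure on $\partial B_n$ such that $P[\sigma_\alpha[b]](z)=\frac{1-|b(z)|^2}{|\alpha-b(z)|^2}=\mathrm{Re}\left(\frac{\alpha+b(z)}{\alpha-b(z)}\right)$ for all $z\in B_n$. Inner function: a holomorphic $I:B_n\to\mathbb{D}$ with $|I(\zeta)|=1$ for $\Sigma$-a.e. $\zeta\in\partial B_n$, where $I(\zeta)=\lim_{r\to1-}I(r\zeta)$ (which exists $\Sigma$-a.e.). $H^2=H^2(B_n)$ is the Hardy space of holomorphic $f$ on $B_n$ with $\|f\|_{H^2}^2=\sup_{0<r<1}\int_{\partial B_n}|f(r\zeta)|^2\,d\Sigma(\zeta)<\infty$, identified with its space of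 boundary values. De Branges--Rovnyak space: for a non-constant holomorphic $b:B_n\to\mathbb{D}$, $\mathcal{H}(b)\subset H^2$ is the Hilbert space of holomorphic functions on $B_n$ with reproducing kernel $k_b(z,w)=(1-b(z)\overline{b(w)})\,C(z,w)$. For inner $I$, $\mathcal{H}(I)=I^*(H^2)$. *)

theory Defs
  imports "HOL-Analysis.Analysis"
begin

section \<open>Function theory on the unit ball of complex n-space\<close>

definition cdot :: "complex ^ 'n \<Rightarrow> complex ^ 'n \<Rightarrow> complex" where
  "cdot z \<zeta> = (\<Sum>j\<in>UNIV. z $ j * cnj (\<zeta> $ j))"

text \<open>Real differentiability together with complex homogeneity of the derivative,
  which makes the derivative complex linear.\<close>

definition holomorphic_on_ball :: "(complex ^ 'n \<Rightarrow> complex) \<Rightarrow> bool" where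
  "holomorphic_on_ball f \<longleftrightarrow>
     (\<forall>z\<in>ball 0 1. \<exists>f'. (f has_derivative f') (at z) \<and> (\<forall>c v. f' (c *s v) = c * f' v))"

definition holomorphic_to_disc :: "(complex ^ 'n \<Rightarrow> complex) \<Rightarrow> bool" where
  "holomorphic_to_disc f \<longleftrightarrow> holomorphic_on_ball f \<and> (\<forall>z\<in>ball 0 1. cmod (f z) < 1)"

definition cauchy_kernel :: "complex ^ 'n \<Rightarrow> complex ^ 'n \<Rightarrow> complex" where
  "cauchy_kernel z \<zeta> = 1 / (1 - cdot z \<zeta>) ^ CARD('n)"

definition poisson_kernel :: "complex ^ 'n \<Rightarrow> complex ^ 'n \<Rightarrow> complex" where
  "poisson_kernel z \<zeta> = cauchy_kernel z \<zeta> * cauchy_kernel \<zeta> z / cauchy_kernel z z"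


section \<open>Measures on the unit sphere\<close>

text \<open>The normalized Lebesgue measure on the sphere, by polar coordinates: the measure of
  a Borel set \<open>A\<close> is the proportion of the volume of the ball which the cone over \<open>A\<close> fills.
  The exceptional point \<open>0 / norm 0 = 0\<close> is Lebesgue null.\<close>

definition sphere_measure :: "(complex ^ 'n) measure" where
  "sphere_measure =
     restrict_space (distr (uniform_measure lborel (ball 0 1)) borel (\<lambda>x. x /\<^sub>R norm x)) (sphere 0 1)"

definition inner_function :: "(complex ^ 'n \<Rightarrow> complex) \<Rightarrow> bool" where
  "inner_function f \<longleftrightarrow> holomorphic_to_disc f \<and>
     (AE \<zeta> in sphere_measure. \<exists>l. ((\<lambda>r. f (r *\<^sub>R \<zeta>)) \<longlongrightarrow> l) (at_left 1) \<and> cmod l = 1)"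

text \<open>\<open>clark_measure b \<alpha> \<sigma>\<close> says that \<open>\<sigma>\<close> is the positive Borel measure \<open>\<sigma>\<^sub>\<alpha>[b]\<close> on the
  sphere. The equation at \<open>z = 0\<close> gives the total mass, so finiteness is no restriction; it
  makes the Bochner integral of the (bounded) Poisson kernel meaningful.\<close>

definition clark_measure ::
    "(complex ^ 'n \<Rightarrow> complex) \<Rightarrow> complex \<Rightarrow> (complex ^ 'n) measure \<Rightarrow> bool" where
  "clark_measure b \<alpha> \<sigma> \<longleftrightarrow>
     sets \<sigma> = sets (restrict_space borel (sphere 0 1)) \<and> finite_measure \<sigma> \<and>
     (\<forall>z\<in>ball 0 1. (\<integral>\<zeta>. poisson_kernel z \<zeta> \<partial>\<sigma>) =
        complex_of_real ((1 - (cmod (b z))\<^sup>2) / (cmod (\<alpha> - b z))\<^sup>2))"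


section \<open>Reproducing kernel Hilbert spaces and de Branges--Rovnyak spaces\<close>

definition ip_dist :: "(('a \<Rightarrow> complex) \<Rightarrow> ('a \<Rightarrow> complex) \<Rightarrow> complex) \<Rightarrow>
    ('a \<Rightarrow> complex) \<Rightarrow> ('a \<Rightarrow> complex) \<Rightarrow> real" where
  "ip_dist ip f g = sqrt (Re (ip (\<lambda>z. f z - g z) (\<lambda>z. f z - g z)))"

text \<open>Functions on \<open>X\<close> are represented by total functions which vanish outside \<open>X\<close>.\<close>

definition cut_off :: "'a set \<Rightarrow> ('a \<Rightarrow> complex) \<Rightarrow> 'a \<Rightarrow> complex" where
  "cut_off X f = (\<lambda>z. if z \<in> X then f z else 0)"

text \<open>\<open>H\<close>, with the inner product \<open>ip\<close> (linear in the first argument), is a complex Hilbert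
  space of functions on \<open>X\<close> with reproducing kernel \<open>k\<close>.\<close>

locale reproducing_kernel_hilbert_space =
  fixes X :: "'a set"
    and k :: "'a \<Rightarrow> 'a \<Rightarrow> complex"
    and H :: "('a \<Rightarrow> complex) set"
    and ip :: "('a \<Rightarrow> complex) \<Rightarrow> ('a \<Rightarrow> complex) \<Rightarrow> complex"
  assumes supported: "f \<in> H \<Longrightarrow> z \<notin> X \<Longrightarrow> f z = 0"
    and zero_mem: "(\<lambda>z. 0) \<in> H"
    and add_mem: "f \<in> H \<Longrightarrow> g \<in> H \<Longrightarrow> (\<lambda>z. f z + g z) \<in> H"
    and scale_mem: "f \<in> H \<Longrightarrow> (\<lambda>z. c * f z) \<in> H"
    and ip_add: "f \<in> H \<Longrightarrow> g \<in> H \<Longrightarrow> h \<in> H \<Longrightarrow> ip (\<lambda>z. f z + g z) h = ip f h + ip g h"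
    and ip_scale: "f \<in> H \<Longrightarrow> h \<in> H \<Longrightarrow> ip (\<lambda>z. c * f z) h = c * ip f h"
    and ip_cnj: "f \<in> H \<Longrightarrow> g \<in> H \<Longrightarrow> ip g f = cnj (ip f g)"
    and ip_nonneg: "f \<in> H \<Longrightarrow> 0 \<le> Re (ip f f)"
    and ip_definite: "f \<in> H \<Longrightarrow> ip f f = 0 \<Longrightarrow> f = (\<lambda>z. 0)"
    and complete: "(\<And>i. s i \<in> H) \<Longrightarrow>
          (\<And>\<epsilon>. \<epsilon> > 0 \<Longrightarrow> \<exists>N. \<forall>i\<ge>N. \<forall>j\<ge>N. ip_dist ip (s i) (s j) < \<epsilon>) \<Longrightarrow>
          \<exists>f\<in>H. (\<lambda>i::nat. ip_dist ip (s i) f) \<longlonglongrightarrow> 0"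
    and kernel_mem: "w \<in> X \<Longrightarrow> cut_off X (\<lambda>z. k z w) \<in> H"
    and reproducing: "f \<in> H \<Longrightarrow> w \<in> X \<Longrightarrow> ip f (cut_off X (\<lambda>z. k z w)) = f w"

definition dbr_kernel :: "(complex ^ 'n \<Rightarrow> complex) \<Rightarrow> complex ^ 'n \<Rightarrow> complex ^ 'n \<Rightarrow> complex" where
  "dbr_kernel b z w = (1 - b z * cnj (b w)) * cauchy_kernel z w"

text \<open>A Hilbert function space is determined by its reproducing kernel, so the existential
  quantifier below ranges over a single pair, up to the values of \<open>ip\<close> off \<open>H\<close>. Only the
  values of \<open>f\<close> on the ball matter for membership.\<close>

definition de_branges_rovnyak :: "(complex ^ 'n \<Rightarrow> complex) \<Rightarrow> (complex ^ 'n \<Rightarrow> complex) set" where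
  "de_branges_rovnyak b = {f. \<exists>H ip.
      reproducing_kernel_hilbert_space (ball 0 1) (dbr_kernel b) H ip \<and>
      (\<forall>g\<in>H. holomorphic_on_ball g) \<and> cut_off (ball 0 1) f \<in> H}"

end

theory Submission
  imports Defs "HOL-Complex_Analysis.Complex_Analysis"
begin

text \<open>Polarizing the defining equation of a Clark measure \<open>\<mu>\<close> of \<open>b\<close> gives
  \<open>\<integral> C(z, \<zeta>) C(\<zeta>, w) d\<mu> = k\<^sub>b(z, w) / ((1 - cnj \<alpha> b(z)) (1 - \<alpha> cnj b(w)))\<close>, so \<open>H(b)\<close> consists of
  the functions \<open>(1 - cnj \<alpha> b) C[f \<mu>]\<close> with \<open>f \<in> L\<^sup>2(\<mu>)\<close>, and the function in question is a multiple of
  \<open>(1 - cnj \<alpha> b) C[g \<sigma>]\<close> with \<open>g = C(\<cdot>, w)\<close>. If \<open>d\<sigma>/d\<mu> \<in> L\<^sup>2(\<mu>)\<close>, membership is immediate.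

  Conversely, membership for one \<open>w\<close> yields \<open>\<bar>\<integral> cnj \<phi> g d\<sigma>\<bar> \<le> M \<parallel>\<phi>\<parallel>\<close> in \<open>L\<^sup>2(\<mu>)\<close> for all combinations \<open>\<phi>\<close> of
  Cauchy kernels, and one has to pass from such \<open>\<phi>\<close> to arbitrary continuous functions. Since \<open>I\<close> is
  inner, the functions \<open>P = ((1 + cnj \<alpha> I(r \<cdot>)) / 2)\<^sup>m\<close> satisfy \<open>\<bar>P\<bar> \<le> 1\<close>, tend to 1 in \<open>L\<^sup>2(\<sigma>)\<close> and to
  0 in \<open>L\<^sup>1\<close> of the Lebesgue measure. For a Lipschitz function \<open>\<psi>\<close> on the sphere the kernel of the
  commutator of \<open>\<psi>\<close> with the Cauchy projection is weakly singular, so the Cauchy projection of \<open>\<psi> P\<close> is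
  uniformly close to \<open>\<psi> P\<close>. Hence the estimate holds for \<open>\<psi>\<close> in place of \<open>\<phi>\<close>, and no
  information about the part of \<open>\<mu>\<close> singular to \<open>\<sigma>\<close> is needed.\<close>

section \<open>The Hermitian product and the Cauchy kernel\<close>

text \<open>Combinations of Cauchy kernels are holomorphic, and such functions need not be dense in
  L^2(\<mu>), so the bound extracted from membership does not by itself control \<sigma>. The way
  out is an asymmetry between its two sides: replacing \<psi> by the Cauchy transform of \<psi> P
  hardly changes the left side, as P is close to 1 for \<sigma>, while the right side only needs |P|
  \<le> 1. The peaking has two sources. The set where I = \<alpha> is Lebesgue null, by the mean
  value property applied to powers; and the \<sigma>-integral of cnj \<alpha> I(r .) tends to the
  full mass of \<sigma>, which a function bounded by 1 achieves only by being close to 1. The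
  commutator is tame because |1 - \<open>cdot z \<eta>\<close>| controls the square of the Euclidean
  distance, so a Lipschitz factor gains half a power of the singularity. Finally \<psi> = \<theta>
  C(., w) with \<theta> \<ge> 0 turns the left side into the integral of \<theta> |C(., w)|^2, and
  |C(., w)| is bounded above and below on the sphere; this is why a single w suffices.\<close>

lemma cdot_add_left: "cdot (x + y) z = cdot x z + cdot y z"
  by (simp add: cdot_def algebra_simps sum.distrib)

lemma cdot_add_right: "cdot x (y + z) = cdot x y + cdot x z"
  by (simp add: cdot_def algebra_simps sum.distrib)

lemma cdot_diff_left: "cdot (x - y) z = cdot x z - cdot y z"
  by (simp add: cdot_def algebra_simps sum_subtractf)

lemma cdot_diff_right: "cdot x (y - z) = cdot x y - cdot x z"
  by (simp add: cdot_def algebra_simps sum_subtractf)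

lemma cdot_smult_left: "cdot (c *s x) y = c * cdot x y"
  by (simp add: cdot_def sum_distrib_left mult_ac)

lemma cdot_smult_right: "cdot x (c *s y) = cnj c * cdot x y"
  by (simp add: cdot_def sum_distrib_left mult_ac)

lemma scaleR_eq_smult: "r *\<^sub>R (x :: complex ^ 'n) = complex_of_real r *s x"
  by (simp add: vec_eq_iff scaleR_conv_of_real[of r "_ :: complex"])

lemma cdot_zero_left [simp]: "cdot 0 x = 0" and cdot_zero_right [simp]: "cdot x 0 = 0"
  by (simp_all add: cdot_def)

lemma cdot_commute: "cdot y x = cnj (cdot x y)"
  by (simp add: cdot_def mult.commute)

lemma cdot_self: "cdot x x = complex_of_real ((norm x)\<^sup>2)"
proof -
  have "(norm x)\<^sup>2 = (\<Sum>j\<in>UNIV. (cmod (x $ j))\<^sup>2)"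
    by (simp add: norm_vec_def L2_set_def sum_nonneg)
  then show ?thesis
    by (simp add: cdot_def complex_norm_square[symmetric] del: of_real_power)
qed

lemma norm_cdot_le: "cmod (cdot x y) \<le> norm x * norm y"
proof -
  have "cmod (cdot x y) \<le> (\<Sum>j\<in>UNIV. cmod (x $ j) * cmod (y $ j))"
    unfolding cdot_def by (rule order_trans[OF norm_sum]) (simp add: norm_mult)
  also have "\<dots> \<le> norm x * norm y"
    using L2_set_mult_ineq[of "\<lambda>j. cmod (x $ j)" "\<lambda>j. cmod (y $ j)" UNIV]
    by (simp add: norm_vec_def)
  finally show ?thesis .
qed

lemma norm_smult: "norm (c *s (x :: complex ^ 'n)) = cmod c * norm x"
proof -
  have "complex_of_real ((norm (c *s x))\<^sup>2) = c * cnj c * cdot x x"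
    unfolding cdot_self[symmetric] by (simp add: cdot_smult_left cdot_smult_right)
  also have "\<dots> = complex_of_real ((cmod c * norm x)\<^sup>2)"
    by (simp add: cdot_self power_mult_distrib complex_norm_square[symmetric] mult_ac)
  finally have "(norm (c *s x))\<^sup>2 = (cmod c * norm x)\<^sup>2"
    by (simp only: of_real_eq_iff)
  then show ?thesis by (simp add: power2_eq_iff_nonneg)
qed

lemma bounded_linear_cdot_left: "bounded_linear (\<lambda>x. cdot x y)"
  by (rule bounded_linear_intro[where K = "norm y"])
     (auto simp: cdot_add_left scaleR_eq_smult cdot_smult_left scaleR_conv_of_real
       intro: norm_cdot_le)

lemma continuous_on_cdot [continuous_intros]:
  "continuous_on A f \<Longrightarrow> continuous_on A g \<Longrightarrow> continuous_on A (\<lambda>x. cdot (f x) (g x))"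
  unfolding cdot_def by (intro continuous_intros)

lemma cdot_measurable [measurable]:
  assumes "f \<in> borel_measurable M" "g \<in> borel_measurable M"
  shows "(\<lambda>x. cdot (f x) (g x)) \<in> borel_measurable M"
proof -
  have 1: "(\<lambda>p. cdot (fst p) (snd p)) \<in> borel_measurable (borel :: ((complex ^ 'n) \<times> (complex ^ 'n)) measure)"
    by (intro borel_measurable_continuous_onI continuous_intros)
  have 2: "(\<lambda>x. (f x, g x)) \<in> borel_measurable M"
    using assms by simp
  show ?thesis using measurable_compose[OF 2 1] by simp
qed

lemma smult_measurable [measurable]:
  assumes "f \<in> borel_measurable M" "g \<in> borel_measurable M"
  shows "(\<lambda>x. f x *s (g x :: complex ^ 'n)) \<in> borel_measurable M"
proof -
  have "continuous_on UNIV (\<lambda>p :: complex \<times> (complex ^ 'n). fst p *s snd p)"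
    unfolding vector_scalar_mult_def
    by (intro continuous_intros)
  then have 1: "(\<lambda>p :: complex \<times> (complex ^ 'n). fst p *s snd p) \<in> borel_measurable borel"
    by (rule borel_measurable_continuous_onI)
  have 2: "(\<lambda>x. (f x, g x)) \<in> borel_measurable M"
    using assms by simp
  show ?thesis using measurable_compose[OF 2 1] by simp
qed

lemma continuous_on_smult [continuous_intros]:
  "continuous_on A f \<Longrightarrow> continuous_on A g \<Longrightarrow> continuous_on A (\<lambda>x. f x *s (g x :: complex ^ 'n))"
  unfolding vector_scalar_mult_def by (intro continuous_intros)

lemma cauchy_kernel_cnj: "cnj (cauchy_kernel z w) = cauchy_kernel w z"
  by (simp add: cauchy_kernel_def cdot_commute[of z w])

lemma cauchy_kernel_measurable [measurable]:
  "f \<in> borel_measurable M \<Longrightarrow> g \<in> borel_measurable M \<Longrightarrow>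
    (\<lambda>x. cauchy_kernel (f x) (g x)) \<in> borel_measurable M"
  unfolding cauchy_kernel_def by measurable

lemma cauchy_kernel_zero [simp]: "cauchy_kernel 0 z = 1" "cauchy_kernel z 0 = 1"
  by (simp_all add: cauchy_kernel_def)

text \<open>A dilation of the variable is traded for an interior base point, so a Cauchy integral
  evaluated at \<open>r *\<^sub>R \<zeta>\<close> is a superposition of kernels C(., w) with |w| =
  r.\<close>

lemma cauchy_kernel_scaleR: "cauchy_kernel (r *\<^sub>R z) w = cauchy_kernel z (r *\<^sub>R w)"
  by (simp add: cauchy_kernel_def scaleR_eq_smult cdot_smult_left cdot_smult_right)

lemma norm_one_minus_cdot_ge:
  assumes "norm \<zeta> \<le> 1" shows "1 - norm z \<le> cmod (1 - cdot z \<zeta>)"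
proof -
  have "cmod (cdot z \<zeta>) \<le> norm z"
    using norm_cdot_le[of z \<zeta>] assms by (metis mult_left_le norm_ge_zero order_trans)
  then show ?thesis
    using norm_triangle_ineq2[of 1 "cdot z \<zeta>"] by simp
qed

lemma one_minus_cdot_nonzero:
  assumes "norm \<zeta> \<le> 1" "norm z < 1" shows "1 - cdot z \<zeta> \<noteq> 0"
  using norm_one_minus_cdot_ge[OF assms(1), of z] assms(2) by auto

lemma norm_cauchy_kernel_le:
  fixes z \<zeta> :: "complex ^ 'n"
  assumes "norm \<zeta> \<le> 1" "norm z \<le> \<rho>" "\<rho> < 1"
  shows "cmod (cauchy_kernel z \<zeta>) \<le> 1 / (1 - \<rho>) ^ CARD('n)"
proof -
  have "1 - \<rho> \<le> cmod (1 - cdot z \<zeta>)"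
    using norm_one_minus_cdot_ge[OF assms(1), of z] assms(2) by linarith
  then show ?thesis
    using assms(3) unfolding cauchy_kernel_def
    by (auto simp: norm_divide norm_power intro!: divide_left_mono power_mono mult_pos_pos
        zero_less_power)
qed

text \<open>Since |1 - \<open>cdot z \<zeta>\<close>| \<le> 2. The lower bound is what later allows
  division by |C(., w)|^2 for one fixed w.\<close>

lemma norm_cauchy_kernel_ge:
  fixes z \<zeta> :: "complex ^ 'n"
  assumes "norm \<zeta> \<le> 1" "norm z < 1"
  shows "1 / 2 ^ CARD('n) \<le> cmod (cauchy_kernel z \<zeta>)"
proof -
  have "cmod (cdot z \<zeta>) \<le> 1"
    using norm_cdot_le[of z \<zeta>] assms by (smt (verit) mult_le_one norm_ge_zero)
  then have "cmod (1 - cdot z \<zeta>) \<le> 2"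
    using norm_triangle_ineq4[of 1 "cdot z \<zeta>"] by simp
  then have "cmod (1 - cdot z \<zeta>) ^ CARD('n) \<le> 2 ^ CARD('n)"
    by (intro power_mono) auto
  moreover have "0 < cmod (1 - cdot z \<zeta>) ^ CARD('n)"
    using one_minus_cdot_nonzero[OF assms] by simp
  ultimately show ?thesis
    unfolding cauchy_kernel_def by (auto simp: norm_divide norm_power intro!: divide_left_mono)
qed

section \<open>Differentiation under the integral sign\<close>

lemma norm_lebesgue_integral_le:
  fixes f :: "'a \<Rightarrow> 'b :: {banach, second_countable_topology}"
  assumes "integrable M f" "integrable M g" "\<And>x. x \<in> space M \<Longrightarrow> norm (f x) \<le> g x"
  shows "norm (\<integral>x. f x \<partial>M) \<le> (\<integral>x. g x \<partial>M)"
  by (rule order_trans[OF integral_norm_bound integral_mono]) (use assms in auto)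

text \<open>Exhibits the derivative as a limit of difference quotients, which is how it inherits
  measurability in the parameter below.\<close>

lemma has_vector_derivative_slope:
  fixes g :: "real \<Rightarrow> 'a :: real_normed_vector"
  assumes "(g has_vector_derivative d) (at 0)"
  shows "((\<lambda>t. (g t - g 0) /\<^sub>R t) \<longlongrightarrow> d) (at 0)"
proof -
  have "((\<lambda>t. (g t - g 0 - t *\<^sub>R d) /\<^sub>R \<bar>t\<bar>) \<longlongrightarrow> 0) (at 0)"
    using assms unfolding has_vector_derivative_def has_derivative_at_within by simp
  then have "((\<lambda>t. norm ((g t - g 0 - t *\<^sub>R d) /\<^sub>R \<bar>t\<bar>)) \<longlongrightarrow> 0) (at 0)"
    by (rule tendsto_norm_zero)
  moreover have "\<forall>\<^sub>F t in at 0. norm ((g t - g 0 - t *\<^sub>R d) /\<^sub>R \<bar>t\<bar>) = norm ((g t - g 0) /\<^sub>R t - d)"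
    unfolding eventually_at_filter
  proof (intro always_eventually allI impI)
    fix t :: real assume t: "t \<noteq> 0"
    have "(g t - g 0) /\<^sub>R t - d = (g t - g 0 - t *\<^sub>R d) /\<^sub>R t"
      using t by (simp add: scaleR_diff_right)
    then show "norm ((g t - g 0 - t *\<^sub>R d) /\<^sub>R \<bar>t\<bar>) = norm ((g t - g 0) /\<^sub>R t - d)"
      by simp
  qed
  ultimately have "((\<lambda>t. norm ((g t - g 0) /\<^sub>R t - d)) \<longlongrightarrow> 0) (at 0)"
    by (simp only: tendsto_cong)
  then show ?thesis
    by (rule LIM_zero_cancel[OF tendsto_norm_zero_cancel])
qed

text \<open>The mean value inequality on the convex ball turns the bound on \<open>D\<close> into a
  majorant for the difference quotients, so dominated convergence applies along sequences.
  Measurability of \<open>D x0 \<zeta> v\<close> in \<zeta> is derived, not assumed.\<close>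

lemma has_derivative_integral_dominated:
  fixes f :: "'a :: {real_normed_vector, perfect_space} \<Rightarrow> 'b \<Rightarrow> complex"
  assumes r: "0 < r"
    and D: "\<And>x \<zeta>. x \<in> ball x0 r \<Longrightarrow> \<zeta> \<in> space M \<Longrightarrow> ((\<lambda>x. f x \<zeta>) has_derivative D x \<zeta>) (at x)"
    and bound: "\<And>x \<zeta> v. x \<in> ball x0 r \<Longrightarrow> \<zeta> \<in> space M \<Longrightarrow> cmod (D x \<zeta> v) \<le> B \<zeta> * norm v"
    and B: "integrable M B"
    and f: "\<And>x. x \<in> ball x0 r \<Longrightarrow> integrable M (f x)"
  shows "((\<lambda>x. \<integral>\<zeta>. f x \<zeta> \<partial>M) has_derivative (\<lambda>v. \<integral>\<zeta>. D x0 \<zeta> v \<partial>M)) (at x0)"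
proof -
  have x0: "x0 \<in> ball x0 r" using r by simp
  have meas: "(\<lambda>\<zeta>. D x0 \<zeta> v) \<in> borel_measurable M" for v
  proof (cases "v = 0")
    case True
    have "D x0 \<zeta> v = 0" if "\<zeta> \<in> space M" for \<zeta>
      using has_derivative_bounded_linear[OF D[OF x0 that]] True
      by (simp add: bounded_linear.linear linear_0)
    then show ?thesis by (simp cong: measurable_cong)
  next
    case False
    \<comment> \<open>With this scale every displacement \<open>(c / Suc i) *\<^sub>R v\<close> has
      length at most \<open>r / 2\<close>, so all difference quotients are taken inside the
      ball.\<close>
    define c where "c = r / (2 * norm v)"
    have c: "c > 0" using False r by (simp add: c_def)
    define X where "X i = x0 + (c / Suc i) *\<^sub>R v" for i
    have X: "X i \<in> ball x0 r" for i
    proof -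
      have "c / Suc i \<le> c" using c by (simp add: divide_le_eq)
      then have "norm ((c / Suc i) *\<^sub>R v) \<le> c * norm v"
        using c mult_right_mono[of "c / Suc i" c "norm v"] by (simp del: of_nat_Suc)
      also have "\<dots> < r" using False r by (simp add: c_def)
      finally show ?thesis by (simp add: X_def dist_norm)
    qed
    show ?thesis
    proof (rule borel_measurable_LIMSEQ_metric)
      show "(\<lambda>\<zeta>. (f (X i) \<zeta> - f x0 \<zeta>) /\<^sub>R (c / Suc i)) \<in> borel_measurable M" for i
        using f[OF X, of i] f[OF x0] by measurable
    next
      fix \<zeta> assume z: "\<zeta> \<in> space M"
      have lin: "bounded_linear (D x0 \<zeta>)" using has_derivative_bounded_linear[OF D[OF x0 z]] .
      have lim: "(\<lambda>i. c / real (Suc i)) \<longlonglongrightarrow> 0" 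
        by (rule tendsto_divide_0[OF tendsto_const])
           (intro filterlim_compose[OF filterlim_at_top_imp_at_infinity filterlim_Suc]
             filterlim_real_sequentially)+
      have "((\<lambda>t. f (x0 + t *\<^sub>R v) \<zeta>) has_derivative (\<lambda>t. D x0 \<zeta> (t *\<^sub>R v))) (at 0)"
        by (rule has_derivative_compose[of "\<lambda>t. x0 + t *\<^sub>R v" "\<lambda>t. t *\<^sub>R v" 0 UNIV "\<lambda>x. f x \<zeta>" "D x0 \<zeta>"])
           (auto intro!: derivative_eq_intros D x0 z)
      then have "((\<lambda>t. f (x0 + t *\<^sub>R v) \<zeta>) has_vector_derivative D x0 \<zeta> v) (at 0)"
        by (simp add: has_vector_derivative_def linear_cmul[OF bounded_linear.linear[OF lin]])
      from has_vector_derivative_slope[OF this]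
      have "((\<lambda>t. (f (x0 + t *\<^sub>R v) \<zeta> - f x0 \<zeta>) /\<^sub>R t) \<longlongrightarrow> D x0 \<zeta> v) (at 0)"
        by simp
      from filterlim_compose[OF this, of "\<lambda>i. c / real (Suc i)" sequentially]
      show "(\<lambda>i. (f (X i) \<zeta> - f x0 \<zeta>) /\<^sub>R (c / Suc i)) \<longlonglongrightarrow> D x0 \<zeta> v"
        using lim c by (simp add: X_def filterlim_at)
    qed
  qed
  have lin: "bounded_linear (D x0 \<zeta>)" if "\<zeta> \<in> space M" for \<zeta>
    using has_derivative_bounded_linear[OF D[OF x0 that]] .
  have Dint: "integrable M (\<lambda>\<zeta>. D x0 \<zeta> v)" for v
    by (rule Bochner_Integration.integrable_bound[OF integrable_mult_left[OF B, of "norm v"] meas])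
       (auto intro!: AE_I2 order_trans[OF bound[OF x0]])
  show ?thesis
    unfolding has_derivative_at_within
  proof (intro conjI)
    show "bounded_linear (\<lambda>v. \<integral>\<zeta>. D x0 \<zeta> v \<partial>M)"
    proof (rule bounded_linear_intro[where K = "\<integral>\<zeta>. B \<zeta> \<partial>M"])
      fix u v
      show "(\<integral>\<zeta>. D x0 \<zeta> (u + v) \<partial>M) = (\<integral>\<zeta>. D x0 \<zeta> u \<partial>M) + (\<integral>\<zeta>. D x0 \<zeta> v \<partial>M)"
        by (subst Bochner_Integration.integral_add[symmetric, OF Dint Dint])
           (auto intro!: Bochner_Integration.integral_cong simp: linear_add[OF bounded_linear.linear[OF lin]])
      show "(\<integral>\<zeta>. D x0 \<zeta> (r *\<^sub>R u) \<partial>M) = r *\<^sub>R (\<integral>\<zeta>. D x0 \<zeta> u \<partial>M)" for r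
      proof -
        have "(\<integral>\<zeta>. D x0 \<zeta> (r *\<^sub>R u) \<partial>M) = (\<integral>\<zeta>. r *\<^sub>R D x0 \<zeta> u \<partial>M)"
          by (intro Bochner_Integration.integral_cong refl linear_cmul bounded_linear.linear lin)
        then show ?thesis using Dint by simp
      qed
      show "norm (\<integral>\<zeta>. D x0 \<zeta> v \<partial>M) \<le> norm v * (\<integral>\<zeta>. B \<zeta> \<partial>M)"
      proof -
        have "norm (\<integral>\<zeta>. D x0 \<zeta> v \<partial>M) \<le> (\<integral>\<zeta>. B \<zeta> * norm v \<partial>M)"
          by (rule norm_lebesgue_integral_le) (use Dint B bound[OF x0] in auto)
        then show ?thesis by (simp add: mult.commute)
      qed
    qed
    \<comment> \<open>The normalized remainder. Its majorant is \<open>2 * B\<close>: one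
      \<open>B\<close> for the increment of \<open>f\<close>, one for the linear term.\<close>
    define e where "e y \<zeta> = (f y \<zeta> - f x0 \<zeta> - D x0 \<zeta> (y - x0)) /\<^sub>R norm (y - x0)" for y \<zeta>
    have "((\<lambda>y. \<integral>\<zeta>. e y \<zeta> \<partial>M) \<longlongrightarrow> 0) (at x0 within ball x0 r)"
      unfolding tendsto_at_iff_sequentially
    proof (intro allI impI)
      fix X assume X: "\<forall>i. X i \<in> ball x0 r - {x0}" "X \<longlonglongrightarrow> x0"
      have "(\<lambda>i. \<integral>\<zeta>. e (X i) \<zeta> \<partial>M) \<longlonglongrightarrow> (\<integral>\<zeta>. 0 \<partial>M)"
      proof (rule integral_dominated_convergence)
        show "(\<lambda>\<zeta>. e (X i) \<zeta>) \<in> borel_measurable M" for i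
          unfolding e_def
          by (intro borel_measurable_scaleR borel_measurable_diff borel_measurable_const meas
              borel_measurable_integrable[OF f] x0) (use X(1) in auto)
        show "integrable M (\<lambda>\<zeta>. 2 * B \<zeta>)" using B by simp
        show "AE \<zeta> in M. (\<lambda>i. e (X i) \<zeta>) \<longlonglongrightarrow> 0"
        proof (intro AE_I2)
          fix \<zeta> assume z: "\<zeta> \<in> space M"
          have "((\<lambda>y. e y \<zeta>) \<longlongrightarrow> 0) (at x0)"
            using D[OF x0 z] unfolding has_derivative_at_within e_def by blast
          then show "(\<lambda>i. e (X i) \<zeta>) \<longlonglongrightarrow> 0"
            using X unfolding tendsto_at_iff_sequentially by (auto simp: o_def)
        qed
        show "AE \<zeta> in M. norm (e (X i) \<zeta>) \<le> 2 * B \<zeta>" for i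
        proof (intro AE_I2)
          fix \<zeta> assume z: "\<zeta> \<in> space M"
          have Xi: "X i \<in> ball x0 r" "X i \<noteq> x0" using X by auto
          have "norm (f (X i) \<zeta> - f x0 \<zeta>) \<le> B \<zeta> * norm (X i - x0)"
          proof (rule differentiable_bound[OF convex_ball[of x0 r] _ _ Xi(1) x0])
            show "((\<lambda>x. f x \<zeta>) has_derivative D x \<zeta>) (at x within ball x0 r)" if "x \<in> ball x0 r" for x
              using D[OF that z] by (rule has_derivative_at_withinI)
            show "onorm (D x \<zeta>) \<le> B \<zeta>" if "x \<in> ball x0 r" for x
              by (rule onorm_le) (rule bound[OF that z])
          qed
          moreover have "norm (D x0 \<zeta> (X i - x0)) \<le> B \<zeta> * norm (X i - x0)"
            by (rule bound[OF x0 z])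
          ultimately have "norm (f (X i) \<zeta> - f x0 \<zeta> - D x0 \<zeta> (X i - x0)) \<le> 2 * B \<zeta> * norm (X i - x0)"
            using norm_triangle_ineq4[of "f (X i) \<zeta> - f x0 \<zeta>" "D x0 \<zeta> (X i - x0)"] by linarith
          then show "norm (e (X i) \<zeta>) \<le> 2 * B \<zeta>"
            using Xi unfolding e_def norm_scaleR by (simp add: divide_inverse_commute[symmetric] pos_divide_le_eq)
        qed
      qed auto
      then show "((\<lambda>y. \<integral>\<zeta>. e y \<zeta> \<partial>M) \<circ> X) \<longlonglongrightarrow> 0"
        by (simp add: o_def)
    qed
    then have lim: "((\<lambda>y. \<integral>\<zeta>. e y \<zeta> \<partial>M) \<longlongrightarrow> 0) (at x0)"
      using r by (simp add: at_within_open[OF x0])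
    have "(\<integral>\<zeta>. e y \<zeta> \<partial>M) = ((\<integral>\<zeta>. f y \<zeta> \<partial>M) - (\<integral>\<zeta>. f x0 \<zeta> \<partial>M) - (\<integral>\<zeta>. D x0 \<zeta> (y - x0) \<partial>M)) /\<^sub>R norm (y - x0)"
      if "y \<in> ball x0 r" for y
      unfolding e_def using f[OF x0] f[OF that] Dint by simp
    then have ev: "\<forall>\<^sub>F y in at x0. (\<integral>\<zeta>. e y \<zeta> \<partial>M) = ((\<integral>\<zeta>. f y \<zeta> \<partial>M) - (\<integral>\<zeta>. f x0 \<zeta> \<partial>M) - (\<integral>\<zeta>. D x0 \<zeta> (y - x0) \<partial>M)) /\<^sub>R norm (y - x0)"
      using eventually_at_in_open[OF open_ball x0] by (auto elim: eventually_mono)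
    show "((\<lambda>y. ((\<integral>\<zeta>. f y \<zeta> \<partial>M) - (\<integral>\<zeta>. f x0 \<zeta> \<partial>M) - (\<integral>\<zeta>. D x0 \<zeta> (y - x0) \<partial>M)) /\<^sub>R norm (y - x0)) \<longlongrightarrow> 0) (at x0)"
      using lim tendsto_cong[OF ev] by blast
  qed
qed

text \<open>A uniform bound on the integrand is enough because the Cauchy inequality on discs of
  radius r bounds the derivative by the constant B / r, which is integrable over a finite
  measure.\<close>

lemma holomorphic_on_integral:
  fixes f :: "complex \<Rightarrow> 'b \<Rightarrow> complex"
  assumes M: "finite_measure M" and S: "open S"
    and hol: "\<And>\<zeta>. \<zeta> \<in> space M \<Longrightarrow> (\<lambda>t. f t \<zeta>) holomorphic_on S"
    and bd: "\<And>t \<zeta>. t \<in> S \<Longrightarrow> \<zeta> \<in> space M \<Longrightarrow> cmod (f t \<zeta>) \<le> B"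
    and meas: "\<And>t. t \<in> S \<Longrightarrow> f t \<in> borel_measurable M"
  shows "(\<lambda>t. \<integral>\<zeta>. f t \<zeta> \<partial>M) holomorphic_on S"
proof -
  interpret finite_measure M by fact
  have "(\<lambda>t. \<integral>\<zeta>. f t \<zeta> \<partial>M) field_differentiable (at x0)" if x0: "x0 \<in> S" for x0
  proof -
    \<comment> \<open>Twice the radius, so that the closed disc of radius \<open>r\<close> about
      each point of \<open>ball x0 r\<close> still lies in \<open>S\<close>.\<close>
    obtain r where r: "r > 0" "ball x0 (2 * r) \<subseteq> S"
    proof -
      obtain e where "e > 0" "ball x0 e \<subseteq> S" using S x0 openE by blast
      then show ?thesis using that[of "e / 2"] by simp
    qed
    have sub: "cball x r \<subseteq> S" if "x \<in> ball x0 r" for x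
    proof
      fix y assume "y \<in> cball x r"
      then have "dist x0 y < 2 * r" using that dist_triangle[of x0 y x] by simp
      then show "y \<in> S" using r by auto
    qed
    have xS: "x \<in> S" if "x \<in> ball x0 r" for x using sub[OF that] r(1) by force
    define D where "D x \<zeta> v = deriv (\<lambda>t. f t \<zeta>) x * v" for x \<zeta> v
    have "((\<lambda>x. \<integral>\<zeta>. f x \<zeta> \<partial>M) has_derivative (\<lambda>v. \<integral>\<zeta>. D x0 \<zeta> v \<partial>M)) (at x0)"
    proof (rule has_derivative_integral_dominated[OF r(1)])
      fix x \<zeta> assume x: "x \<in> ball x0 r" and z: "\<zeta> \<in> space M"
      show "((\<lambda>x. f x \<zeta>) has_derivative D x \<zeta>) (at x)"
        unfolding D_def using holomorphic_derivI[OF hol[OF z] S xS[OF x]]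
        by (simp add: has_field_derivative_def)
      have "norm ((deriv ^^ 1) (\<lambda>t. f t \<zeta>) x) \<le> fact 1 * B / r ^ 1"
      proof (rule Cauchy_inequality)
        show "(\<lambda>t. f t \<zeta>) holomorphic_on ball x r"
          by (rule holomorphic_on_subset[OF hol[OF z]]) (use sub[OF x] ball_subset_cball in blast)
        show "continuous_on (cball x r) (\<lambda>t. f t \<zeta>)"
          by (rule continuous_on_subset[OF holomorphic_on_imp_continuous_on[OF hol[OF z]] sub[OF x]])
        show "cmod (f y \<zeta>) \<le> B" if "cmod (x - y) = r" for y
          by (rule bd[OF _ z]) (use sub[OF x] that in \<open>auto simp: dist_norm\<close>)
      qed (use r in auto)
      then show "cmod (D x \<zeta> v) \<le> (B / r) * norm v" for v
        using mult_right_mono[of "cmod (deriv (\<lambda>t. f t \<zeta>) x)" "B / r" "norm v"] by (simp add: D_def norm_mult)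
    next
      show "integrable M (f x)" if "x \<in> ball x0 r" for x
        by (rule integrable_const_bound[of _ B]) (use xS[OF that] bd meas in auto)
    qed auto
    moreover have "(\<lambda>v. \<integral>\<zeta>. D x0 \<zeta> v \<partial>M) = (\<lambda>v. (\<integral>\<zeta>. deriv (\<lambda>t. f t \<zeta>) x0 \<partial>M) * v)"
      by (simp add: D_def)
    ultimately show ?thesis
      unfolding field_differentiable_def has_field_derivative_def by metis
  qed
  then show ?thesis
    using holomorphic_on_def field_differentiable_at_within by blast
qed

section \<open>Holomorphic functions on the ball and on complex lines\<close>

lemma holomorphic_on_ballE:
  assumes "holomorphic_on_ball f" "z \<in> ball 0 1"
  obtains f' where "(f has_derivative f') (at z)" "\<And>c v. f' (c *s v) = c * f' v"
  using bspec[OF assms(1)[unfolded holomorphic_on_ball_def] assms(2)] by blast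

text \<open>Complex homogeneity turns the real chain rule into a complex derivative, equal to
  \<open>f' v\<close>. All one-variable theorems enter through such restrictions to lines.\<close>

lemma holomorphic_on_ball_line:
  assumes f: "holomorphic_on_ball f"
  shows "(\<lambda>t. f (a + t *s v)) holomorphic_on {t. a + t *s v \<in> ball 0 1}"
proof -
  have "(\<lambda>t. f (a + t *s v)) field_differentiable (at t)" if t: "a + t *s v \<in> ball 0 1" for t
  proof -
    obtain f' where f': "(f has_derivative f') (at (a + t *s v))" "\<And>c v. f' (c *s v) = c * f' v"
      using holomorphic_on_ballE[OF f t] by blast
    have 1: "((\<lambda>t. a + t *s v) has_derivative (\<lambda>h. h *s v)) (at t)"
    proof -
      have "bounded_linear (\<lambda>h. h *s v)"
        by (rule bounded_linear_intro[where K = "norm v"])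
           (simp_all add: vector_sadd_rdistrib scaleR_eq_smult scaleR_conv_of_real
             vector_smult_assoc norm_smult)
      from has_derivative_add[OF has_derivative_const bounded_linear_imp_has_derivative[OF this]]
      show ?thesis by simp
    qed
    have "((\<lambda>t. f (a + t *s v)) has_derivative (\<lambda>h. f' (h *s v))) (at t)"
      using has_derivative_compose[OF 1 f'(1)] .
    then have "((\<lambda>t. f (a + t *s v)) has_field_derivative f' v) (at t)"
      unfolding has_field_derivative_def f'(2) by (simp only: mult.commute[of _ "f' v"])
    then show ?thesis unfolding field_differentiable_def by blast
  qed
  then show ?thesis by (simp add: holomorphic_on_def field_differentiable_at_within)
qed

lemma has_field_derivative_inverse_power:
  fixes x :: complex
  assumes "x \<noteq> 1"
  shows "((\<lambda>x. 1 / (1 - x) ^ n) has_field_derivative of_nat n / (1 - x) ^ (n + 1)) (at x)"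
proof (cases n)
  case (Suc m)
  have "((\<lambda>x. inverse (1 - x)) has_field_derivative inverse (1 - x) ^ 2) (at x)"
    using assms by (auto intro!: derivative_eq_intros simp: power2_eq_square)
  from DERIV_power[OF this, of n]
  have "((\<lambda>x. inverse (1 - x) ^ n) has_field_derivative of_nat n * (inverse (1 - x) ^ 2 * inverse (1 - x) ^ m)) (at x)"
    using Suc by simp
  also have "of_nat n * (inverse (1 - x) ^ 2 * inverse (1 - x) ^ m) = of_nat n / (1 - x) ^ (n + 1)"
    unfolding Suc by (simp add: divide_inverse power_inverse power2_eq_square)
  finally show ?thesis by (simp add: divide_inverse power_inverse)
qed simp

text \<open>Near an interior point the kernel and its derivative are bounded uniformly in \<zeta>,
  so a multiple of |g| dominates. Homogeneity of the derivative comes from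
  \<open>cdot v \<zeta>\<close> being complex linear in \<open>v\<close>.\<close>

lemma holomorphic_on_ball_cauchy_integral:
  fixes \<mu> :: "(complex ^ 'n) measure"
  assumes sp: "space \<mu> \<subseteq> cball 0 1" and sets: "(\<lambda>x. x) \<in> borel_measurable \<mu>"
    and g: "integrable \<mu> g"
  shows "holomorphic_on_ball (\<lambda>z. \<integral>\<zeta>. cauchy_kernel z \<zeta> * g \<zeta> \<partial>\<mu>)"
  unfolding holomorphic_on_ball_def
proof
  fix z0 :: "complex ^ 'n" assume z0: "z0 \<in> ball 0 1"
  \<comment> \<open>Half the distance to the sphere: points of \<open>ball z0 r\<close> keep norm at
    most \<open>\<rho> = 1 - r < 1\<close>.\<close>
  define r where "r = (1 - norm z0) / 2"
  define \<rho> where "\<rho> = 1 - r"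
  have r: "r > 0" "\<rho> < 1" using z0 by (auto simp: r_def \<rho>_def)
  have zr: "norm z \<le> \<rho>" if "z \<in> ball z0 r" for z
  proof -
    have "norm z \<le> norm z0 + dist z0 z" by (metis dist_norm norm_minus_commute norm_triangle_sub)
    then show ?thesis using that by (simp add: \<rho>_def r_def field_simps)
  qed
  define D where "D z \<zeta> v = of_nat CARD('n) * cdot v \<zeta> / (1 - cdot z \<zeta>) ^ (CARD('n) + 1) * g \<zeta>" for z \<zeta> v
  have "((\<lambda>z. \<integral>\<zeta>. cauchy_kernel z \<zeta> * g \<zeta> \<partial>\<mu>) has_derivative (\<lambda>v. \<integral>\<zeta>. D z0 \<zeta> v \<partial>\<mu>)) (at z0)"
  proof (rule has_derivative_integral_dominated[OF r(1)])
    fix z \<zeta> assume z: "z \<in> ball z0 r" and s: "\<zeta> \<in> space \<mu>"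
    have n1: "norm \<zeta> \<le> 1" using s sp by auto
    have ne: "1 - cdot z \<zeta> \<noteq> 0" using one_minus_cdot_nonzero[OF n1] zr[OF z] r by auto
    have d: "((\<lambda>z. cdot z \<zeta>) has_derivative (\<lambda>v. cdot v \<zeta>)) (at z)"
      by (rule bounded_linear_imp_has_derivative[OF bounded_linear_cdot_left])
    have "((\<lambda>x. 1 / (1 - x) ^ CARD('n) * g \<zeta>) has_field_derivative
        of_nat CARD('n) / (1 - cdot z \<zeta>) ^ (CARD('n) + 1) * g \<zeta>) (at (cdot z \<zeta>))"
      using DERIV_cmult_right[OF has_field_derivative_inverse_power[of "cdot z \<zeta>" "CARD('n)"]] ne by simp
    from has_derivative_compose[OF d this[unfolded has_field_derivative_def]]
    show "((\<lambda>z. cauchy_kernel z \<zeta> * g \<zeta>) has_derivative D z \<zeta>) (at z)"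
      unfolding cauchy_kernel_def D_def by (simp add: mult_ac)
    fix v
    have ge: "1 - \<rho> \<le> cmod (1 - cdot z \<zeta>)" using norm_one_minus_cdot_ge[OF n1, of z] zr[OF z] by linarith
    have "cmod (cdot v \<zeta>) \<le> norm v" using norm_cdot_le[of v \<zeta>] n1 by (metis mult_left_le norm_ge_zero order_trans)
    then have "of_nat CARD('n) * cmod (cdot v \<zeta>) / cmod (1 - cdot z \<zeta>) ^ (CARD('n) + 1) \<le> CARD('n) * norm v / (1 - \<rho>) ^ (CARD('n) + 1)"
      using r ge by (intro frac_le mult_left_mono power_mono) auto
    then have "of_nat CARD('n) * cmod (cdot v \<zeta>) / cmod (1 - cdot z \<zeta>) ^ (CARD('n) + 1) * cmod (g \<zeta>) \<le> CARD('n) * norm v / (1 - \<rho>) ^ (CARD('n) + 1) * cmod (g \<zeta>)"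
      by (rule mult_right_mono) auto
    then show "cmod (D z \<zeta> v) \<le> (CARD('n) / (1 - \<rho>) ^ (CARD('n) + 1) * cmod (g \<zeta>)) * norm v"
      by (simp add: D_def norm_mult norm_divide norm_power mult_ac)
  next
    show "integrable \<mu> (\<lambda>\<zeta>. CARD('n) / (1 - \<rho>) ^ (CARD('n) + 1) * cmod (g \<zeta>))"
      using g by simp
  next
    fix z assume z: "z \<in> ball z0 r"
    show "integrable \<mu> (\<lambda>\<zeta>. cauchy_kernel z \<zeta> * g \<zeta>)"
    proof (rule Bochner_Integration.integrable_bound[OF integrable_mult_right[OF integrable_norm[OF g]]])
      show "(\<lambda>\<zeta>. cauchy_kernel z \<zeta> * g \<zeta>) \<in> borel_measurable \<mu>" using g sets by measurable
      show "AE \<zeta> in \<mu>. norm (cauchy_kernel z \<zeta> * g \<zeta>) \<le> norm (1 / (1 - \<rho>) ^ CARD('n) * norm (g \<zeta>))"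
      proof (intro AE_I2)
        fix \<zeta> assume "\<zeta> \<in> space \<mu>"
        then have "cmod (cauchy_kernel z \<zeta>) \<le> 1 / (1 - \<rho>) ^ CARD('n)"
          by (intro norm_cauchy_kernel_le[OF _ zr[OF z] r(2)]) (use sp in auto)
        then show "norm (cauchy_kernel z \<zeta> * g \<zeta>) \<le> norm (1 / (1 - \<rho>) ^ CARD('n) * norm (g \<zeta>))"
          using r(2) mult_right_mono[of "cmod (cauchy_kernel z \<zeta>)" "1 / (1 - \<rho>) ^ CARD('n)" "norm (g \<zeta>)"]
          by (simp add: norm_mult)
      qed
    qed
  qed
  moreover have "(\<integral>\<zeta>. D z0 \<zeta> (c *s v) \<partial>\<mu>) = c * (\<integral>\<zeta>. D z0 \<zeta> v \<partial>\<mu>)" for c v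
    by (subst integral_mult_right_zero[symmetric]) (simp add: D_def cdot_smult_left mult_ac)
  ultimately show "\<exists>f'. ((\<lambda>z. \<integral>\<zeta>. cauchy_kernel z \<zeta> * g \<zeta> \<partial>\<mu>) has_derivative f') (at z0) \<and> (\<forall>c v. f' (c *s v) = c * f' v)"
    by blast
qed

lemma holomorphic_on_ball_mult:
  fixes f g :: "complex ^ 'n \<Rightarrow> complex"
  assumes "holomorphic_on_ball f" "holomorphic_on_ball g"
  shows "holomorphic_on_ball (\<lambda>z. f z * g z)"
  unfolding holomorphic_on_ball_def
proof
  fix z :: "complex ^ 'n" assume z: "z \<in> ball 0 1"
  obtain f' where f: "(f has_derivative f') (at z)" "\<And>c v. f' (c *s v) = c * f' v"
    using holomorphic_on_ballE[OF assms(1) z] by blast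
  obtain g' where g: "(g has_derivative g') (at z)" "\<And>c v. g' (c *s v) = c * g' v"
    using holomorphic_on_ballE[OF assms(2) z] by blast
  show "\<exists>h'. ((\<lambda>z. f z * g z) has_derivative h') (at z) \<and> (\<forall>c v. h' (c *s v) = c * h' v)"
    by (rule exI[of _ "\<lambda>v. f z * g' v + f' v * g z"])
       (use has_derivative_mult[OF f(1) g(1)] in \<open>simp add: f(2) g(2) algebra_simps\<close>)
qed

lemma holomorphic_on_ball_linear:
  fixes f :: "complex ^ 'n \<Rightarrow> complex"
  assumes "holomorphic_on_ball f"
  shows "holomorphic_on_ball (\<lambda>z. c + d * f z)"
  unfolding holomorphic_on_ball_def
proof
  fix z :: "complex ^ 'n" assume z: "z \<in> ball 0 1"
  obtain f' where f: "(f has_derivative f') (at z)" "\<And>c v. f' (c *s v) = c * f' v"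
    using holomorphic_on_ballE[OF assms(1) z] by blast
  show "\<exists>h'. ((\<lambda>z. c + d * f z) has_derivative h') (at z) \<and> (\<forall>c v. h' (c *s v) = c * h' v)"
    by (rule exI[of _ "\<lambda>v. d * f' v"]) (auto intro!: derivative_eq_intros f simp: f(2))
qed

lemma holomorphic_on_ball_power:
  fixes f :: "complex ^ 'n \<Rightarrow> complex"
  assumes "holomorphic_on_ball f"
  shows "holomorphic_on_ball (\<lambda>z. f z ^ k)"
proof (induction k)
  case 0 then show ?case using holomorphic_on_ball_linear[OF assms, of 1 0] by simp
next
  case (Suc k) then show ?case using holomorphic_on_ball_mult[OF assms Suc] by simp
qed

lemma holomorphic_on_ball_cut_off:
  fixes f :: "complex ^ 'n \<Rightarrow> complex"
  assumes "holomorphic_on_ball f"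
  shows "holomorphic_on_ball (cut_off (ball 0 1) f)"
  unfolding holomorphic_on_ball_def
proof
  fix z :: "complex ^ 'n" assume z: "z \<in> ball 0 1"
  obtain f' where f: "(f has_derivative f') (at z)" "\<And>c v. f' (c *s v) = c * f' v"
    using holomorphic_on_ballE[OF assms(1) z] by blast
  have "(cut_off (ball 0 1) f has_derivative f') (at z)"
    by (rule has_derivative_transform_within_open[OF f(1) open_ball z]) (simp add: cut_off_def)
  then show "\<exists>h'. (cut_off (ball 0 1) f has_derivative h') (at z) \<and> (\<forall>c v. h' (c *s v) = c * h' v)"
    using f(2) by blast
qed

lemma holomorphic_on_ball_continuous:
  "holomorphic_on_ball f \<Longrightarrow> continuous_on (ball 0 1) f"
  unfolding holomorphic_on_ball_def
  by (meson continuous_at_imp_continuous_on has_derivative_continuous)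

section \<open>Polarization of the Clark identity\<close>

lemma clark_measureD:
  assumes "clark_measure b \<alpha> (\<mu> :: (complex ^ 'n) measure)"
  shows "space \<mu> = sphere 0 1" "finite_measure \<mu>" "(\<lambda>x. x) \<in> borel_measurable \<mu>"
    "sets \<mu> = sets (restrict_space borel (sphere 0 1))"
proof -
  have s: "sets \<mu> = sets (restrict_space borel (sphere 0 1))"
    using assms by (simp add: clark_measure_def)
  then show "sets \<mu> = sets (restrict_space borel (sphere 0 1))" .
  show "space \<mu> = sphere 0 1"
    using sets_eq_imp_space_eq[OF s] by (simp add: space_restrict_space)
  show "finite_measure \<mu>" using assms by (simp add: clark_measure_def)
  have "(\<lambda>x. x) \<in> borel_measurable (restrict_space borel (sphere 0 1))"
    by (intro measurable_restrict_space1) simp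
  then show "(\<lambda>x. x) \<in> borel_measurable \<mu>"
    using measurable_cong_sets[OF s refl] by blast
qed

text \<open>The factor C(z, z) of the Poisson kernel is moved across, and unimodularity of \<alpha>
  splits |\<alpha> - b(z)|^2 into a holomorphic and an antiholomorphic factor. In this form the
  identity can be polarized.\<close>

lemma clark_identity_diagonal:
  fixes b :: "complex ^ 'n \<Rightarrow> complex"
  assumes \<alpha>: "cmod \<alpha> = 1" and \<mu>: "clark_measure b \<alpha> \<mu>" and z: "z \<in> ball 0 1"
  shows "(\<integral>\<zeta>. cauchy_kernel z \<zeta> * cauchy_kernel \<zeta> z \<partial>\<mu>) =
    dbr_kernel b z z / ((1 - cnj \<alpha> * b z) * (1 - \<alpha> * cnj (b z)))"
proof -
  have ne: "cauchy_kernel z z \<noteq> 0"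
    using one_minus_cdot_nonzero[of z z] z by (simp add: cauchy_kernel_def)
  have "(\<integral>\<zeta>. poisson_kernel z \<zeta> \<partial>\<mu>) = (\<integral>\<zeta>. cauchy_kernel z \<zeta> * cauchy_kernel \<zeta> z \<partial>\<mu>) / cauchy_kernel z z"
    by (simp add: poisson_kernel_def)
  moreover have "(\<integral>\<zeta>. poisson_kernel z \<zeta> \<partial>\<mu>) = complex_of_real ((1 - (cmod (b z))\<^sup>2) / (cmod (\<alpha> - b z))\<^sup>2)"
    using \<mu> z by (simp add: clark_measure_def)
  moreover have "complex_of_real (1 - (cmod (b z))\<^sup>2) = 1 - b z * cnj (b z)"
    by (simp add: complex_norm_square[symmetric])
  moreover have "complex_of_real ((cmod (\<alpha> - b z))\<^sup>2) = (1 - cnj \<alpha> * b z) * (1 - \<alpha> * cnj (b z))"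
  proof -
    have a: "\<alpha> * cnj \<alpha> = 1" using \<alpha> complex_norm_square[of \<alpha>] by simp
    have "complex_of_real ((cmod (\<alpha> - b z))\<^sup>2) = (\<alpha> - b z) * (cnj \<alpha> - cnj (b z))"
      by (simp only: complex_norm_square complex_cnj_diff)
    also have "\<dots> = (\<alpha> * cnj \<alpha>) * 1 - cnj \<alpha> * b z - \<alpha> * cnj (b z) + (\<alpha> * cnj \<alpha>) * b z * cnj (b z)"
      unfolding a by (simp add: algebra_simps a)
    also have "\<dots> = (1 - cnj \<alpha> * b z) * (1 - \<alpha> * cnj (b z))"
      unfolding a by (simp add: algebra_simps) (metis a mult.commute mult.left_commute mult.right_neutral)
    finally show ?thesis .
  qed
  ultimately show ?thesis
    using ne by (simp add: dbr_kernel_def field_simps del: of_real_power of_real_diff)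
qed

lemma one_minus_unimodular_mult_nonzero:
  assumes "cmod \<alpha> = 1" "cmod w < 1" shows "1 - \<alpha> * w \<noteq> 0"
proof -
  have "cmod (\<alpha> * w) < 1" using assms by (simp add: norm_mult)
  then show ?thesis by auto
qed

text \<open>Both sides are holomorphic in \<open>z\<close> and antiholomorphic in \<open>w\<close>, so the identity spreads
  from the diagonal. Along \<open>t \<mapsto> (x + i t y, x + i \<bar>t y)\<close> this is an identity theorem in
  one variable: real \<open>t\<close> gives diagonal points and \<open>t = -i\<close> gives \<open>(x + y, x - y)\<close>.\<close>

lemma clark_identity:
  fixes b :: "complex ^ 'n \<Rightarrow> complex"
  assumes b: "holomorphic_to_disc b" and \<alpha>: "cmod \<alpha> = 1" and \<mu>: "clark_measure b \<alpha> \<mu>"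
    and p: "p \<in> ball 0 1" and q: "q \<in> ball 0 1"
  shows "(\<integral>\<zeta>. cauchy_kernel p \<zeta> * cauchy_kernel \<zeta> q \<partial>\<mu>) =
    dbr_kernel b p q / ((1 - cnj \<alpha> * b p) * (1 - \<alpha> * cnj (b q)))"
proof -
  note \<mu>D = clark_measureD[OF \<mu>]
  note [measurable] = \<mu>D(3)
  have bh: "holomorphic_on_ball b" and bd: "\<And>z. z \<in> ball 0 1 \<Longrightarrow> cmod (b z) < 1"
    using b by (auto simp: holomorphic_to_disc_def)
  define F where "F z w = (\<integral>\<zeta>. cauchy_kernel z \<zeta> * cauchy_kernel \<zeta> w \<partial>\<mu>) -
    dbr_kernel b z w / ((1 - cnj \<alpha> * b z) * (1 - \<alpha> * cnj (b w)))" for z w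
  \<comment> \<open>Midpoint and half difference: \<open>x + y = p\<close> and
    \<open>x - y = q\<close>, so \<open>t = -\<i>\<close> hits the required pair.\<close>
  define x where "x = (1/2) *s (p + q)"
  define y where "y = (1/2) *s (p - q)"
  define \<rho> where "\<rho> = (1 + max (norm p) (norm q)) / 2"
  have \<rho>: "norm p < \<rho>" "norm q < \<rho>" "\<rho> < 1" using p q by (auto simp: \<rho>_def)
  define u where "u t = x + (\<i> * t) *s y" for t
  \<comment> \<open>Both moving points are confined to a ball of radius \<open>\<rho> < 1\<close>,
    which bounds the integrand uniformly. As an intersection of preimages of a ball under real
    affine maps, \<open>S\<close> is convex; containing \<open>-\<i>\<close> and
    \<open>\<i>\<close>, it contains 0.\<close>
  define S where "S = {t. u t \<in> ball 0 \<rho>} \<inter> {t. u (cnj t) \<in> ball 0 \<rho>}"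
  have contu: "continuous_on A u" for A unfolding u_def by (intro continuous_intros)
  have contuc: "continuous_on A (\<lambda>t. u (cnj t))" for A unfolding u_def by (intro continuous_intros)
  have S: "open S"
    unfolding S_def
    using open_vimage[OF open_ball contu, of 0 \<rho>] open_vimage[OF open_ball contuc, of 0 \<rho>]
    by (simp add: vimage_def open_Int)
  have ulin: "u ((1 - s) *\<^sub>R t1 + s *\<^sub>R t2) = (1 - s) *\<^sub>R u t1 + s *\<^sub>R u t2" for s t1 t2
    unfolding u_def scaleR_eq_smult by (simp add: vec_eq_iff scaleR_conv_of_real algebra_simps)
  have S1: "convex S"
  proof -
    have "convex {t. u t \<in> ball 0 \<rho>}" "convex {t. u (cnj t) \<in> ball 0 \<rho>}"
      using convexD_alt[OF convex_ball[of "0 :: complex ^ 'n" \<rho>]]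
      by (auto simp: convex_alt ulin simp del: mem_ball)
    then show ?thesis unfolding S_def by (rule convex_Int)
  qed
  have uS: "u t \<in> ball 0 1" "u (cnj t) \<in> ball 0 1" "norm (u t) \<le> \<rho>" "norm (u (cnj t)) \<le> \<rho>"
    if "t \<in> S" for t using that \<rho> by (auto simp: S_def)
  have cd1: "cdot (u t) \<zeta> = cdot x \<zeta> + \<i> * t * cdot y \<zeta>" for t \<zeta>
    by (simp add: u_def cdot_add_left cdot_smult_left)
  have cd2: "cdot \<zeta> (u (cnj t)) = cdot \<zeta> x - \<i> * t * cdot \<zeta> y" for t \<zeta>
    by (simp add: u_def cdot_add_right cdot_smult_right)
  have ne1: "1 - cdot (u t) \<zeta> \<noteq> 0" if "t \<in> S" "norm \<zeta> \<le> 1" for t \<zeta>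
    using one_minus_cdot_nonzero[OF that(2), of "u t"] uS[OF that(1)] by simp
  have ne2: "1 - cdot \<zeta> (u (cnj t)) \<noteq> 0" if "t \<in> S" "norm \<zeta> \<le> 1" for t \<zeta>
    using one_minus_cdot_nonzero[OF that(2), of "u (cnj t)"] uS[OF that(1)]
    by (simp add: cdot_commute[of "u (cnj t)" \<zeta>])
  have h1: "(\<lambda>t. \<integral>\<zeta>. cauchy_kernel (u t) \<zeta> * cauchy_kernel \<zeta> (u (cnj t)) \<partial>\<mu>) holomorphic_on S"
  proof (rule holomorphic_on_integral[OF \<mu>D(2) S, where B = "1 / (1 - \<rho>) ^ CARD('n) * (1 / (1 - \<rho>) ^ CARD('n))"])
    fix \<zeta> assume "\<zeta> \<in> space \<mu>"
    then have z: "norm \<zeta> \<le> 1" by (simp add: \<mu>D(1))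
    show "(\<lambda>t. cauchy_kernel (u t) \<zeta> * cauchy_kernel \<zeta> (u (cnj t))) holomorphic_on S"
      unfolding cauchy_kernel_def
      using ne1[OF _ z] ne2[OF _ z] unfolding cd1 cd2
      by (intro holomorphic_intros) auto
    fix t assume t: "t \<in> S"
    have "cmod (cauchy_kernel (u t) \<zeta>) \<le> 1 / (1 - \<rho>) ^ CARD('n)"
      by (rule norm_cauchy_kernel_le[OF z uS(3)[OF t] \<rho>(3)])
    moreover have "cmod (cauchy_kernel \<zeta> (u (cnj t))) \<le> 1 / (1 - \<rho>) ^ CARD('n)"
      using norm_cauchy_kernel_le[OF z uS(4)[OF t] \<rho>(3)]
      by (metis cauchy_kernel_cnj complex_mod_cnj)
    ultimately show "cmod (cauchy_kernel (u t) \<zeta> * cauchy_kernel \<zeta> (u (cnj t))) \<le> 1 / (1 - \<rho>) ^ CARD('n) * (1 / (1 - \<rho>) ^ CARD('n))"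
      unfolding norm_mult using \<rho>(3) by (intro mult_mono) auto
  next
    fix t
    show "(\<lambda>\<zeta>. cauchy_kernel (u t) \<zeta> * cauchy_kernel \<zeta> (u (cnj t))) \<in> borel_measurable \<mu>"
      by measurable
  qed
  have bu: "(\<lambda>t. b (u t)) holomorphic_on {t. u t \<in> ball 0 1}"
  proof -
    have eq: "u t = x + t *s (\<i> *s y)" for t by (simp add: u_def vector_smult_assoc mult.commute)
    show ?thesis unfolding eq by (rule holomorphic_on_ball_line[OF bh])
  qed
  have bu1: "(\<lambda>t. b (u t)) holomorphic_on S"
    by (rule holomorphic_on_subset[OF bu]) (use uS in auto)
  have bu2: "(\<lambda>t. cnj (b (u (cnj t)))) holomorphic_on S"
  proof -
    have "(\<lambda>t. b (u t)) holomorphic_on cnj ` S"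
      by (rule holomorphic_on_subset[OF bu]) (use uS in auto)
    from holomorphic_on_compose_cnj_cnj[OF this S] show ?thesis by (simp add: o_def)
  qed
  have h2: "(\<lambda>t. dbr_kernel b (u t) (u (cnj t)) / ((1 - cnj \<alpha> * b (u t)) * (1 - \<alpha> * cnj (b (u (cnj t)))))) holomorphic_on S"
  proof -
    have nz: "1 - cdot (u t) (u (cnj t)) \<noteq> 0" if "t \<in> S" for t
      by (rule ne1[OF that]) (use uS[OF that] \<rho>(3) in linarith)
    have eq: "cdot (u t) (u (cnj t)) = cdot x x + \<i> * t * cdot y x - \<i> * t * (cdot x y + \<i> * t * cdot y y)" for t
      unfolding cd2 by (simp add: cd1)
    have "(\<lambda>t. cauchy_kernel (u t) (u (cnj t))) holomorphic_on S"
      unfolding cauchy_kernel_def using nz unfolding eq by (intro holomorphic_intros) auto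
    then show ?thesis unfolding dbr_kernel_def
      using one_minus_unimodular_mult_nonzero[of "cnj \<alpha>"] one_minus_unimodular_mult_nonzero[of \<alpha>] \<alpha> bd uS
      by (intro holomorphic_intros bu1 bu2) auto
  qed
  have "F (u (-\<i>)) (u (cnj (-\<i>))) = 0"
  proof (rule analytic_continuation[where f = "\<lambda>t. F (u t) (u (cnj t))" and S = S and U = "S \<inter> \<real>" and \<xi> = 0])
    show "(\<lambda>t. F (u t) (u (cnj t))) holomorphic_on S"
      unfolding F_def by (intro holomorphic_intros h1 h2)
    show "open S" by fact
    show "connected S" using S1 by (rule convex_connected)
    have up: "u (-\<i>) = p" "u \<i> = q"
      by (simp_all add: u_def x_def y_def vec_eq_iff field_simps)
    show "-\<i> \<in> S" using \<rho> by (simp add: S_def up)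
    have "\<i> \<in> S" using \<rho> by (simp add: S_def up)
    then have "(1 - 1/2) *\<^sub>R (-\<i>) + (1/2) *\<^sub>R \<i> \<in> S"
      using convexD_alt[OF S1 \<open>-\<i> \<in> S\<close>, of \<i> "1/2"] by simp
    then show 0: "0 \<in> S" by (simp add: scaleR_conv_of_real)
    show "0 islimpt S \<inter> \<real>"
      unfolding islimpt_approachable
    proof (intro allI impI)
      fix e :: real assume e: "e > 0"
      obtain d where d: "d > 0" "ball 0 d \<subseteq> S" using S 0 openE by blast
      have "complex_of_real (min e d / 2) \<in> ball 0 d" using d e by (simp add: norm_of_real)
      then show "\<exists>x'\<in>S \<inter> \<real>. x' \<noteq> 0 \<and> dist x' 0 < e"
        using d e by (intro bexI[of _ "complex_of_real (min e d / 2)"]) auto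
    qed
    show "F (u t) (u (cnj t)) = 0" if "t \<in> S \<inter> \<real>" for t
    proof -
      have c: "cnj t = t" using that by (simp add: Reals_cnj_iff)
      show ?thesis unfolding F_def c
        using clark_identity_diagonal[OF \<alpha> \<mu>, of "u t"] uS that by simp
    qed
  qed auto
  moreover have "u (-\<i>) = p" "u (cnj (-\<i>)) = q"
    by (simp_all add: u_def x_def y_def vec_eq_iff field_simps)
  ultimately show ?thesis by (simp add: F_def)
qed

section \<open>Invariance of the measure on the sphere\<close>

lemma nn_integral_lborel_plus:
  fixes h :: "'a :: euclidean_space \<Rightarrow> ennreal"
  assumes [measurable]: "h \<in> borel_measurable borel"
  shows "(\<integral>\<^sup>+x. h (a + x) \<partial>lborel) = (\<integral>\<^sup>+x. h x \<partial>lborel)"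
  using nn_integral_distr[of "(+) a" lborel borel h] by (simp add: lborel_distr_plus)

lemma emeasure_lborel_unit_ball:
  "emeasure lborel (ball (0 :: 'a :: euclidean_space) 1) \<noteq> 0"
  "emeasure lborel (ball (0 :: 'a :: euclidean_space) 1) \<noteq> \<infinity>"
proof -
  show "emeasure lborel (ball (0 :: 'a :: euclidean_space) 1) \<noteq> 0"
    by (subst emeasure_ball) (auto simp: unit_ball_vol_pos less_imp_neq[symmetric] simp flip: ennreal_power)
  show "emeasure lborel (ball (0 :: 'a :: euclidean_space) 1) \<noteq> \<infinity>"
    using emeasure_lborel_ball_finite[of "0::'a" 1] by simp
qed

text \<open>The uniqueness argument for Haar measure: the push-forward is translation invariant,
  and comparing it with Lebesgue measure through Fubini leaves only a constant factor, which
  is 1 because the unit ball is preserved.\<close>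

lemma emeasure_linear_isometry_vimage_uminus:
  fixes T :: "'a :: euclidean_space \<Rightarrow> 'a"
  assumes lin: "linear T" and iso: "\<And>x. norm (T x) = norm x" and A: "A \<in> sets borel"
  shows "emeasure lborel (T -` A) = emeasure lborel (uminus -` A)"
proof -
  have T [measurable]: "T \<in> borel_measurable borel"
    using lin by (intro borel_measurable_continuous_onI linear_continuous_on)
      (simp add: linear_conv_bounded_linear)
  have "inj T"
    using iso by (intro linear_injective_0[THEN iffD2, OF lin]) (metis norm_eq_zero)
  then have "surj T" using linear_injective_imp_surjective[OF lin] by blast
  then obtain S where S: "\<And>y. T (S y) = y" by (metis surjD)
  define f :: "'a \<Rightarrow> ennreal" where "f = indicator A"
  define g :: "'a \<Rightarrow> ennreal" where "g = indicator (ball 0 1)"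
  have fm [measurable]: "f \<in> borel_measurable borel" and gm [measurable]: "g \<in> borel_measurable borel"
    unfolding f_def g_def using A by (auto intro!: borel_measurable_indicator)
  have gT: "g (T x) = g x" for x by (simp add: g_def indicator_def iso)
  have "(\<integral>\<^sup>+x. f (T x) \<partial>lborel) * (\<integral>\<^sup>+y. g y \<partial>lborel) = (\<integral>\<^sup>+x. (\<integral>\<^sup>+y. f (T x) * g y \<partial>lborel) \<partial>lborel)"
    by (simp add: nn_integral_cmult nn_integral_multc)
  also have "\<dots> = (\<integral>\<^sup>+x. (\<integral>\<^sup>+y. f (T x) * g (T x + y) \<partial>lborel) \<partial>lborel)"
    by (rule nn_integral_cong) (simp add: nn_integral_cmult nn_integral_lborel_plus)
  also have "\<dots> = (\<integral>\<^sup>+y. (\<integral>\<^sup>+x. f (T x) * g (T x + y) \<partial>lborel) \<partial>lborel)"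
    by (rule lborel_pair.Fubini'[symmetric]) simp
  also have "\<dots> = (\<integral>\<^sup>+y. (\<integral>\<^sup>+x. f (T x - y) * g (T x) \<partial>lborel) \<partial>lborel)"
  proof (rule nn_integral_cong)
    \<comment> \<open>Translating \<open>x\<close> by \<open>- S y\<close> removes the shift inside
      \<open>g\<close> and moves it into \<open>f\<close>. The later translation of \<open>y\<close>
      by \<open>T x\<close> then separates the two integrals, at the price of a reflection in
      \<open>f\<close>.\<close>
    fix y
    have "(\<integral>\<^sup>+x. f (T x) * g (T x + y) \<partial>lborel) = (\<integral>\<^sup>+x. f (T (- S y + x)) * g (T (- S y + x) + y) \<partial>lborel)"
      by (rule nn_integral_lborel_plus[symmetric]) simp
    then show "(\<integral>\<^sup>+x. f (T x) * g (T x + y) \<partial>lborel) = (\<integral>\<^sup>+x. f (T x - y) * g (T x) \<partial>lborel)"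
      by (simp add: linear_diff[OF lin] S)
  qed
  also have "\<dots> = (\<integral>\<^sup>+x. (\<integral>\<^sup>+y. f (T x - y) * g (T x) \<partial>lborel) \<partial>lborel)"
    by (rule lborel_pair.Fubini') simp
  also have "\<dots> = (\<integral>\<^sup>+x. (\<integral>\<^sup>+y. f (- y) \<partial>lborel) * g x \<partial>lborel)"
  proof (rule nn_integral_cong)
    fix x
    have "(\<integral>\<^sup>+y. f (T x - y) \<partial>lborel) = (\<integral>\<^sup>+y. f (T x - (T x + y)) \<partial>lborel)"
      by (rule nn_integral_lborel_plus[symmetric]) simp
    also have "\<dots> = (\<integral>\<^sup>+y. f (- y) \<partial>lborel)" by simp
    finally show "(\<integral>\<^sup>+y. f (T x - y) * g (T x) \<partial>lborel) = (\<integral>\<^sup>+y. f (- y) \<partial>lborel) * g x"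
      by (simp add: nn_integral_multc gT)
  qed
  also have "\<dots> = (\<integral>\<^sup>+y. f (- y) \<partial>lborel) * (\<integral>\<^sup>+y. g y \<partial>lborel)"
    by (simp add: nn_integral_cmult)
  finally have eq: "(\<integral>\<^sup>+x. f (T x) \<partial>lborel) * (\<integral>\<^sup>+y. g y \<partial>lborel) = (\<integral>\<^sup>+y. f (- y) \<partial>lborel) * (\<integral>\<^sup>+y. g y \<partial>lborel)" .
  have gv: "(\<integral>\<^sup>+y. g y \<partial>lborel) = emeasure lborel (ball (0::'a) 1)" by (simp add: g_def)
  have "(\<integral>\<^sup>+x. f (T x) \<partial>lborel) = (\<integral>\<^sup>+y. f (- y) \<partial>lborel)"
    using eq emeasure_lborel_unit_ball[where 'a = 'a] unfolding gv by (metis mult_divide_eq_ennreal infinity_ennreal_def)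
  moreover have "(\<lambda>x. f (T x)) = indicator (T -` A)" "(\<lambda>x. f (- x)) = indicator (uminus -` A)"
    by (auto simp: f_def indicator_def)
  moreover have "T -` A \<in> sets lborel" "uminus -` A \<in> sets lborel"
    using measurable_sets[OF T A] measurable_sets[of "uminus :: 'a \<Rightarrow> 'a" borel borel A] A by simp_all
  ultimately show ?thesis by simp
qed

text \<open>The preceding comparison gives the same reflected set for every isometry; using it for
  \<open>T\<close> and for the identity removes the reflection.\<close>

lemma emeasure_linear_isometry_vimage:
  fixes T :: "'a :: euclidean_space \<Rightarrow> 'a"
  assumes "linear T" "\<And>x. norm (T x) = norm x" "A \<in> sets borel"
  shows "emeasure lborel (T -` A) = emeasure lborel A"
  using emeasure_linear_isometry_vimage_uminus[OF assms]
    emeasure_linear_isometry_vimage_uminus[OF linear_id _ assms(3)] by simp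

section \<open>The normalized measure on the sphere\<close>

lemma space_sphere_measure [simp]: "space sphere_measure = (sphere 0 1 :: (complex ^ 'n) set)"
  by (simp add: sphere_measure_def space_restrict_space)

lemma sets_sphere_measure:
  "sets (sphere_measure :: (complex ^ 'n) measure) = sets (restrict_space borel (sphere 0 1))"
  unfolding sphere_measure_def by (rule sets_restrict_space_cong) simp

lemma borel_measurable_sphereI:
  fixes f :: "complex ^ 'n \<Rightarrow> 'b :: topological_space"
  assumes "sets M = sets (restrict_space borel (sphere 0 1 :: (complex ^ 'n) set))"
    and "continuous_on (sphere 0 1) f"
  shows "f \<in> borel_measurable M"
  using borel_measurable_continuous_on_restrict[OF assms(2)] measurable_cong_sets[OF assms(1) refl]
  by blast

lemma emeasure_sphere_measure:
  fixes A :: "(complex ^ 'n) set"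
  assumes A: "A \<in> sets borel" "A \<subseteq> sphere 0 1"
  shows "emeasure sphere_measure A =
    emeasure lborel (ball 0 1 \<inter> (\<lambda>x. x /\<^sub>R norm x) -` A) / emeasure lborel (ball (0 :: complex ^ 'n) 1)"
proof -
  have N: "(\<lambda>x :: complex ^ 'n. x /\<^sub>R norm x) \<in> borel_measurable borel" by measurable
  have "emeasure sphere_measure A = emeasure (distr (uniform_measure lborel (ball 0 1)) borel (\<lambda>x. x /\<^sub>R norm x)) A"
    unfolding sphere_measure_def using A by (intro emeasure_restrict_space) auto
  also have "\<dots> = emeasure (uniform_measure lborel (ball 0 1)) ((\<lambda>x. x /\<^sub>R norm x) -` A)"
    using A by (subst emeasure_distr) auto
  also have "\<dots> = emeasure lborel (ball 0 1 \<inter> (\<lambda>x. x /\<^sub>R norm x) -` A) / emeasure lborel (ball (0 :: complex ^ 'n) 1)"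
    using measurable_sets[OF N A(1)] by (subst emeasure_uniform_measure) auto
  finally show ?thesis .
qed

lemma emeasure_sphere_measure_sphere [simp]:
  "emeasure (sphere_measure :: (complex ^ 'n) measure) (sphere 0 1) = 1"
proof -
  have eq: "ball 0 1 \<inter> (\<lambda>x. x /\<^sub>R norm x) -` sphere 0 1 = ball 0 1 - {0 :: complex ^ 'n}"
    by auto
  have "emeasure lborel (ball 0 1 - {0 :: complex ^ 'n}) = emeasure lborel (ball (0 :: complex ^ 'n) 1)"
    by (intro emeasure_Diff_null_set) auto
  then show ?thesis
    using emeasure_lborel_unit_ball[where 'a = "complex ^ 'n"]
    by (simp add: emeasure_sphere_measure eq ennreal_divide_self less_top)
qed

lemma finite_measure_sphere_measure: "finite_measure (sphere_measure :: (complex ^ 'n) measure)"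
  by (rule finite_measureI) simp

lemma measure_sphere_measure_sphere [simp]:
  "measure (sphere_measure :: (complex ^ 'n) measure) (sphere 0 1) = 1"
  by (simp add: measure_def)

text \<open>Radial normalization commutes with a linear isometry, so the cone over a preimage is the
  preimage of the cone, and invariance of Lebesgue measure applies.\<close>

lemma distr_sphere_measure_isometry:
  fixes T :: "complex ^ 'n \<Rightarrow> complex ^ 'n"
  assumes lin: "linear T" and iso: "\<And>x. norm (T x) = norm x"
  shows "distr sphere_measure sphere_measure T = sphere_measure"
proof (rule measure_eqI)
  fix A assume "A \<in> sets (distr sphere_measure sphere_measure T)"
  then have "A \<in> sets (restrict_space borel (sphere 0 1))" by (simp add: sets_sphere_measure)
  then have A: "A \<in> sets borel" "A \<subseteq> sphere 0 1"
    by (auto simp: sets_restrict_space_iff)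
  have T [measurable]: "T \<in> borel_measurable borel"
    using lin by (intro borel_measurable_continuous_onI linear_continuous_on)
      (simp add: linear_conv_bounded_linear)
  have N: "(\<lambda>x :: complex ^ 'n. x /\<^sub>R norm x) \<in> borel_measurable borel" by measurable
  have TS: "T \<in> measurable sphere_measure sphere_measure"
    using measurable_restrict_space3[OF T, of "sphere 0 1" "sphere 0 1"] iso
    by (simp add: measurable_cong_sets[OF sets_sphere_measure sets_sphere_measure] Pi_def)
  have sub: "T -` A \<subseteq> sphere 0 1" using A(2) iso by force
  have TA: "T -` A \<in> sets borel" using measurable_sets[OF T A(1)] by simp
  have NA: "(\<lambda>x :: complex ^ 'n. x /\<^sub>R norm x) -` A \<in> sets borel" using measurable_sets[OF N A(1)] by simp
  have "emeasure (distr sphere_measure sphere_measure T) A = emeasure sphere_measure (T -` A \<inter> sphere 0 1)"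
    by (subst emeasure_distr[OF TS]) (auto simp: sets_sphere_measure sets_restrict_space_iff A)
  also have "T -` A \<inter> sphere 0 1 = T -` A" using sub by blast
  also have "emeasure sphere_measure (T -` A) =
      emeasure lborel (ball 0 1 \<inter> (\<lambda>x. x /\<^sub>R norm x) -` T -` A) / emeasure lborel (ball (0 :: complex ^ 'n) 1)"
    by (rule emeasure_sphere_measure[OF TA sub])
  also have "ball 0 1 \<inter> (\<lambda>x. x /\<^sub>R norm x) -` T -` A = T -` (ball 0 1 \<inter> (\<lambda>x. x /\<^sub>R norm x) -` A)"
    by (auto simp: iso linear_cmul[OF lin])
  also have "emeasure lborel \<dots> = emeasure lborel (ball 0 1 \<inter> (\<lambda>x. x /\<^sub>R norm x) -` A)"
    using NA by (intro emeasure_linear_isometry_vimage[OF lin iso]) auto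
  also have "emeasure lborel (ball 0 1 \<inter> (\<lambda>x. x /\<^sub>R norm x) -` A) / emeasure lborel (ball (0 :: complex ^ 'n) 1) = emeasure sphere_measure A"
    by (rule emeasure_sphere_measure[OF A, symmetric])
  finally show "emeasure (distr sphere_measure sphere_measure T) A = emeasure sphere_measure A" .
qed simp

lemma integral_sphere_measure_isometry:
  fixes T :: "complex ^ 'n \<Rightarrow> complex ^ 'n" and g :: "complex ^ 'n \<Rightarrow> complex"
  assumes lin: "linear T" and iso: "\<And>x. norm (T x) = norm x"
    and g: "g \<in> borel_measurable sphere_measure"
  shows "(\<integral>\<eta>. g (T \<eta>) \<partial>sphere_measure) = (\<integral>\<eta>. g \<eta> \<partial>sphere_measure)"
proof -
  have T: "T \<in> borel_measurable borel"
    using lin by (intro borel_measurable_continuous_onI linear_continuous_on)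
      (simp add: linear_conv_bounded_linear)
  have TS: "T \<in> measurable sphere_measure sphere_measure"
    using measurable_restrict_space3[OF T, of "sphere 0 1" "sphere 0 1"] iso
    by (simp add: measurable_cong_sets[OF sets_sphere_measure sets_sphere_measure] Pi_def)
  show ?thesis
    using integral_distr[OF TS g] by (simp add: distr_sphere_measure_isometry[OF lin iso])
qed

text \<open>For a unit vector \<open>u\<close>: the identity on the complex line of \<open>u\<close>
  and multiplication by \<open>c\<close> on its orthogonal complement. It is unitary for |c| = 1 and
  the orthogonal projection onto the line for c = 0, with holomorphic dependence on \<open>c\<close>
  in between.\<close>

definition rotate_about :: "complex ^ 'n \<Rightarrow> complex \<Rightarrow> complex ^ 'n \<Rightarrow> complex ^ 'n" where
  "rotate_about u c \<eta> = cdot \<eta> u *s u + c *s (\<eta> - cdot \<eta> u *s u)"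

lemma linear_rotate_about: "linear (rotate_about u c)"
  by (rule linearI)
     (simp_all add: rotate_about_def cdot_add_left cdot_smult_left vec_eq_iff algebra_simps,
      simp add: scaleR_eq_smult cdot_smult_left scaleR_conv_of_real algebra_simps)

lemma cdot_rotate_about:
  assumes u: "norm u = 1" shows "cdot (rotate_about u c \<eta>) u = cdot \<eta> u"
proof -
  have "cdot u u = 1" using u by (simp add: cdot_self)
  then show ?thesis
    by (simp add: rotate_about_def cdot_add_left cdot_smult_left cdot_diff_left)
qed

lemma cdot_rotate_about_orthogonal:
  assumes u: "norm u = 1" and v: "cdot u v = 0"
  shows "cdot (rotate_about u c \<eta>) v = c * cdot \<eta> v"
  using v by (simp add: rotate_about_def cdot_add_left cdot_smult_left cdot_diff_left)

text \<open>Pythagoras. It gives the isometry for |c| = 1 and also keeps the points with |c| < R'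
  inside the ball of radius R' when the rotation parameter leaves the circle.\<close>

lemma norm_orthogonal_split:
  assumes u: "norm u = 1"
  shows "(norm (cdot \<eta> u *s u + c *s (\<eta> - cdot \<eta> u *s u)))\<^sup>2 = (cmod (cdot \<eta> u))\<^sup>2 + (cmod c)\<^sup>2 * ((norm \<eta>)\<^sup>2 - (cmod (cdot \<eta> u))\<^sup>2)"
proof -
  have uu: "cdot u u = 1" using u by (simp add: cdot_self)
  have "complex_of_real ((norm (cdot \<eta> u *s u + c *s (\<eta> - cdot \<eta> u *s u)))\<^sup>2) =
    cdot \<eta> u * cnj (cdot \<eta> u) + c * cnj c * (cdot \<eta> \<eta> - cdot \<eta> u * cnj (cdot \<eta> u))"
    unfolding cdot_self[symmetric]
    by (simp add: cdot_add_left cdot_add_right cdot_diff_left cdot_diff_right cdot_smult_left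
        cdot_smult_right uu cdot_commute[of u \<eta>] algebra_simps)
  also have "\<dots> = complex_of_real ((cmod (cdot \<eta> u))\<^sup>2 + (cmod c)\<^sup>2 * ((norm \<eta>)\<^sup>2 - (cmod (cdot \<eta> u))\<^sup>2))"
    by (simp only: complex_norm_square[symmetric] cdot_self of_real_add of_real_mult of_real_diff)
  finally show ?thesis by (simp only: of_real_eq_iff)
qed

lemma norm_rotate_about:
  assumes "norm u = 1" "cmod c = 1" shows "norm (rotate_about u c \<eta>) = norm \<eta>"
  using norm_orthogonal_split[OF assms(1), of \<eta> c] assms(2)
  by (simp add: rotate_about_def power2_eq_iff_nonneg)

lemma integral_rotate_about:
  fixes g :: "complex ^ 'n \<Rightarrow> complex"
  assumes "norm u = 1" "cmod c = 1" "g \<in> borel_measurable sphere_measure"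
  shows "(\<integral>\<eta>. g (rotate_about u c \<eta>) \<partial>sphere_measure) = (\<integral>\<eta>. g \<eta> \<partial>sphere_measure)"
  by (rule integral_sphere_measure_isometry[OF linear_rotate_about norm_rotate_about[OF assms(1,2)] assms(3)])

lemma integral_smult_sphere:
  fixes g :: "complex ^ 'n \<Rightarrow> complex"
  assumes "cmod c = 1" "g \<in> borel_measurable sphere_measure"
  shows "(\<integral>\<eta>. g (c *s \<eta>) \<partial>sphere_measure) = (\<integral>\<eta>. g \<eta> \<partial>sphere_measure)"
proof (rule integral_sphere_measure_isometry[OF _ _ assms(2)])
  show "linear (\<lambda>\<eta>. c *s (\<eta> :: complex ^ 'n))"
    by (rule linearI) (simp_all add: vec_eq_iff algebra_simps)
qed (simp add: norm_smult assms(1))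

section \<open>The Cauchy formula on the sphere\<close>

text \<open>Continuity plus holomorphy on all complex lines, equivalent to holomorphy by Osgood's
  lemma, is the form in which the one-variable arguments consume it. A radius R > 1 puts the sphere
  inside the domain, so that no boundary values arise.\<close>

definition line_holomorphic :: "real \<Rightarrow> (complex ^ 'n \<Rightarrow> complex) \<Rightarrow> bool" where
  "line_holomorphic R h \<longleftrightarrow> continuous_on (ball 0 R) h \<and>
     (\<forall>a v. (\<lambda>t. h (a + t *s v)) holomorphic_on {t. a + t *s v \<in> ball 0 R})"

text \<open>Dilation pushes the domain past the closed ball; functions on the open ball enter the
  sphere formulas only through their dilates.\<close>

lemma line_holomorphic_dilate:
  fixes f :: "complex ^ 'n \<Rightarrow> complex"
  assumes f: "holomorphic_on_ball f" and r: "0 < r" "r < 1"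
  shows "line_holomorphic (1 / r) (\<lambda>z. f (r *\<^sub>R z))"
  unfolding line_holomorphic_def
proof (intro conjI allI)
  have mem: "r *\<^sub>R z \<in> ball 0 1 \<longleftrightarrow> z \<in> ball 0 (1 / r)" for z :: "complex ^ 'n"
    using r by (simp add: field_simps)
  show "continuous_on (ball 0 (1 / r)) (\<lambda>z. f (r *\<^sub>R z))"
    by (rule continuous_on_compose2[OF holomorphic_on_ball_continuous[OF f]])
       (use r in \<open>auto intro!: continuous_intros simp: field_simps\<close>)
  fix a v :: "complex ^ 'n"
  have eq: "r *\<^sub>R (a + t *s v) = r *\<^sub>R a + t *s (r *\<^sub>R v)" for t
    by (simp add: vec_eq_iff scaleR_right_distrib)
  show "(\<lambda>t. f (r *\<^sub>R (a + t *s v))) holomorphic_on {t. a + t *s v \<in> ball 0 (1 / r)}"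
    using holomorphic_on_ball_line[OF f, of "r *\<^sub>R a" "r *\<^sub>R v"] unfolding eq[symmetric] mem .
qed

lemma line_holomorphic_cdot_power:
  "line_holomorphic R (\<lambda>z. cdot z v ^ k * cdot z w ^ l)"
  unfolding line_holomorphic_def
  by (auto simp: cdot_add_left cdot_smult_left intro!: continuous_intros holomorphic_intros)

lemma integrable_bounded_sphere:
  fixes f :: "complex ^ 'n \<Rightarrow> complex"
  assumes "f \<in> borel_measurable sphere_measure" "\<And>x. x \<in> sphere 0 1 \<Longrightarrow> cmod (f x) \<le> B"
  shows "integrable sphere_measure f"
  by (rule finite_measure.integrable_const_bound[OF finite_measure_sphere_measure, of _ B])
     (use assms in auto)

lemma integrable_bounded_finite:
  fixes f :: "'a \<Rightarrow> 'b :: {banach, second_countable_topology}"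
  assumes "finite_measure M" "f \<in> borel_measurable M" "\<And>x. x \<in> space M \<Longrightarrow> norm (f x) \<le> B"
  shows "integrable M f"
  by (rule finite_measure.integrable_const_bound[OF assms(1) _ assms(2), of B]) (use assms(3) in auto)

lemma integrable_continuous_on_sphere:
  fixes f :: "complex ^ 'n \<Rightarrow> 'b :: {banach, second_countable_topology}"
  assumes "finite_measure M" "sets M = sets (restrict_space borel (sphere 0 1 :: (complex ^ 'n) set))"
    and "continuous_on (sphere 0 1) f"
  shows "integrable M f"
proof -
  have "compact (f ` sphere 0 1)" by (intro compact_continuous_image assms) simp
  then obtain B where "\<And>y. y \<in> f ` sphere 0 1 \<Longrightarrow> norm y \<le> B"
    using compact_imp_bounded bounded_iff by metis
  moreover have "space M = sphere 0 1"
    using sets_eq_imp_space_eq[OF assms(2)] by (simp add: space_restrict_space)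
  ultimately show ?thesis
    by (intro integrable_bounded_finite[OF assms(1) borel_measurable_sphereI[OF assms(2,3)], of B]) auto
qed

lemmas integrable_continuous_sphere =
  integrable_continuous_on_sphere[OF finite_measure_sphere_measure sets_sphere_measure]

lemma sphere_id_measurable [measurable]: "(\<lambda>x. x) \<in> borel_measurable sphere_measure"
  by (rule borel_measurable_sphereI[OF sets_sphere_measure]) (intro continuous_intros)

text \<open>Rotating about the complex line through \<open>u\<close> leaves \<open>\<langle>\<eta>, u\<rangle>\<close> alone, so the integral is
  a holomorphic function of the rotation parameter which is constant on the circle.\<close>

lemma integral_project_line:
  fixes h :: "complex ^ 'n \<Rightarrow> complex" and W :: "complex \<Rightarrow> complex"
  assumes R: "R > 1" and h: "line_holomorphic R h" and u: "norm u = 1"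
    and W: "W \<in> borel_measurable borel" and Wb: "\<And>x. cmod x \<le> 1 \<Longrightarrow> cmod (W x) \<le> B"
  shows "(\<integral>\<eta>. W (cdot \<eta> u) * h \<eta> \<partial>sphere_measure) =
    (\<integral>\<eta>. W (cdot \<eta> u) * h (cdot \<eta> u *s u) \<partial>sphere_measure)"
proof -
  \<comment> \<open>An intermediate radius: \<open>h\<close> is bounded on the closed ball of radius
    \<open>R'\<close>, while the parameter disc of radius \<open>R' > 1\<close> still contains the
    unit circle.\<close>
  define R' where "R' = (1 + R) / 2"
  have R': "1 < R'" "R' < R" using R by (auto simp: R'_def)
  have ch: "continuous_on (ball 0 R) h"
    and hl: "\<And>a v. (\<lambda>t. h (a + t *s v)) holomorphic_on {t. a + t *s v \<in> ball 0 R}"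
    using h by (auto simp: line_holomorphic_def)
  obtain H where H: "\<And>x. norm x \<le> R' \<Longrightarrow> cmod (h x) \<le> H"
  proof -
    have "compact (h ` cball 0 R')"
      by (intro compact_continuous_image continuous_on_subset[OF ch]) (use R' in auto)
    then obtain H where "\<And>y. y \<in> h ` cball 0 R' \<Longrightarrow> norm y \<le> H"
      using compact_imp_bounded bounded_iff by metis
    then show ?thesis using that[of H] by auto
  qed
  define p where "p \<eta> = cdot \<eta> u *s u" for \<eta>
  define S where "S = ball (0 :: complex) R'"
  have nb: "norm (p \<eta> + t *s (\<eta> - p \<eta>)) \<le> R'" if "t \<in> S" "norm \<eta> = 1" for t \<eta>
  proof -
    have c: "(cmod (cdot \<eta> u))\<^sup>2 \<le> 1"
      using norm_cdot_le[of \<eta> u] u that by (simp add: power_le_one)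
    have "(norm (p \<eta> + t *s (\<eta> - p \<eta>)))\<^sup>2 = (cmod (cdot \<eta> u))\<^sup>2 + (cmod t)\<^sup>2 * (1 - (cmod (cdot \<eta> u))\<^sup>2)"
      using norm_orthogonal_split[OF u, of \<eta> t] that by (simp add: p_def)
    also have "\<dots> \<le> R'\<^sup>2 * (cmod (cdot \<eta> u))\<^sup>2 + R'\<^sup>2 * (1 - (cmod (cdot \<eta> u))\<^sup>2)"
    proof (intro add_mono mult_right_mono)
      show "(cmod (cdot \<eta> u))\<^sup>2 \<le> R'\<^sup>2 * (cmod (cdot \<eta> u))\<^sup>2"
        using R' mult_right_mono[of 1 "R'\<^sup>2" "(cmod (cdot \<eta> u))\<^sup>2"] one_le_power[of R' 2] by simp
      show "(cmod t)\<^sup>2 \<le> R'\<^sup>2" using that by (intro power_mono) (auto simp: S_def)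
    qed (use c in auto)
    also have "\<dots> = R'\<^sup>2" by (simp add: algebra_simps)
    finally show ?thesis using R' by (simp add: power2_le_iff_abs_le)
  qed
  define G where "G t = (\<integral>\<eta>. W (cdot \<eta> u) * h (p \<eta> + t *s (\<eta> - p \<eta>)) \<partial>sphere_measure)" for t
  have cp: "continuous_on A p" for A unfolding p_def by (intro continuous_intros)
  have Wm: "(\<lambda>\<eta>. W (cdot \<eta> u)) \<in> borel_measurable sphere_measure"
    by (rule measurable_compose[OF _ W]) measurable
  have hm: "(\<lambda>\<eta>. h (p \<eta> + t *s (\<eta> - p \<eta>))) \<in> borel_measurable sphere_measure" if "t \<in> S" for t
    by (rule borel_measurable_sphereI[OF sets_sphere_measure], rule continuous_on_compose2[OF ch])
       (use nb[OF that] R' in \<open>auto intro!: continuous_intros cp\<close>, smt (verit))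
  have Wb': "cmod (W (cdot \<eta> u)) \<le> B" if "norm \<eta> = 1" for \<eta>
    using norm_cdot_le[of \<eta> u] u that by (intro Wb) simp
  have G: "G holomorphic_on S"
    unfolding G_def
  proof (rule holomorphic_on_integral[OF finite_measure_sphere_measure, where B = "B * H"])
    show "open S" by (simp add: S_def)
    fix \<eta> :: "complex ^ 'n" assume "\<eta> \<in> space sphere_measure"
    then have e: "norm \<eta> = 1" by simp
    have "(\<lambda>t. h (p \<eta> + t *s (\<eta> - p \<eta>))) holomorphic_on S"
      by (rule holomorphic_on_subset[OF hl]) (use nb[OF _ e] R' in force)
    then show "(\<lambda>t. W (cdot \<eta> u) * h (p \<eta> + t *s (\<eta> - p \<eta>))) holomorphic_on S"
      by (intro holomorphic_intros)
    fix t assume t: "t \<in> S"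
    show "cmod (W (cdot \<eta> u) * h (p \<eta> + t *s (\<eta> - p \<eta>))) \<le> B * H"
      unfolding norm_mult using Wb'[OF e] H[OF nb[OF t e]] order_trans[OF norm_ge_zero Wb[of 0]]
      by (intro mult_mono) auto
  next
    fix t assume t: "t \<in> S"
    show "(\<lambda>\<eta>. W (cdot \<eta> u) * h (p \<eta> + t *s (\<eta> - p \<eta>))) \<in> borel_measurable sphere_measure"
      using Wm hm[OF t] by (rule borel_measurable_times)
  qed
  have S1: "1 \<in> S" using R' by (simp add: S_def)
  have circle: "G c = G 1" if c: "c \<in> sphere 0 1" for c
  proof -
    have m: "(\<lambda>\<eta>. W (cdot \<eta> u) * h (p \<eta> + 1 *s (\<eta> - p \<eta>))) \<in> borel_measurable sphere_measure"
      using Wm hm[OF S1] by (rule borel_measurable_times)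
    have c1: "cmod c = 1" using c by simp
    have "p (rotate_about u c \<eta>) = p \<eta>" for \<eta> by (simp add: p_def cdot_rotate_about[OF u])
    then show ?thesis
      using integral_rotate_about[OF u c1 m] unfolding G_def
      by (simp add: cdot_rotate_about[OF u]) (simp add: rotate_about_def p_def)
  qed
  have "G 0 - G 1 = 0"
  proof (rule analytic_continuation[where f = "\<lambda>t. G t - G 1" and S = S and U = "sphere 0 1" and \<xi> = 1])
    show "(\<lambda>t. G t - G 1) holomorphic_on S" by (intro holomorphic_intros G)
    show "sphere 0 1 \<subseteq> S" using R' by (auto simp: S_def)
    show "1 islimpt sphere (0::complex) 1"
    proof (rule connected_imp_perfect)
      have "1 \<in> sphere (0::complex) 1" "-1 \<in> sphere (0::complex) 1" by simp_all
      then show "sphere (0::complex) 1 \<noteq> {x}" for x by (metis one_neq_neg_one singletonD)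
    qed (auto intro: connected_sphere)
    show "G z - G 1 = 0" if "z \<in> sphere 0 1" for z using circle[OF that] by simp
  qed (use S1 R' in \<open>auto simp: S_def\<close>)
  then show ?thesis by (simp add: G_def p_def)
qed

text \<open>The integral of |\<open>cdot \<eta> u\<close>|^(2k), kept complex to fit the complex
  integrals. For a unit vector it turns out to be the reciprocal of a coefficient of (1 -
  x)^(-n).\<close>

definition sphere_moment :: "(complex ^ 'n) \<Rightarrow> nat \<Rightarrow> complex" where
  "sphere_moment u k = (\<integral>\<eta>. cnj (cdot \<eta> u) ^ k * cdot \<eta> u ^ k \<partial>sphere_measure)"

text \<open>After projection onto the line of \<open>u\<close>, homogeneity replaces h by
  \<open>cdot \<eta> u ^ k * h u\<close>.\<close>

lemma integral_power_project:
  fixes h :: "complex ^ 'n \<Rightarrow> complex"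
  assumes h: "line_holomorphic 2 h" and hom: "\<And>c. h (c *s u) = c ^ k * h u" and u: "norm u = 1"
  shows "(\<integral>\<eta>. cnj (cdot \<eta> u) ^ k * h \<eta> \<partial>sphere_measure) = sphere_moment u k * h u"
proof -
  have "(\<integral>\<eta>. cnj (cdot \<eta> u) ^ k * h \<eta> \<partial>sphere_measure) =
    (\<integral>\<eta>. cnj (cdot \<eta> u) ^ k * h (cdot \<eta> u *s u) \<partial>sphere_measure)"
    by (rule integral_project_line[OF _ h u, of "\<lambda>x. cnj x ^ k" 1])
       (auto simp: norm_power power_le_one intro!: borel_measurable_continuous_onI continuous_intros)
  also have "\<dots> = (\<integral>\<eta>. (cnj (cdot \<eta> u) ^ k * cdot \<eta> u ^ k) * h u \<partial>sphere_measure)"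
    by (simp add: hom mult.assoc)
  finally show ?thesis by (simp add: sphere_moment_def)
qed

text \<open>The mixed integral of \<open>cnj (cdot \<eta> u) ^ k * cdot \<eta> v ^ k\<close> is
  computed by projecting on \<open>u\<close> and, after conjugation, on \<open>v\<close>. Both
  answers carry the factor \<open>cdot u v ^ k\<close>, which may be cancelled.\<close>

lemma sphere_moment_eq:
  assumes u: "norm u = 1" and v: "norm v = 1" and uv: "cdot u v \<noteq> 0"
  shows "sphere_moment u k = sphere_moment v k"
proof -
  have *: "(\<integral>\<eta>. cnj (cdot \<eta> u) ^ k * cdot \<eta> v ^ k \<partial>sphere_measure) = sphere_moment u k * cdot u v ^ k"
    if "norm u = 1" for u v :: "complex ^ 'n"
    using integral_power_project[OF line_holomorphic_cdot_power[of 2 v k v 0] _ that, of k]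
    by (simp add: cdot_smult_left power_mult_distrib)
  have c: "cnj (\<integral>\<eta>. cnj (cdot \<eta> v) ^ k * cdot \<eta> u ^ k \<partial>sphere_measure) = (\<integral>\<eta>. cnj (cdot \<eta> u) ^ k * cdot \<eta> v ^ k \<partial>sphere_measure)" for u v :: "complex ^ 'n"
    by (subst Bochner_Integration.integral_cnj[symmetric]) (simp add: mult.commute)
  have "cnj (sphere_moment v k * cdot v u ^ k) = sphere_moment u k * cdot u v ^ k"
    using *[OF v, of u] *[OF u, of v] c[of v u] by simp
  moreover have "cnj (sphere_moment v k) = sphere_moment v k"
    unfolding sphere_moment_def by (rule c)
  ultimately show ?thesis using uv by (simp add: cdot_commute[of v u])
qed

text \<open>A rotation about \<open>u\<close> by \<open>c\<close> multiplies the integrand by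
  \<open>cnj c ^ m * c\<close> and preserves the integral; for m \<noteq> 1 this factor can be made
  -1.\<close>

lemma integral_mixed_vanish:
  fixes u v :: "complex ^ 'n"
  assumes u: "norm u = 1" and uv: "cdot u v = 0" and m: "m \<noteq> 1"
  shows "(\<integral>\<eta>. cnj (cdot \<eta> u) ^ i * cnj (cdot \<eta> v) ^ m * (cdot \<eta> u ^ j * cdot \<eta> v) \<partial>sphere_measure) = 0"
proof -
  obtain c :: complex where c: "cmod c = 1" "cnj c ^ m * c = -1"
  proof (cases m)
    case 0 then show ?thesis using that[of "-1"] by simp
  next
    case (Suc l)
    then have l: "l > 0" using m by simp
    define c where "c = cis (pi / l)"
    have "cnj c ^ l = cis (- pi)" using l by (simp add: c_def cis_cnj Complex.DeMoivre)
    moreover have "cnj c * c = 1" by (simp add: c_def cis_cnj cis_mult)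
    moreover have "cnj c ^ m * c = cnj c ^ l * (cnj c * c)" unfolding Suc by simp
    ultimately have "cnj c ^ m * c = -1" by (simp flip: cis_cnj)
    then show ?thesis using that[of c] by (simp add: c_def)
  qed
  let ?f = "\<lambda>\<eta>. cnj (cdot \<eta> u) ^ i * cnj (cdot \<eta> v) ^ m * (cdot \<eta> u ^ j * cdot \<eta> v)"
  have "?f \<in> borel_measurable sphere_measure"
    by (rule borel_measurable_sphereI[OF sets_sphere_measure]) (intro continuous_intros)
  from integral_rotate_about[OF u c(1) this]
  have "(\<integral>\<eta>. (cnj c ^ m * c) * ?f \<eta> \<partial>sphere_measure) = (\<integral>\<eta>. ?f \<eta> \<partial>sphere_measure)"
    by (simp add: cdot_rotate_about[OF u] cdot_rotate_about_orthogonal[OF u uv] power_mult_distrib mult_ac)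
  then show ?thesis unfolding c(2) by (simp add: equation_minus_iff)
qed

text \<open>The integral of cnj(\<open>cdot \<eta> (u + v)\<close>)^(k+1)
  \<open>cdot \<eta> u ^ k * cdot \<eta> v\<close> is computed twice: by projection on the unit
  direction \<open>U\<close> of \<open>u + v\<close>, and by binomial expansion, where the preceding
  lemma leaves only the term m = 1 with coefficient k + 1. All powers of the norm \<open>s\<close>
  cancel.\<close>

lemma integral_orthogonal_moment:
  fixes u v :: "complex ^ 'n"
  assumes u: "norm u = 1" and uv: "cdot u v = 0"
  shows "of_nat (Suc k) * (\<integral>\<eta>. cnj (cdot \<eta> u) ^ k * cnj (cdot \<eta> v) * (cdot \<eta> u ^ k * cdot \<eta> v) \<partial>sphere_measure)
    = sphere_moment u (Suc k) * cdot v v"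
proof -
  define s where "s = norm (u + v)"
  have uu: "cdot u u = 1" using u by (simp add: cdot_self)
  have vu: "cdot v u = 0" using uv by (simp add: cdot_commute[of v u])
  have "complex_of_real (s\<^sup>2) = 1 + complex_of_real ((norm v)\<^sup>2)"
    unfolding s_def cdot_self[symmetric] by (simp add: cdot_add_left cdot_add_right uu uv vu)
  then have "s\<^sup>2 = 1 + (norm v)\<^sup>2" by (metis of_real_1 of_real_add of_real_eq_iff)
  then have s: "s > 0" by (metis norm_ge_zero s_def add_pos_nonneg less_eq_real_def power_zero_numeral zero_le_power2 zero_less_one less_irrefl)
  define U where "U = (1 / complex_of_real s) *s (u + v)"
  have U: "norm U = 1" using s unfolding U_def norm_smult by (simp add: norm_divide s_def)
  have Uu: "cdot U u = 1 / s" by (simp add: U_def cdot_smult_left cdot_add_left uu vu)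
  have Uv: "cdot U v = cdot v v / s" by (simp add: U_def cdot_smult_left cdot_add_left uv)
  have U\<eta>: "complex_of_real s * cdot \<eta> U = cdot \<eta> u + cdot \<eta> v" for \<eta>
    using s by (simp add: U_def cdot_smult_right cdot_add_right field_simps)
  let ?h = "\<lambda>\<eta>. cdot \<eta> u ^ k * cdot \<eta> v"
  have h: "line_holomorphic 2 ?h" using line_holomorphic_cdot_power[of 2 u k v 1] by simp
  have I: "(\<integral>\<eta>. cnj (cdot \<eta> U) ^ Suc k * ?h \<eta> \<partial>sphere_measure) = sphere_moment U (Suc k) * ?h U"
    by (rule integral_power_project[OF h _ U]) (simp add: cdot_smult_left power_mult_distrib mult_ac)
  have t: "integrable sphere_measure (\<lambda>\<eta>. of_nat (Suc k choose m) * (cnj (cdot \<eta> u) ^ (Suc k - m) * cnj (cdot \<eta> v) ^ m * ?h \<eta>))" for m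
    by (intro integrable_continuous_sphere continuous_intros)
  have "(\<integral>\<eta>. (cnj (cdot \<eta> v) + cnj (cdot \<eta> u)) ^ Suc k * ?h \<eta> \<partial>sphere_measure) =
    (\<integral>\<eta>. (\<Sum>m\<le>Suc k. of_nat (Suc k choose m) * (cnj (cdot \<eta> u) ^ (Suc k - m) * cnj (cdot \<eta> v) ^ m * ?h \<eta>)) \<partial>sphere_measure)"
    unfolding binomial_ring sum_distrib_right by (simp add: mult_ac)
  also have "\<dots> = (\<Sum>m\<le>Suc k. \<integral>\<eta>. of_nat (Suc k choose m) * (cnj (cdot \<eta> u) ^ (Suc k - m) * cnj (cdot \<eta> v) ^ m * ?h \<eta>) \<partial>sphere_measure)"
    by (rule Bochner_Integration.integral_sum) (rule t)
  also have "\<dots> = (\<Sum>m\<le>Suc k. if m = 1 then of_nat (Suc k) * (\<integral>\<eta>. cnj (cdot \<eta> u) ^ k * cnj (cdot \<eta> v) * ?h \<eta> \<partial>sphere_measure) else 0)"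
    using integral_mixed_vanish[OF u uv] by (intro sum.cong refl) auto
  also have "\<dots> = of_nat (Suc k) * (\<integral>\<eta>. cnj (cdot \<eta> u) ^ k * cnj (cdot \<eta> v) * ?h \<eta> \<partial>sphere_measure)"
    by (subst sum.delta) auto
  finally have "of_nat (Suc k) * (\<integral>\<eta>. cnj (cdot \<eta> u) ^ k * cnj (cdot \<eta> v) * ?h \<eta> \<partial>sphere_measure) =
     (\<integral>\<eta>. (cnj (cdot \<eta> v) + cnj (cdot \<eta> u)) ^ Suc k * ?h \<eta> \<partial>sphere_measure)" ..
  also have "\<dots> = (\<integral>\<eta>. complex_of_real s ^ Suc k * (cnj (cdot \<eta> U) ^ Suc k * ?h \<eta>) \<partial>sphere_measure)"
  proof -
    have "cnj (cdot \<eta> v) + cnj (cdot \<eta> u) = complex_of_real s * cnj (cdot \<eta> U)" for \<eta>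
      using arg_cong[OF U\<eta>[of \<eta>], of cnj] by (simp add: add.commute)
    then show ?thesis by (simp only: power_mult_distrib mult.assoc)
  qed
  also have "\<dots> = complex_of_real s ^ Suc k * (sphere_moment U (Suc k) * ?h U)"
    by (simp only: integral_mult_right_zero I)
  also have "\<dots> = sphere_moment U (Suc k) * cdot v v"
    using s by (simp add: Uu Uv power_divide)
  also have "sphere_moment U (Suc k) = sphere_moment u (Suc k)"
    using s by (intro sphere_moment_eq U u) (simp add: Uu)
  finally show ?thesis .
qed

lemma cnj_measurable [measurable]:
  "f \<in> borel_measurable M \<Longrightarrow> (\<lambda>x. cnj (f x)) \<in> borel_measurable M"
  by (rule measurable_compose[where N = borel])
     (auto intro!: borel_measurable_continuous_onI continuous_intros)

text \<open>The preceding lemma is summed over the projections \<open>v j\<close> of the standard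
  basis onto the complement of \<open>u\<close>. On the sphere the squares
  |\<open>cdot \<eta> (v j)\<close>|^2 add up to 1 - |\<open>cdot \<eta> u\<close>|^2, and the
  squared norms of the \<open>v j\<close> add up to the trace n - 1.\<close>

lemma sphere_moment_Suc:
  fixes u :: "complex ^ 'n"
  assumes u: "norm u = 1"
  shows "of_nat (CARD('n) + k) * sphere_moment u (Suc k) = of_nat (Suc k) * sphere_moment u k"
proof -
  have uu: "cdot u u = 1" using u by (simp add: cdot_self)
  define e :: "'n \<Rightarrow> complex ^ 'n" where "e j = axis j 1" for j
  define v where "v j = e j - cdot (e j) u *s u" for j
  have ce: "cdot x (e j) = x $ j" for x j
    unfolding cdot_def e_def axis_def by (simp add: if_distrib[of cnj] if_distrib cong: if_cong)
  have eu: "cdot (e j) u = cnj (u $ j)" for j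
    using ce[of u j] cdot_commute[of "e j" u] by simp
  have uv: "cdot u (v j) = 0" for j
    by (simp add: v_def cdot_diff_right cdot_smult_right ce uu eu)
  have xv: "cdot x (v j) = (x - cdot x u *s u) $ j" for x j
    by (simp add: v_def cdot_diff_right cdot_smult_right ce eu)
  have vv: "cdot (v j) (v j) = 1 - u $ j * cnj (u $ j)" for j
    using xv[of "v j" j] uv[of j] by (simp add: cdot_commute[of "v j" u]) (simp add: v_def e_def eu[unfolded e_def] mult.commute)
  have sumv: "(\<Sum>j\<in>UNIV. cdot (v j) (v j)) = of_nat CARD('n) - 1"
    using uu unfolding vv by (simp add: sum_subtractf cdot_def)
  have split: "(\<Sum>j\<in>UNIV. cnj (cdot \<eta> u) ^ k * cnj (cdot \<eta> (v j)) * (cdot \<eta> u ^ k * cdot \<eta> (v j))) =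
     cnj (cdot \<eta> u) ^ k * cdot \<eta> u ^ k - cnj (cdot \<eta> u) ^ Suc k * cdot \<eta> u ^ Suc k" if "\<eta> \<in> sphere 0 1" for \<eta>
  proof -
    define \<eta>' where "\<eta>' = \<eta> - cdot \<eta> u *s u"
    have \<eta>: "cdot \<eta> \<eta> = 1" using that by (simp add: cdot_self)
    have "(\<Sum>j\<in>UNIV. cdot \<eta> (v j) * cnj (cdot \<eta> (v j))) = cdot \<eta>' \<eta>'"
      unfolding xv \<eta>'_def cdot_def[of "_ - _"] ..
    also have "\<dots> = 1 - cnj (cdot \<eta> u) * cdot \<eta> u"
      unfolding \<eta>'_def by (simp add: cdot_diff_left cdot_diff_right cdot_smult_left cdot_smult_right uu \<eta> cdot_commute[of u \<eta>] algebra_simps)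
    finally have 1: "(\<Sum>j\<in>UNIV. cdot \<eta> (v j) * cnj (cdot \<eta> (v j))) = 1 - cnj (cdot \<eta> u) * cdot \<eta> u" .
    have "(\<Sum>j\<in>UNIV. cnj (cdot \<eta> u) ^ k * cnj (cdot \<eta> (v j)) * (cdot \<eta> u ^ k * cdot \<eta> (v j))) =
      cnj (cdot \<eta> u) ^ k * cdot \<eta> u ^ k * (\<Sum>j\<in>UNIV. cdot \<eta> (v j) * cnj (cdot \<eta> (v j)))"
      by (simp add: sum_distrib_left mult_ac)
    then show ?thesis unfolding 1 by (simp add: algebra_simps)
  qed
  have i: "integrable sphere_measure (\<lambda>\<eta>. cnj (cdot \<eta> u) ^ k * cnj (cdot \<eta> (v j)) * (cdot \<eta> u ^ k * cdot \<eta> (v j)))" for j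
    by (intro integrable_continuous_sphere continuous_intros)
  have i2: "integrable sphere_measure (\<lambda>\<eta>. cnj (cdot \<eta> u) ^ k * cdot \<eta> u ^ k)" for k
    by (intro integrable_continuous_sphere continuous_intros)
  have "of_nat (Suc k) * (sphere_moment u k - sphere_moment u (Suc k)) =
     of_nat (Suc k) * (\<integral>\<eta>. cnj (cdot \<eta> u) ^ k * cdot \<eta> u ^ k - cnj (cdot \<eta> u) ^ Suc k * cdot \<eta> u ^ Suc k \<partial>sphere_measure)"
    unfolding sphere_moment_def by (subst Bochner_Integration.integral_diff[OF i2 i2]) simp
  also have "\<dots> = of_nat (Suc k) * (\<integral>\<eta>. (\<Sum>j\<in>UNIV. cnj (cdot \<eta> u) ^ k * cnj (cdot \<eta> (v j)) * (cdot \<eta> u ^ k * cdot \<eta> (v j))) \<partial>sphere_measure)"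
    by (intro arg_cong2[where f = "(*)"] refl Bochner_Integration.integral_cong) (simp only: split space_sphere_measure)
  also have "\<dots> = (\<Sum>j\<in>UNIV. of_nat (Suc k) * (\<integral>\<eta>. cnj (cdot \<eta> u) ^ k * cnj (cdot \<eta> (v j)) * (cdot \<eta> u ^ k * cdot \<eta> (v j)) \<partial>sphere_measure))"
    by (subst Bochner_Integration.integral_sum[OF i]) (simp add: sum_distrib_left)
  also have "\<dots> = sphere_moment u (Suc k) * (of_nat CARD('n) - 1)"
    unfolding integral_orthogonal_moment[OF u uv] sum_distrib_left[symmetric] sumv ..
  finally show ?thesis by (simp add: algebra_simps)
qed

text \<open>Unrolling the recursion. These binomials are exactly the Taylor coefficients of the
  Cauchy kernel, which is why that kernel reproduces powers.\<close>

lemma sphere_moment_binomial: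
  fixes u :: "complex ^ 'n"
  assumes u: "norm u = 1"
  shows "of_nat ((CARD('n) + k - 1) choose k) * sphere_moment u k = 1"
proof (induction k)
  case 0
  show ?case by (simp add: sphere_moment_def)
next
  case (Suc k)
  obtain m where m: "CARD('n) = Suc m" using not0_implies_Suc[of "CARD('n)"] by auto
  have b: "Suc k * ((Suc m + k) choose Suc k) = (Suc m + k) * ((m + k) choose k)"
    using Suc_times_binomial_eq[of "m + k" k] by (simp add: mult.commute)
  have "of_nat (Suc k) * (of_nat ((Suc m + k) choose Suc k) * sphere_moment u (Suc k)) =
     of_nat (Suc k * ((Suc m + k) choose Suc k)) * sphere_moment u (Suc k)"
    by (simp only: of_nat_mult mult.assoc)
  also have "\<dots> = of_nat ((m + k) choose k) * (of_nat (CARD('n) + k) * sphere_moment u (Suc k))"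
    unfolding b m of_nat_mult by (simp only: mult_ac)
  also have "\<dots> = of_nat (Suc k) * (of_nat ((m + k) choose k) * sphere_moment u k)"
    unfolding sphere_moment_Suc[OF u] by (simp only: mult_ac)
  also have "of_nat ((m + k) choose k) * sphere_moment u k = 1" using Suc m by simp
  finally have "of_nat ((Suc m + k) choose Suc k) * sphere_moment u (Suc k) = 1"
    by (metis mult_cancel_left of_nat_eq_0_iff nat.distinct(1))
  then show ?case by (simp add: m)
qed

section \<open>Termwise integration and the Cauchy formula\<close>

lemma negative_binomial_sums:
  fixes x :: complex
  assumes "cmod x < 1" "n > 0"
  shows "(\<lambda>k. of_nat ((n + k - 1) choose k) * x ^ k) sums (1 / (1 - x) ^ n)"
proof -
  have "((- of_nat n :: complex) gchoose k) * (- x) ^ k = of_nat ((n + k - 1) choose k) * x ^ k" for k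
  proof -
    have "((- of_nat n :: complex) gchoose k) = (-1) ^ k * ((of_nat n + of_nat k - 1) gchoose k)"
      by (simp add: gbinomial_minus)
    also have "(of_nat n + of_nat k - 1 :: complex) = of_nat (n + k - 1)"
      using assms(2) by (simp add: of_nat_diff)
    finally show ?thesis
      by (simp add: binomial_gbinomial[symmetric] power_minus[of x])
  qed
  moreover have "(\<lambda>k. ((- of_nat n :: complex) gchoose k) * (- x) ^ k) sums (1 + (- x)) powr (- of_nat n)"
    using assms by (intro gen_binomial_complex) simp
  moreover have "(1 + (- x)) powr (- of_nat n) = 1 / (1 - x) ^ n"
  proof -
    have "x \<noteq> 1" using assms(1) by auto
    then show ?thesis by (simp add: powr_minus powr_nat' inverse_eq_divide)
  qed
  ultimately show ?thesis by simp
qed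

lemma integral_power_series:
  fixes W L :: "complex ^ 'n \<Rightarrow> complex"
  assumes W: "W \<in> borel_measurable sphere_measure" "\<And>\<eta>. \<eta> \<in> sphere 0 1 \<Longrightarrow> cmod (W \<eta>) \<le> B"
    and L: "L \<in> borel_measurable sphere_measure" "\<And>\<eta>. \<eta> \<in> sphere 0 1 \<Longrightarrow> cmod (L \<eta>) \<le> 1"
    and a: "summable (\<lambda>k. cmod (a k))"
  shows "(\<lambda>k. a k * (\<integral>\<eta>. W \<eta> * L \<eta> ^ k \<partial>sphere_measure)) sums (\<integral>\<eta>. W \<eta> * (\<Sum>k. a k * L \<eta> ^ k) \<partial>sphere_measure)"
proof -
  have bd: "cmod (a k * (W \<eta> * L \<eta> ^ k)) \<le> B * cmod (a k)" if "\<eta> \<in> sphere 0 1" for \<eta> k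
  proof -
    have "cmod (L \<eta>) ^ k \<le> 1" using L(2)[OF that] by (simp add: power_le_one)
    then have "cmod (W \<eta>) * cmod (L \<eta>) ^ k \<le> B * 1"
      using W(2)[OF that] order_trans[OF norm_ge_zero W(2)[OF that]] by (intro mult_mono) auto
    then have "cmod (a k) * (cmod (W \<eta>) * cmod (L \<eta>) ^ k) \<le> cmod (a k) * B"
      by (intro mult_left_mono) auto
    then show ?thesis by (simp add: norm_mult norm_power mult.commute)
  qed
  have i: "integrable sphere_measure (\<lambda>\<eta>. a k * (W \<eta> * L \<eta> ^ k))" for k
    by (rule integrable_bounded_sphere[OF _ bd]) (use W L in measurable)
  have "(\<lambda>k. \<integral>\<eta>. a k * (W \<eta> * L \<eta> ^ k) \<partial>sphere_measure) sums (\<integral>\<eta>. (\<Sum>k. a k * (W \<eta> * L \<eta> ^ k)) \<partial>sphere_measure)"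
  proof (rule sums_integral[OF i])
    show "AE \<eta> in sphere_measure. summable (\<lambda>k. norm (a k * (W \<eta> * L \<eta> ^ k)))"
      by (intro AE_I2 summable_comparison_test'[OF summable_mult[OF a, of B]])
         (use bd in \<open>simp only: space_sphere_measure norm_ge_zero real_norm_def abs_norm_cancel\<close>)
    show "summable (\<lambda>k. \<integral>\<eta>. norm (a k * (W \<eta> * L \<eta> ^ k)) \<partial>sphere_measure)"
    proof (rule summable_comparison_test'[OF summable_mult[OF a, of B]])
      fix k
      have "(\<integral>\<eta>. norm (a k * (W \<eta> * L \<eta> ^ k)) \<partial>sphere_measure) \<le> (\<integral>\<eta>. B * cmod (a k) \<partial>(sphere_measure :: (complex ^ 'n) measure))"
        by (rule integral_mono) (use i bd finite_measure.integrable_const[OF finite_measure_sphere_measure] in auto)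
      then show "norm (\<integral>\<eta>. norm (a k * (W \<eta> * L \<eta> ^ k)) \<partial>sphere_measure) \<le> B * cmod (a k)"
        by simp
    qed
  qed
  moreover have "(\<integral>\<eta>. (\<Sum>k. a k * (W \<eta> * L \<eta> ^ k)) \<partial>sphere_measure) = (\<integral>\<eta>. W \<eta> * (\<Sum>k. a k * L \<eta> ^ k) \<partial>sphere_measure)"
  proof (rule Bochner_Integration.integral_cong[OF refl])
    fix \<eta> :: "complex ^ 'n" assume "\<eta> \<in> space sphere_measure"
    then have "cmod (L \<eta>) \<le> 1" using L(2) by simp
    then have "cmod (a k * L \<eta> ^ k) \<le> cmod (a k)" for k
      by (simp add: norm_mult norm_power power_le_one mult_left_le)
    then have "summable (\<lambda>k. a k * L \<eta> ^ k)"
      by (intro summable_norm_cancel[OF summable_comparison_test'[OF a]]) simp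
    from suminf_mult[OF this, of "W \<eta>"]
    show "(\<Sum>k. a k * (W \<eta> * L \<eta> ^ k)) = W \<eta> * (\<Sum>k. a k * L \<eta> ^ k)"
      by (simp add: mult_ac)
  qed
  ultimately show ?thesis by simp
qed

text \<open>For j < k the rotation of the whole sphere by exp(i \<pi> / (k - j)) changes the sign of
  the integrand but not the integral; the other case follows by conjugation.\<close>

lemma integral_monomials_orthogonal:
  fixes u :: "complex ^ 'n"
  assumes "j \<noteq> k"
  shows "(\<integral>\<eta>. cnj (cdot \<eta> u) ^ j * cdot \<eta> u ^ k \<partial>sphere_measure) = 0"
proof -
  have *: "(\<integral>\<eta>. cnj (cdot \<eta> u) ^ j * cdot \<eta> u ^ k \<partial>sphere_measure) = 0" if "j < k" for j k
  proof -
    define c where "c = cis (pi / (real k - real j))"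
    have c: "cmod c = 1" by (simp add: c_def)
    have "c ^ (k - j) = -1" using that by (simp add: c_def Complex.DeMoivre of_nat_diff)
    moreover have "cnj c * c = 1" by (simp add: c_def cis_cnj cis_mult)
    moreover have "cnj c ^ j * c ^ k = (cnj c * c) ^ j * c ^ (k - j)"
      using that by (simp add: power_mult_distrib mult.assoc power_add[symmetric])
    ultimately have c2: "cnj c ^ j * c ^ k = -1" by simp
    have "(\<lambda>\<eta>. cnj (cdot \<eta> u) ^ j * cdot \<eta> u ^ k) \<in> borel_measurable sphere_measure"
      by (rule borel_measurable_sphereI[OF sets_sphere_measure]) (intro continuous_intros)
    from integral_smult_sphere[OF c this]
    have "(\<integral>\<eta>. (cnj c ^ j * c ^ k) * (cnj (cdot \<eta> u) ^ j * cdot \<eta> u ^ k) \<partial>sphere_measure) = (\<integral>\<eta>. cnj (cdot \<eta> u) ^ j * cdot \<eta> u ^ k \<partial>sphere_measure)"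
      by (simp add: cdot_smult_left power_mult_distrib mult_ac)
    then show ?thesis unfolding c2 by (simp add: equation_minus_iff)
  qed
  show ?thesis
  proof (cases "j < k")
    case False
    then have "cnj (\<integral>\<eta>. cnj (cdot \<eta> u) ^ j * cdot \<eta> u ^ k \<partial>sphere_measure) = 0"
      using *[of k j] assms by (subst Bochner_Integration.integral_cnj[symmetric]) (simp add: mult.commute)
    then show ?thesis by simp
  qed (rule *)
qed

text \<open>In the expansion of the kernel only the term j = k survives integration, and there the
  binomial coefficient cancels the moment.\<close>

lemma integral_kernel_power:
  fixes u :: "complex ^ 'n"
  assumes u: "norm u = 1" and \<rho>: "0 \<le> \<rho>" "\<rho> < 1"
  shows "(\<integral>\<eta>. 1 / (1 - complex_of_real \<rho> * cnj (cdot \<eta> u)) ^ CARD('n) * cdot \<eta> u ^ k \<partial>sphere_measure) = of_real \<rho> ^ k"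
proof -
  define a where "a j = of_nat ((CARD('n) + j - 1) choose j) * complex_of_real \<rho> ^ j" for j
  have le: "cmod (cdot \<eta> u) \<le> 1" if "\<eta> \<in> sphere 0 1" for \<eta>
    using norm_cdot_le[of \<eta> u] u that by simp
  \<comment> \<open>Convergence at (1 + \<rho>) / 2, strictly between \<rho> and 1, yields absolute
    summability at \<rho>.\<close>
  have "summable (\<lambda>j. of_nat ((CARD('n) + j - 1) choose j) * complex_of_real ((1 + \<rho>) / 2) ^ j)"
    using negative_binomial_sums[of "complex_of_real ((1 + \<rho>) / 2)" "CARD('n)"] \<rho> by (auto simp: sums_iff norm_divide simp del: of_real_divide of_real_add)
  then have a: "summable (\<lambda>j. cmod (a j))"
    unfolding a_def by (rule powser_insidea) (use \<rho> in \<open>simp del: of_real_divide of_real_add\<close>)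
  have s: "1 / (1 - complex_of_real \<rho> * cnj (cdot \<eta> u)) ^ CARD('n) = (\<Sum>j. a j * cnj (cdot \<eta> u) ^ j)" if "\<eta> \<in> sphere 0 1" for \<eta>
  proof -
    have "cmod (complex_of_real \<rho> * cnj (cdot \<eta> u)) \<le> \<rho> * 1"
      unfolding norm_mult using le[OF that] \<rho> by (intro mult_mono) auto
    then have "cmod (complex_of_real \<rho> * cnj (cdot \<eta> u)) < 1" using \<rho> by linarith
    from negative_binomial_sums[OF this, of "CARD('n)"] show ?thesis
      by (simp add: sums_iff a_def power_mult_distrib mult_ac)
  qed
  have "(\<lambda>j. a j * (\<integral>\<eta>. cdot \<eta> u ^ k * cnj (cdot \<eta> u) ^ j \<partial>sphere_measure)) sums
      (\<integral>\<eta>. cdot \<eta> u ^ k * (\<Sum>j. a j * cnj (cdot \<eta> u) ^ j) \<partial>sphere_measure)"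
    by (rule integral_power_series[where B = 1])
       (use le in \<open>auto simp: norm_power power_le_one a intro!: borel_measurable_sphereI[OF sets_sphere_measure] continuous_intros\<close>)
  moreover have "(\<lambda>j. a j * (\<integral>\<eta>. cdot \<eta> u ^ k * cnj (cdot \<eta> u) ^ j \<partial>sphere_measure)) = (\<lambda>j. if j = k then of_real \<rho> ^ k else 0)"
  proof
    fix j
    show "a j * (\<integral>\<eta>. cdot \<eta> u ^ k * cnj (cdot \<eta> u) ^ j \<partial>sphere_measure) = (if j = k then of_real \<rho> ^ k else 0)"
    proof (cases "j = k")
      case True
      have "a k * sphere_moment u k = of_real \<rho> ^ k * (of_nat ((CARD('n) + k - 1) choose k) * sphere_moment u k)"
        by (simp add: a_def)
      then have "a k * sphere_moment u k = of_real \<rho> ^ k"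
        unfolding sphere_moment_binomial[OF u] by simp
      then show ?thesis using True by (simp add: sphere_moment_def mult.commute)
    next
      case False
      then show ?thesis using integral_monomials_orthogonal[OF False, of u] by (simp add: mult.commute)
    qed
  qed
  ultimately have "(\<integral>\<eta>. cdot \<eta> u ^ k * (\<Sum>j. a j * cnj (cdot \<eta> u) ^ j) \<partial>sphere_measure) = of_real \<rho> ^ k"
    using sums_single[of k "\<lambda>_. complex_of_real \<rho> ^ k"] by (simp add: sums_iff)
  moreover have "(\<integral>\<eta>. 1 / (1 - complex_of_real \<rho> * cnj (cdot \<eta> u)) ^ CARD('n) * cdot \<eta> u ^ k \<partial>sphere_measure) =
     (\<integral>\<eta>. cdot \<eta> u ^ k * (\<Sum>j. a j * cnj (cdot \<eta> u) ^ j) \<partial>sphere_measure)"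
    by (rule Bochner_Integration.integral_cong[OF refl]) (simp only: s space_sphere_measure mult.commute)
  ultimately show ?thesis by simp
qed

lemma unit_direction:
  obtains u :: "complex ^ 'n" where "norm u = 1" "x = norm x *\<^sub>R u"
proof (cases "x = 0")
  case True
  have "norm (axis undefined 1 :: complex ^ 'n) = 1" by simp
  then show ?thesis using that True by fastforce
next
  case False
  then show ?thesis using that[of "x /\<^sub>R norm x"] by simp
qed

text \<open>Writing z = \<rho> u with |u| = 1, the kernel depends on \<eta> only through
  \<open>cdot \<eta> u\<close>, so h may be replaced by its restriction to the line of u. The Taylor
  series of that restriction is integrated term by term; R > 1 makes its coefficients absolutely
  summable.\<close>

theorem cauchy_formula_sphere:
  fixes h :: "complex ^ 'n \<Rightarrow> complex"
  assumes R: "R > 1" and h: "line_holomorphic R h" and z: "z \<in> ball 0 1"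
  shows "(\<integral>\<eta>. cauchy_kernel z \<eta> * h \<eta> \<partial>sphere_measure) = h z"
proof -
  obtain u where u: "norm u = 1" "z = complex_of_real (norm z) *s u"
    by (rule unit_direction[of z]) (simp only: scaleR_eq_smult)
  define \<rho> where "\<rho> = norm z"
  have \<rho>: "0 \<le> \<rho>" "\<rho> < 1" using z by (auto simp: \<rho>_def)
  define W where "W x = 1 / (1 - complex_of_real \<rho> * cnj x) ^ CARD('n)" for x
  have W: "W \<in> borel_measurable borel" unfolding W_def by measurable
  have ck: "cauchy_kernel z \<eta> = W (cdot \<eta> u)" for \<eta>
    by (subst u(2)) (simp add: cauchy_kernel_def W_def cdot_smult_left \<rho>_def cdot_commute[of u \<eta>])
  have Wb: "cmod (W x) \<le> 1 / (1 - \<rho>) ^ CARD('n)" if "cmod x \<le> 1" for x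
  proof -
    have "cmod (complex_of_real \<rho> * cnj x) \<le> \<rho> * 1"
      unfolding norm_mult using that \<rho> by (intro mult_mono) auto
    then have "1 - \<rho> \<le> cmod (1 - complex_of_real \<rho> * cnj x)"
      using norm_triangle_ineq2[of 1 "complex_of_real \<rho> * cnj x"] by simp
    then show ?thesis using \<rho> unfolding W_def norm_divide norm_power norm_one
      by (intro divide_left_mono power_mono mult_pos_pos zero_less_power) auto
  qed
  define g where "g t = h (t *s u)" for t
  have "(\<lambda>t. h (0 + t *s u)) holomorphic_on {t. 0 + t *s u \<in> ball 0 R}"
    using h unfolding line_holomorphic_def by blast
  moreover have "{t. 0 + t *s u \<in> ball 0 R} = ball 0 R" by (auto simp: norm_smult u(1))
  ultimately have g: "g holomorphic_on ball 0 R" by (simp add: g_def[abs_def])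
  define a where "a k = (deriv ^^ k) g 0 / fact k" for k
  have gs: "(\<lambda>k. a k * t ^ k) sums g t" if "cmod t < R" for t
    using holomorphic_power_series[OF g, of t] that by (simp add: a_def)
  have "summable (\<lambda>k. a k * complex_of_real ((1 + R) / 2) ^ k)"
    using gs[of "complex_of_real ((1 + R) / 2)"] R by (auto simp: sums_iff simp del: of_real_divide of_real_add)
  from powser_insidea[OF this, of 1]
  have a: "summable (\<lambda>k. cmod (a k))" using R by (simp del: of_real_divide of_real_add)
  have le: "cmod (cdot \<eta> u) \<le> 1" if "\<eta> \<in> sphere 0 1" for \<eta>
    using norm_cdot_le[of \<eta> u] u that by simp
  have "(\<integral>\<eta>. cauchy_kernel z \<eta> * h \<eta> \<partial>sphere_measure) = (\<integral>\<eta>. W (cdot \<eta> u) * h (cdot \<eta> u *s u) \<partial>sphere_measure)"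
    unfolding ck by (rule integral_project_line[OF R h u(1) W Wb])
  also have "\<dots> = (\<integral>\<eta>. W (cdot \<eta> u) * (\<Sum>k. a k * cdot \<eta> u ^ k) \<partial>sphere_measure)"
  proof (rule Bochner_Integration.integral_cong[OF refl])
    fix \<eta> :: "complex ^ 'n" assume "\<eta> \<in> space sphere_measure"
    then have "cmod (cdot \<eta> u) < R" using le[of \<eta>] R by simp
    from gs[OF this] show "W (cdot \<eta> u) * h (cdot \<eta> u *s u) = W (cdot \<eta> u) * (\<Sum>k. a k * cdot \<eta> u ^ k)"
      by (simp add: sums_iff g_def)
  qed
  finally have 1: "(\<integral>\<eta>. cauchy_kernel z \<eta> * h \<eta> \<partial>sphere_measure) = (\<integral>\<eta>. W (cdot \<eta> u) * (\<Sum>k. a k * cdot \<eta> u ^ k) \<partial>sphere_measure)" .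
  have Wm: "(\<lambda>\<eta>. W (cdot \<eta> u)) \<in> borel_measurable sphere_measure"
    by (rule measurable_compose[OF _ W]) measurable
  have "(\<lambda>k. a k * (\<integral>\<eta>. W (cdot \<eta> u) * cdot \<eta> u ^ k \<partial>sphere_measure)) sums (\<integral>\<eta>. cauchy_kernel z \<eta> * h \<eta> \<partial>sphere_measure)"
    unfolding 1 by (rule integral_power_series[OF Wm Wb _ le a]) (use le in auto)
  then have "(\<lambda>k. a k * of_real \<rho> ^ k) sums (\<integral>\<eta>. cauchy_kernel z \<eta> * h \<eta> \<partial>sphere_measure)"
    using integral_kernel_power[OF u(1) \<rho>] by (simp add: W_def)
  moreover have "(\<lambda>k. a k * of_real \<rho> ^ k) sums g (of_real \<rho>)"
    using \<rho> R by (intro gs) simp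
  moreover have "g (of_real \<rho>) = h z" by (subst u(2)) (simp add: g_def \<rho>_def)
  ultimately show ?thesis using sums_unique2 by metis
qed

section \<open>Peak functions of an inner function\<close>

lemma holomorphic_on_ball_inverse:
  fixes f :: "complex ^ 'n \<Rightarrow> complex"
  assumes "holomorphic_on_ball f" "\<And>z. z \<in> ball 0 1 \<Longrightarrow> f z \<noteq> 0"
  shows "holomorphic_on_ball (\<lambda>z. inverse (f z))"
  unfolding holomorphic_on_ball_def
proof
  fix z :: "complex ^ 'n" assume z: "z \<in> ball 0 1"
  obtain f' where f: "(f has_derivative f') (at z)" "\<And>c v. f' (c *s v) = c * f' v"
    using holomorphic_on_ballE[OF assms(1) z] by blast
  show "\<exists>h'. ((\<lambda>z. inverse (f z)) has_derivative h') (at z) \<and> (\<forall>c v. h' (c *s v) = c * h' v)"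
    by (rule exI[of _ "\<lambda>v. - (inverse (f z) * f' v * inverse (f z))"])
       (use Deriv.has_derivative_inverse[OF assms(2)[OF z] f(1)] in \<open>simp add: f(2)\<close>)
qed

lemma mean_value_sphere:
  fixes f :: "complex ^ 'n \<Rightarrow> complex"
  assumes f: "holomorphic_on_ball f" and r: "0 < r" "r < 1"
  shows "(\<integral>\<eta>. f (r *\<^sub>R \<eta>) \<partial>sphere_measure) = f 0"
  using cauchy_formula_sphere[OF _ line_holomorphic_dilate[OF f r], of 0] r by simp

lemma fubini_bounded:
  fixes f :: "'a \<Rightarrow> 'b \<Rightarrow> complex"
  assumes M: "finite_measure M" and N: "finite_measure N"
    and f: "(\<lambda>(x, y). f x y) \<in> borel_measurable (M \<Otimes>\<^sub>M N)"
    and bd: "\<And>x y. x \<in> space M \<Longrightarrow> y \<in> space N \<Longrightarrow> cmod (f x y) \<le> B"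
  shows "(\<integral>x. (\<integral>y. f x y \<partial>N) \<partial>M) = (\<integral>y. (\<integral>x. f x y \<partial>M) \<partial>N)"
proof -
  interpret M: finite_measure M by fact
  interpret N: finite_measure N by fact
  interpret P: pair_sigma_finite M N ..
  interpret PF: finite_measure "M \<Otimes>\<^sub>M N"
    by (rule finite_measure_pair_measure) fact+
  have "integrable (M \<Otimes>\<^sub>M N) (\<lambda>(x, y). f x y)"
    by (rule PF.integrable_const_bound[OF _ f, of B]) (auto simp: space_pair_measure bd)
  from P.Fubini_integral[OF this] show ?thesis by simp
qed

lemma line_holomorphic_continuous:
  "line_holomorphic R h \<Longrightarrow> R > 1 \<Longrightarrow> continuous_on (cball 0 1) h"
  unfolding line_holomorphic_def by (elim conjE continuous_on_subset) auto

lemma dilate_measurable: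
  fixes f :: "complex ^ 'n \<Rightarrow> complex"
  assumes "holomorphic_on_ball f" "0 < r" "r < 1"
    and "sets M = sets (restrict_space borel (sphere 0 1 :: (complex ^ 'n) set))"
  shows "(\<lambda>z. f (r *\<^sub>R z)) \<in> borel_measurable M"
  by (rule borel_measurable_sphereI[OF assms(4)],
      rule continuous_on_subset[OF line_holomorphic_continuous[OF line_holomorphic_dilate[OF assms(1-3)]]])
     (use assms in auto)

lemma norm_one_minus_power_le:
  fixes a :: complex
  assumes "cmod a \<le> 1" shows "cmod (1 - a ^ k) \<le> k * cmod (1 - a)"
proof (induction k)
  case (Suc k)
  have "1 - a ^ Suc k = (1 - a ^ k) + a ^ k * (1 - a)" by (simp add: algebra_simps)
  then have "cmod (1 - a ^ Suc k) \<le> cmod (1 - a ^ k) + cmod (a ^ k) * cmod (1 - a)"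
    by (metis norm_mult norm_triangle_ineq)
  also have "cmod (a ^ k) * cmod (1 - a) \<le> 1 * cmod (1 - a)"
    using assms by (intro mult_right_mono) (auto simp: norm_power power_le_one)
  finally show ?case using Suc by (simp add: algebra_simps)
qed simp

text \<open>Strict convexity of the disc: the midpoint of 1 and a different point of the circle is
  interior.\<close>

lemma norm_one_plus_less:
  assumes "cmod l = 1" "l \<noteq> 1" shows "cmod ((1 + l) / 2) < 1"
proof (rule ccontr)
  assume "\<not> cmod ((1 + l) / 2) < 1"
  then have "cmod (1 + l) \<ge> 2" by (simp add: norm_divide)
  then have "(cmod (1 + l))\<^sup>2 \<ge> 2\<^sup>2" by (intro power_mono) auto
  moreover have "(cmod (1 + l))\<^sup>2 = 2 + 2 * Re l"
    using assms(1) cmod_power2[of l]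
    by (subst cmod_power2) (simp add: power2_eq_square algebra_simps)
  ultimately have "Re l \<ge> 1" by simp
  then have "Re l = 1" "Im l = 0"
    using assms(1) complex_Re_le_cmod[of l] cmod_power2[of l] by (auto simp: power2_eq_square)
  then show False using assms(2) by (simp add: complex_eq_iff)
qed

text \<open>The shift by 2 starts the sequence at 1/2, so every term lies strictly between 0 and
  1.\<close>

definition radius :: "nat \<Rightarrow> real" where
  "radius m = 1 - 1 / real (m + 2)"

lemma radius: "0 < radius m" "radius m < 1" "radius \<longlonglongrightarrow> 1"
proof -
  show "0 < radius m" "radius m < 1" by (simp_all add: radius_def field_simps)
  have "(\<lambda>m. 1 - 1 / real (m + 2)) \<longlonglongrightarrow> 1 - 0"
    by (intro tendsto_diff tendsto_const LIMSEQ_ignore_initial_segment[of "\<lambda>m. 1 / real m" 0 2] lim_1_over_n)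
  then show "radius \<longlonglongrightarrow> 1" by (simp add: radius_def[abs_def])
qed

text \<open>\<open>J\<close> below stands for \<open>cnj \<alpha> * I\<close>, so that the Clark measure is the one at the point 1.\<close>

locale inner_clark =
  fixes J :: "complex ^ 'n \<Rightarrow> complex" and \<sigma> :: "(complex ^ 'n) measure"
  assumes inner: "inner_function J" and clark: "clark_measure J 1 \<sigma>"
begin

lemma hol: "holomorphic_on_ball J" and disc: "z \<in> ball 0 1 \<Longrightarrow> cmod (J z) < 1"
  and to_disc: "holomorphic_to_disc J"
  using inner by (auto simp: inner_function_def holomorphic_to_disc_def)

lemma disc': "0 < r \<Longrightarrow> r < 1 \<Longrightarrow> norm z \<le> 1 \<Longrightarrow> cmod (J (r *\<^sub>R z)) < 1"
  by (rule disc) (smt (verit) dist_0_norm mem_ball mult_left_le norm_ge_zero norm_scaleR)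

lemmas \<sigma>D = clark_measureD[OF clark]

text \<open>The boundary function of \<open>J\<close>, taken along one fixed sequence of radii to
  make measurability immediate. Where the sequence diverges the value is arbitrary.\<close>

definition L :: "complex ^ 'n \<Rightarrow> complex" where
  "L \<eta> = lim (\<lambda>m. J (radius m *\<^sub>R \<eta>))"

lemma J_meas: "0 < r \<Longrightarrow> r < 1 \<Longrightarrow> (\<lambda>\<eta>. J (r *\<^sub>R \<eta>)) \<in> borel_measurable sphere_measure"
  by (rule dilate_measurable[OF hol _ _ sets_sphere_measure])

lemma L_measurable [measurable]: "L \<in> borel_measurable sphere_measure"
  unfolding L_def[abs_def]
  by (rule borel_measurable_lim_metric) (intro J_meas radius)

lemma L_limit: "AE \<eta> in sphere_measure. cmod (L \<eta>) = 1 \<and> (\<forall>s. (\<forall>m. s m < 1) \<longrightarrow> s \<longlonglongrightarrow> 1 \<longrightarrow> (\<lambda>m. J (s m *\<^sub>R \<eta>)) \<longlonglongrightarrow> L \<eta>)"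
proof -
  have "AE \<eta> in sphere_measure. \<exists>l. ((\<lambda>r. J (r *\<^sub>R \<eta>)) \<longlongrightarrow> l) (at_left 1) \<and> cmod l = 1"
    using inner by (simp add: inner_function_def)
  then show ?thesis
  proof (rule AE_mp, intro AE_I2 impI)
    fix \<eta> :: "complex ^ 'n" assume "\<exists>l. ((\<lambda>r. J (r *\<^sub>R \<eta>)) \<longlongrightarrow> l) (at_left 1) \<and> cmod l = 1"
    then obtain l where l: "((\<lambda>r. J (r *\<^sub>R \<eta>)) \<longlongrightarrow> l) (at_left 1)" "cmod l = 1" by blast
    have *: "(\<lambda>m. J (s m *\<^sub>R \<eta>)) \<longlonglongrightarrow> l" if "\<forall>m. s m < 1" "s \<longlonglongrightarrow> 1" for s
      by (rule filterlim_compose[OF l(1)]) (use that in \<open>auto simp: filterlim_at less_le intro!: always_eventually\<close>)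
    then have "L \<eta> = l" unfolding L_def using radius by (intro limI) auto
    then show "cmod (L \<eta>) = 1 \<and> (\<forall>s. (\<forall>m. s m < 1) \<longrightarrow> s \<longlonglongrightarrow> 1 \<longrightarrow> (\<lambda>m. J (s m *\<^sub>R \<eta>)) \<longlonglongrightarrow> L \<eta>)"
      using * l(2) by simp
  qed
qed

text \<open>Continuity of \<phi> is required only at almost every boundary value, because the main
  application, (1 - w) / (1 - cnj w), is discontinuous at 1.\<close>

lemma integral_limit:
  fixes \<phi> :: "complex \<Rightarrow> complex"
  assumes s: "\<And>m. 0 < s m" "\<And>m. s m < 1" "s \<longlonglongrightarrow> 1"
    and \<phi>: "\<phi> \<in> borel_measurable borel" "\<And>w. cmod w \<le> 1 \<Longrightarrow> cmod (\<phi> w) \<le> B"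
    and ct: "AE \<eta> in sphere_measure. isCont \<phi> (L \<eta>)"
  shows "(\<lambda>m. \<integral>\<eta>. \<phi> (J (s m *\<^sub>R \<eta>)) \<partial>sphere_measure) \<longlonglongrightarrow> (\<integral>\<eta>. \<phi> (L \<eta>) \<partial>sphere_measure)"
proof (rule integral_dominated_convergence[where w = "\<lambda>_. B"])
  show "(\<lambda>\<eta>. \<phi> (L \<eta>)) \<in> borel_measurable sphere_measure"
    by (rule measurable_compose[OF L_measurable \<phi>(1)])
  show "(\<lambda>\<eta>. \<phi> (J (s m *\<^sub>R \<eta>))) \<in> borel_measurable sphere_measure" for m
    by (rule measurable_compose[OF J_meas[OF s(1,2)] \<phi>(1)])
  show "integrable sphere_measure (\<lambda>_::complex ^ 'n. B)"
    by (rule finite_measure.integrable_const[OF finite_measure_sphere_measure])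
  show "AE \<eta> in sphere_measure. (\<lambda>m. \<phi> (J (s m *\<^sub>R \<eta>))) \<longlonglongrightarrow> \<phi> (L \<eta>)"
    using L_limit ct by eventually_elim (use s in \<open>auto intro: isCont_tendsto_compose\<close>)
  show "AE \<eta> in sphere_measure. norm (\<phi> (J (s m *\<^sub>R \<eta>))) \<le> B" for m
    by (intro AE_I2 \<phi>(2) less_imp_le[OF disc'] s) simp
qed

text \<open>By the mean value property of the dilates the integral is the k-th power of (1 + J(0)) /
  2, a number of modulus below 1.\<close>

lemma peak_power_limit: "(\<lambda>k. \<integral>\<eta>. ((1 + L \<eta>) / 2) ^ k \<partial>sphere_measure) \<longlonglongrightarrow> 0"
proof -
  have "(\<integral>\<eta>. ((1 + L \<eta>) / 2) ^ k \<partial>sphere_measure) = ((1 + J 0) / 2) ^ k" for k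
  proof -
    have hp: "holomorphic_on_ball (\<lambda>z. ((1 + J z) / 2) ^ k)"
      using holomorphic_on_ball_power[OF holomorphic_on_ball_linear[OF hol, of "1/2" "1/2"]]
      by (simp add: add_divide_distrib)
    have b: "cmod (((1 + w) / 2) ^ k) \<le> 1" if "cmod w \<le> 1" for w
      using norm_triangle_ineq[of 1 w] that unfolding norm_power norm_divide by (intro power_le_one) auto
    have "(\<lambda>m. \<integral>\<eta>. ((1 + J (radius m *\<^sub>R \<eta>)) / 2) ^ k \<partial>sphere_measure) \<longlonglongrightarrow> (\<integral>\<eta>. ((1 + L \<eta>) / 2) ^ k \<partial>sphere_measure)"
      by (rule integral_limit[where \<phi> = "\<lambda>w. ((1 + w) / 2) ^ k", OF radius _ b]) auto
    moreover have "(\<integral>\<eta>. ((1 + J (radius m *\<^sub>R \<eta>)) / 2) ^ k \<partial>sphere_measure) = ((1 + J 0) / 2) ^ k" for m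
      using mean_value_sphere[OF hp radius(1,2)] .
    ultimately show ?thesis by (simp add: LIMSEQ_const_iff)
  qed
  moreover have "cmod ((1 + J 0) / 2) < 1"
    using norm_triangle_ineq[of 1 "J 0"] disc[of 0] by (simp add: norm_divide)
  ultimately show ?thesis by (simp only: LIMSEQ_power_zero)
qed

lemma power_peak_tendsto:
  assumes "cmod l = 1"
  shows "(\<lambda>k. ((1 + l) / 2) ^ k) \<longlonglongrightarrow> (if l = 1 then 1 else 0)"
  using LIMSEQ_power_zero[OF norm_one_plus_less[OF assms]] by simp

text \<open>On the circle the powers of (1 + l) / 2 converge boundedly to the indicator of l = 1, so
  the measure of the exceptional set is the limit just computed, namely 0.\<close>

lemma L_neq_1: "AE \<eta> in sphere_measure. L \<eta> \<noteq> 1"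
proof -
  define f :: "complex ^ 'n \<Rightarrow> real" where "f \<eta> = (if L \<eta> = 1 then 1 else 0)" for \<eta>
  have fm: "f \<in> borel_measurable sphere_measure" unfolding f_def by measurable
  have "(\<lambda>k. \<integral>\<eta>. ((1 + L \<eta>) / 2) ^ k \<partial>sphere_measure) \<longlonglongrightarrow> (\<integral>\<eta>. complex_of_real (f \<eta>) \<partial>sphere_measure)"
  proof (rule integral_dominated_convergence[where w = "\<lambda>_. 1"])
    show "integrable sphere_measure (\<lambda>_::complex ^ 'n. 1 :: real)"
      by (rule finite_measure.integrable_const[OF finite_measure_sphere_measure])
    show "AE \<eta> in sphere_measure. (\<lambda>k. ((1 + L \<eta>) / 2) ^ k) \<longlonglongrightarrow> complex_of_real (f \<eta>)"
      using L_limit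
    proof eventually_elim
      case (elim \<eta>)
      then show ?case using power_peak_tendsto[of "L \<eta>"] by (simp add: f_def if_distrib cong: if_cong)
    qed
    show "AE \<eta> in sphere_measure. norm (((1 + L \<eta>) / 2) ^ k) \<le> 1" for k
      using L_limit
    proof eventually_elim
      case (elim \<eta>)
      then show ?case using norm_triangle_ineq[of 1 "L \<eta>"] unfolding norm_power norm_divide by (intro power_le_one) auto
    qed
  qed (use fm in measurable)
  then have "(\<integral>\<eta>. complex_of_real (f \<eta>) \<partial>sphere_measure) = 0"
    using peak_power_limit LIMSEQ_unique by blast
  then have "(\<integral>\<eta>. f \<eta> \<partial>sphere_measure) = 0"
    by (simp only: integral_complex_of_real of_real_eq_0_iff)
  moreover have "integrable sphere_measure f"
    by (rule finite_measure.integrable_const_bound[OF finite_measure_sphere_measure _ fm, of 1]) (simp add: f_def)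
  moreover have "AE \<eta> in sphere_measure. 0 \<le> f \<eta>" by (simp add: f_def)
  ultimately have "AE \<eta> in sphere_measure. f \<eta> = 0"
    using integral_nonneg_eq_0_iff_AE by blast
  then show ?thesis by eventually_elim (simp add: f_def split: if_splits)
qed

lemma abs_peak_power_limit: "(\<lambda>k. \<integral>\<eta>. complex_of_real (cmod ((1 + L \<eta>) / 2) ^ k) \<partial>sphere_measure) \<longlonglongrightarrow> 0"
proof -
  have "(\<lambda>k. \<integral>\<eta>. complex_of_real (cmod ((1 + L \<eta>) / 2) ^ k) \<partial>sphere_measure) \<longlonglongrightarrow> (\<integral>\<eta>. 0 \<partial>(sphere_measure :: (complex ^ 'n) measure))"
  proof (rule integral_dominated_convergence[where w = "\<lambda>_. 1"])
    show "integrable sphere_measure (\<lambda>_::complex ^ 'n. 1 :: real)"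
      by (rule finite_measure.integrable_const[OF finite_measure_sphere_measure])
    show "AE \<eta> in sphere_measure. (\<lambda>k. complex_of_real (cmod ((1 + L \<eta>) / 2) ^ k)) \<longlonglongrightarrow> 0"
      using L_limit L_neq_1
    proof eventually_elim
      case (elim \<eta>)
      then have "cmod (complex_of_real (cmod ((1 + L \<eta>) / 2))) < 1" using norm_one_plus_less[of "L \<eta>"] by simp
      then show ?case unfolding of_real_power by (rule LIMSEQ_power_zero)
    qed
    show "AE \<eta> in sphere_measure. norm (complex_of_real (cmod ((1 + L \<eta>) / 2) ^ k)) \<le> 1" for k
      using L_limit
    proof eventually_elim
      case (elim \<eta>)
      then show ?case using norm_triangle_ineq[of 1 "L \<eta>"] by (simp add: norm_divide norm_power power_le_one)
    qed
  qed measurable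
  then show ?thesis by simp
qed

lemma clark_mass: "complex_of_real (measure \<sigma> (sphere 0 1)) = (1 - J 0 * cnj (J 0)) / ((1 - J 0) * (1 - cnj (J 0)))"
  using clark_identity[OF to_disc _ clark, of 0 0]
  by (simp add: dbr_kernel_def \<sigma>D scaleR_conv_of_real)

text \<open>The dilation is split in two: the Cauchy formula expresses J(s s \<zeta>) through the
  values J(s \<eta>) with kernel C(s \<zeta>, \<eta>). After Fubini the \<sigma>-integral of this
  kernel is the conjugate of the one of C(s \<eta>, .), given by the polarized Clark identity at q =
  0.\<close>

lemma integral_J_clark:
  assumes s: "0 < s" "s < 1"
  shows "(\<integral>\<zeta>. J ((s * s) *\<^sub>R \<zeta>) \<partial>\<sigma>) =
    (\<integral>\<eta>. J (s *\<^sub>R \<eta>) * cnj ((1 - J (s *\<^sub>R \<eta>) * cnj (J 0)) / ((1 - J (s *\<^sub>R \<eta>)) * (1 - cnj (J 0)))) \<partial>sphere_measure)"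
proof -
  note [measurable] = \<sigma>D(3)
  have "(\<integral>\<zeta>. J ((s * s) *\<^sub>R \<zeta>) \<partial>\<sigma>) = (\<integral>\<zeta>. (\<integral>\<eta>. cauchy_kernel (s *\<^sub>R \<zeta>) \<eta> * J (s *\<^sub>R \<eta>) \<partial>sphere_measure) \<partial>\<sigma>)"
    using s by (intro Bochner_Integration.integral_cong refl, subst cauchy_formula_sphere[OF _ line_holomorphic_dilate[OF hol s]])
      (auto simp: \<sigma>D(1))
  also have "\<dots> = (\<integral>\<eta>. (\<integral>\<zeta>. cauchy_kernel (s *\<^sub>R \<zeta>) \<eta> * J (s *\<^sub>R \<eta>) \<partial>\<sigma>) \<partial>sphere_measure)"
  proof (rule fubini_bounded[OF \<sigma>D(2) finite_measure_sphere_measure])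
    have [measurable]: "(\<lambda>\<eta>. J (s *\<^sub>R \<eta>)) \<in> borel_measurable sphere_measure" by (rule J_meas[OF s])
    show "(\<lambda>(\<zeta>, \<eta>). cauchy_kernel (s *\<^sub>R \<zeta>) \<eta> * J (s *\<^sub>R \<eta>)) \<in> borel_measurable (\<sigma> \<Otimes>\<^sub>M sphere_measure)"
      by measurable
    fix \<zeta> \<eta> :: "complex ^ 'n" assume "\<zeta> \<in> space \<sigma>" "\<eta> \<in> space sphere_measure"
    then have "cmod (cauchy_kernel (s *\<^sub>R \<zeta>) \<eta>) \<le> 1 / (1 - s) ^ CARD('n)" "cmod (J (s *\<^sub>R \<eta>)) \<le> 1"
      using s by (auto intro!: norm_cauchy_kernel_le less_imp_le[OF disc'] simp: \<sigma>D(1))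
    then show "cmod (cauchy_kernel (s *\<^sub>R \<zeta>) \<eta> * J (s *\<^sub>R \<eta>)) \<le> 1 / (1 - s) ^ CARD('n) * 1"
      unfolding norm_mult using s by (intro mult_mono) auto
  qed
  also have "\<dots> = (\<integral>\<eta>. J (s *\<^sub>R \<eta>) * cnj ((1 - J (s *\<^sub>R \<eta>) * cnj (J 0)) / ((1 - J (s *\<^sub>R \<eta>)) * (1 - cnj (J 0)))) \<partial>sphere_measure)"
  proof (rule Bochner_Integration.integral_cong[OF refl])
    fix \<eta> :: "complex ^ 'n" assume "\<eta> \<in> space sphere_measure"
    then have "s *\<^sub>R \<eta> \<in> ball 0 1" using s by simp
    from clark_identity[OF to_disc _ clark this, of 0]
    have "(\<integral>\<zeta>. cauchy_kernel (s *\<^sub>R \<eta>) \<zeta> \<partial>\<sigma>) = (1 - J (s *\<^sub>R \<eta>) * cnj (J 0)) / ((1 - J (s *\<^sub>R \<eta>)) * (1 - cnj (J 0)))"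
      by (simp add: dbr_kernel_def)
    moreover have "(\<integral>\<zeta>. cauchy_kernel (s *\<^sub>R \<zeta>) \<eta> \<partial>\<sigma>) = cnj (\<integral>\<zeta>. cauchy_kernel (s *\<^sub>R \<eta>) \<zeta> \<partial>\<sigma>)"
      by (subst Bochner_Integration.integral_cnj[symmetric]) (simp add: cauchy_kernel_cnj cauchy_kernel_scaleR)
    ultimately show "(\<integral>\<zeta>. cauchy_kernel (s *\<^sub>R \<zeta>) \<eta> * J (s *\<^sub>R \<eta>) \<partial>\<sigma>) = J (s *\<^sub>R \<eta>) * cnj ((1 - J (s *\<^sub>R \<eta>) * cnj (J 0)) / ((1 - J (s *\<^sub>R \<eta>)) * (1 - cnj (J 0))))"
      by (simp add: mult.commute)
  qed
  finally show ?thesis .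
qed

text \<open>The unbounded part \<open>J / (1 - cnj J)\<close> of the integrand differs from the antiholomorphic
  \<open>1 / (1 - cnj J)\<close> by the unimodular \<open>(1 - J) / (1 - cnj J)\<close>, whose boundary value is \<open>- J\<close>
  because \<open>J\<close> is inner.\<close>

lemma integral_J_clark_limit:
  "(\<lambda>m. \<integral>\<zeta>. J ((radius m * radius m) *\<^sub>R \<zeta>) \<partial>\<sigma>) \<longlonglongrightarrow> complex_of_real (measure \<sigma> (sphere 0 1))"
proof -
  define j where "j = J 0"
  have j1: "1 - j \<noteq> 0" "1 - cnj j \<noteq> 0" using disc[of 0] by (auto simp: j_def)
  define \<phi> where "\<phi> w = (1 - w) / (1 - cnj w)" for w :: complex
  have cn: "cmod (1 - cnj w) = cmod (1 - w)" for w by (metis complex_cnj_diff complex_cnj_one complex_mod_cnj)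
  have \<phi>b: "cmod (\<phi> w) \<le> 1" for w by (simp add: \<phi>_def norm_divide cn)
  have \<phi>m: "\<phi> \<in> borel_measurable borel" unfolding \<phi>_def by measurable
  have ct: "isCont \<phi> w" if "w \<noteq> 1" for w
    unfolding \<phi>_def using that by (intro continuous_intros) (auto simp: complex_eq_iff)
  have \<phi>L: "\<phi> w = - w" if "cmod w = 1" "w \<noteq> 1" for w
  proof -
    have "w * cnj w = 1" using that(1) complex_norm_square[of w] by simp
    moreover have "1 - cnj w \<noteq> 0" using that(2) by (auto simp: complex_eq_iff)
    ultimately show ?thesis by (simp add: \<phi>_def divide_eq_eq algebra_simps)
  qed
  have "(\<lambda>m. \<integral>\<eta>. \<phi> (J (radius m *\<^sub>R \<eta>)) \<partial>sphere_measure) \<longlonglongrightarrow> (\<integral>\<eta>. \<phi> (L \<eta>) \<partial>sphere_measure)"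
    by (rule integral_limit[OF radius \<phi>m \<phi>b]) (use L_neq_1 in \<open>auto intro: ct elim: eventually_mono\<close>)
  also have "(\<integral>\<eta>. \<phi> (L \<eta>) \<partial>sphere_measure) = (\<integral>\<eta>. - L \<eta> \<partial>sphere_measure)"
  proof (rule integral_cong_AE)
    show "(\<lambda>\<eta>. \<phi> (L \<eta>)) \<in> borel_measurable sphere_measure"
      by (rule measurable_compose[OF L_measurable \<phi>m])
    show "AE \<eta> in sphere_measure. \<phi> (L \<eta>) = - L \<eta>"
      using L_limit L_neq_1 by eventually_elim (simp add: \<phi>L)
  qed measurable
  also have "\<dots> = - j"
  proof -
    have "(\<lambda>m. \<integral>\<eta>. J (radius m *\<^sub>R \<eta>) \<partial>sphere_measure) \<longlonglongrightarrow> (\<integral>\<eta>. L \<eta> \<partial>sphere_measure)"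
      by (rule integral_limit[where \<phi> = "\<lambda>w. w" and B = 1, OF radius]) auto
    then show ?thesis using mean_value_sphere[OF hol radius(1,2)] by (simp add: LIMSEQ_const_iff j_def)
  qed
  finally have lim: "(\<lambda>m. \<integral>\<eta>. \<phi> (J (radius m *\<^sub>R \<eta>)) \<partial>sphere_measure) \<longlonglongrightarrow> - j" .
  \<comment> \<open>The terms in \<open>J\<close> and \<open>1 / (1 - cnj J)\<close> have exact
    means \<open>j\<close> and \<open>1 / (1 - cnj j)\<close> at every radius; only the bounded
    \<phi> needs a limit.\<close>
  have eq: "(\<integral>\<zeta>. J ((radius m * radius m) *\<^sub>R \<zeta>) \<partial>\<sigma>) =
    j / (1 - j) * j + 1 / (1 - cnj j) - (\<integral>\<eta>. \<phi> (J (radius m *\<^sub>R \<eta>)) \<partial>sphere_measure)" for m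
  proof -
    let ?J = "\<lambda>\<eta>. J (radius m *\<^sub>R \<eta>)"
    have ne: "1 - ?J \<eta> \<noteq> 0" "1 - cnj (?J \<eta>) \<noteq> 0" if "\<eta> \<in> sphere 0 1" for \<eta>
    proof -
      show "1 - ?J \<eta> \<noteq> 0" using disc'[of "radius m" \<eta>] radius(1,2)[of m] that by auto
      then show "1 - cnj (?J \<eta>) \<noteq> 0" by (metis complex_cnj_diff complex_cnj_one complex_cnj_zero_iff)
    qed
    have hi: "holomorphic_on_ball (\<lambda>z. inverse (1 - J z))"
      using holomorphic_on_ball_inverse[OF holomorphic_on_ball_linear[OF hol, of 1 "-1"]] disc by force
    have "continuous_on (sphere 0 1) (\<lambda>\<eta>. inverse (1 - ?J \<eta>))"
      using radius(1,2)[of m] by (intro continuous_on_subset[OF line_holomorphic_continuous[OF line_holomorphic_dilate[OF hi radius(1,2)]]]) auto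
    then have "continuous_on (sphere 0 1) (\<lambda>\<eta>. cnj (inverse (1 - ?J \<eta>)))" by (rule continuous_on_cnj)
    then have i1: "integrable sphere_measure (\<lambda>\<eta>. 1 / (1 - cnj (?J \<eta>)))"
      using integrable_continuous_sphere by (force simp: inverse_eq_divide)
    have i2: "integrable sphere_measure ?J"
      by (rule integrable_bounded_sphere[OF J_meas[OF radius(1,2)], of _ 1]) (auto intro!: less_imp_le[OF disc'] radius)
    have i3: "integrable sphere_measure (\<lambda>\<eta>. \<phi> (?J \<eta>))"
      by (rule integrable_bounded_sphere[OF measurable_compose[OF J_meas[OF radius(1,2)] \<phi>m] \<phi>b])
    have "(\<integral>\<eta>. 1 / (1 - cnj (?J \<eta>)) \<partial>sphere_measure) = cnj (\<integral>\<eta>. inverse (1 - ?J \<eta>) \<partial>sphere_measure)"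
      by (subst Bochner_Integration.integral_cnj[symmetric]) (simp add: inverse_eq_divide)
    also have "\<dots> = 1 / (1 - cnj j)"
      using mean_value_sphere[OF hi radius(1,2)] by (simp add: inverse_eq_divide j_def)
    finally have v1: "(\<integral>\<eta>. 1 / (1 - cnj (?J \<eta>)) \<partial>sphere_measure) = 1 / (1 - cnj j)" .
    have "(\<integral>\<zeta>. J ((radius m * radius m) *\<^sub>R \<zeta>) \<partial>\<sigma>) =
       (\<integral>\<eta>. j / (1 - j) * ?J \<eta> + 1 / (1 - cnj (?J \<eta>)) - \<phi> (?J \<eta>) \<partial>sphere_measure)"
      unfolding integral_J_clark[OF radius(1,2)]
    proof (rule Bochner_Integration.integral_cong[OF refl])
      fix \<eta> :: "complex ^ 'n" assume "\<eta> \<in> space sphere_measure"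
      then have n: "1 - ?J \<eta> \<noteq> 0" "1 - cnj (?J \<eta>) \<noteq> 0" using ne by auto
      show "?J \<eta> * cnj ((1 - ?J \<eta> * cnj (J 0)) / ((1 - ?J \<eta>) * (1 - cnj (J 0)))) = j / (1 - j) * ?J \<eta> + 1 / (1 - cnj (?J \<eta>)) - \<phi> (?J \<eta>)"
        using n j1 by (simp add: \<phi>_def j_def[symmetric] divide_simps) (simp add: algebra_simps)
    qed
    also have "\<dots> = j / (1 - j) * j + 1 / (1 - cnj j) - (\<integral>\<eta>. \<phi> (?J \<eta>) \<partial>sphere_measure)"
      using i1 i2 i3 v1 mean_value_sphere[OF hol radius(1,2), of m] by (simp add: j_def)
    finally show ?thesis .
  qed
  have "(\<lambda>m. \<integral>\<zeta>. J ((radius m * radius m) *\<^sub>R \<zeta>) \<partial>\<sigma>) \<longlonglongrightarrow> j / (1 - j) * j + 1 / (1 - cnj j) - (- j)"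
    unfolding eq by (intro tendsto_intros lim)
  also have "j / (1 - j) * j + 1 / (1 - cnj j) - (- j) = complex_of_real (measure \<sigma> (sphere 0 1))"
    unfolding clark_mass j_def[symmetric] using j1 by (simp add: divide_simps) (simp add: algebra_simps)
  finally show ?thesis .
qed

text \<open>For |w| \<le> 1 one has |1 - w|^2 \<le> 2 (1 - Re w), and the mean of Re J under
  \<sigma> approaches the whole mass.\<close>

lemma integral_one_minus_J_limit:
  "(\<lambda>m. \<integral>\<zeta>. (cmod (1 - J ((radius m * radius m) *\<^sub>R \<zeta>)))\<^sup>2 \<partial>\<sigma>) \<longlonglongrightarrow> 0"
proof (rule tendsto_sandwich[OF _ _ tendsto_const])
  interpret finite_measure \<sigma> by (rule \<sigma>D)
  let ?J = "\<lambda>m \<zeta>. J ((radius m * radius m) *\<^sub>R \<zeta>)"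
  have r: "0 < radius m * radius m" "radius m * radius m < 1" for m
    using radius(1,2)[of m] mult_strict_mono[of "radius m" 1 "radius m" 1] by auto
  have m: "?J m \<in> borel_measurable \<sigma>" for m by (rule dilate_measurable[OF hol r \<sigma>D(4)])
  have b: "cmod (?J m \<zeta>) \<le> 1" if "\<zeta> \<in> space \<sigma>" for m \<zeta> using that by (intro less_imp_le[OF disc'] r) (simp add: \<sigma>D(1))
  have i: "integrable \<sigma> (?J m)" for m by (rule integrable_const_bound[OF _ m, where B = 1]) (use b in auto)
  have i2: "integrable \<sigma> (\<lambda>\<zeta>. (cmod (1 - ?J m \<zeta>))\<^sup>2)" for m
  proof (rule integrable_const_bound[where B = 4])
    show "AE \<zeta> in \<sigma>. norm ((cmod (1 - ?J m \<zeta>))\<^sup>2) \<le> 4"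
    proof (intro AE_I2)
      fix \<zeta> assume "\<zeta> \<in> space \<sigma>"
      then have "cmod (1 - ?J m \<zeta>) \<le> 2" using norm_triangle_ineq4[of 1 "?J m \<zeta>"] b[of \<zeta> m] by simp
      then have "(cmod (1 - ?J m \<zeta>))\<^sup>2 \<le> 2\<^sup>2" by (intro power_mono) auto
      then show "norm ((cmod (1 - ?J m \<zeta>))\<^sup>2) \<le> 4" by simp
    qed
  qed (use m in measurable)
  show "\<forall>\<^sub>F m in sequentially. 0 \<le> (\<integral>\<zeta>. (cmod (1 - ?J m \<zeta>))\<^sup>2 \<partial>\<sigma>)" by simp
  have "(\<integral>\<zeta>. (cmod (1 - ?J m \<zeta>))\<^sup>2 \<partial>\<sigma>) \<le> 2 * (measure \<sigma> (sphere 0 1) - Re (\<integral>\<zeta>. ?J m \<zeta> \<partial>\<sigma>))" for m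
  proof -
    have "(\<integral>\<zeta>. (cmod (1 - ?J m \<zeta>))\<^sup>2 \<partial>\<sigma>) \<le> (\<integral>\<zeta>. 2 * (1 - Re (?J m \<zeta>)) \<partial>\<sigma>)"
    proof (rule integral_mono[OF i2])
      show "integrable \<sigma> (\<lambda>\<zeta>. 2 * (1 - Re (?J m \<zeta>)))" using i by auto
      fix \<zeta> assume "\<zeta> \<in> space \<sigma>"
      then have "(cmod (?J m \<zeta>))\<^sup>2 \<le> 1" using b by (simp add: power_le_one)
      then show "(cmod (1 - ?J m \<zeta>))\<^sup>2 \<le> 2 * (1 - Re (?J m \<zeta>))"
        unfolding cmod_power2 by (simp add: power2_eq_square algebra_simps)
    qed
    also have "\<dots> = 2 * (measure \<sigma> (sphere 0 1) - Re (\<integral>\<zeta>. ?J m \<zeta> \<partial>\<sigma>))"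
      using i by (simp add: \<sigma>D(1))
    finally show ?thesis .
  qed
  then show "\<forall>\<^sub>F m in sequentially. (\<integral>\<zeta>. (cmod (1 - ?J m \<zeta>))\<^sup>2 \<partial>\<sigma>) \<le> 2 * (measure \<sigma> (sphere 0 1) - Re (\<integral>\<zeta>. ?J m \<zeta> \<partial>\<sigma>))"
    by simp
  have "(\<lambda>m. 2 * (measure \<sigma> (sphere 0 1) - Re (\<integral>\<zeta>. ?J m \<zeta> \<partial>\<sigma>))) \<longlonglongrightarrow> 2 * (measure \<sigma> (sphere 0 1) - Re (complex_of_real (measure \<sigma> (sphere 0 1))))"
    by (intro tendsto_intros integral_J_clark_limit)
  then show "(\<lambda>m. 2 * (measure \<sigma> (sphere 0 1) - Re (\<integral>\<zeta>. ?J m \<zeta> \<partial>\<sigma>))) \<longlonglongrightarrow> 0" by simp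
qed

text \<open>The order of choices matters: the exponent k is fixed first, so that the boundary
  function has small L^1 norm; only then is the radius moved towards 1, which handles both integrals
  for that k.\<close>

lemma peak_functions:
  assumes "\<epsilon> > 0"
  obtains P R where "R > 1" "line_holomorphic R P" "\<And>z. norm z \<le> 1 \<Longrightarrow> cmod (P z) \<le> 1"
    "(\<integral>\<eta>. cmod (P \<eta>) \<partial>sphere_measure) < \<epsilon>" "(\<integral>\<zeta>. (cmod (1 - P \<zeta>))\<^sup>2 \<partial>\<sigma>) < \<epsilon>"
proof -
  interpret finite_measure \<sigma> by (rule \<sigma>D)
  \<comment> \<open>Squared radii, because the \<sigma>-integrals were computed for the doubly
    dilated function.\<close>
  define t where "t m = radius m * radius m" for m
  have t: "0 < t m" "t m < 1" for m
    unfolding t_def using radius(1,2)[of m] mult_strict_mono[of "radius m" 1 "radius m" 1] by auto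
  have tl: "t \<longlonglongrightarrow> 1" unfolding t_def using tendsto_mult[OF radius(3) radius(3)] by simp
  define P where "P k m z = ((1 + J (t m *\<^sub>R z)) / 2) ^ k" for k m z
  have hp: "holomorphic_on_ball (\<lambda>z. ((1 + J z) / 2) ^ k)" for k
    using holomorphic_on_ball_power[OF holomorphic_on_ball_linear[OF hol, of "1/2" "1/2"]]
    by (simp add: add_divide_distrib)
  have lh: "line_holomorphic (1 / t m) (P k m)" for k m
    unfolding P_def by (rule line_holomorphic_dilate[OF hp t])
  have b1: "cmod ((1 + w) / 2) \<le> 1" if "cmod w \<le> 1" for w
    using norm_triangle_ineq[of 1 w] that by (simp add: norm_divide)
  have b: "cmod (P k m z) \<le> 1" if "norm z \<le> 1" for k m z
    unfolding P_def norm_power by (intro power_le_one norm_ge_zero b1 less_imp_le[OF disc'] t that)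
  have "\<forall>\<^sub>F k in sequentially. cmod (\<integral>\<eta>. complex_of_real (cmod ((1 + L \<eta>) / 2) ^ k) \<partial>sphere_measure) < \<epsilon>"
    using order_tendstoD(2)[OF tendsto_norm_zero[OF abs_peak_power_limit] assms] .
  then obtain k where k: "cmod (\<integral>\<eta>. complex_of_real (cmod ((1 + L \<eta>) / 2) ^ k) \<partial>sphere_measure) < \<epsilon>"
    using eventually_happens'[OF sequentially_bot] by blast
  have bb: "cmod (complex_of_real (cmod ((1 + w) / 2) ^ k)) \<le> 1" if "cmod w \<le> 1" for w
    using b1[OF that] by (simp add: norm_power power_le_one del: of_real_power)
  have "(\<lambda>m. \<integral>\<eta>. complex_of_real (cmod ((1 + J (t m *\<^sub>R \<eta>)) / 2) ^ k) \<partial>sphere_measure) \<longlonglongrightarrow> (\<integral>\<eta>. complex_of_real (cmod ((1 + L \<eta>) / 2) ^ k) \<partial>sphere_measure)"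
    by (rule integral_limit[where \<phi> = "\<lambda>w. complex_of_real (cmod ((1 + w) / 2) ^ k)", OF t tl _ bb]) auto
  from order_tendstoD(2)[OF tendsto_norm[OF this] k]
  have e1: "\<forall>\<^sub>F m in sequentially. cmod (\<integral>\<eta>. complex_of_real (cmod ((1 + J (t m *\<^sub>R \<eta>)) / 2) ^ k) \<partial>sphere_measure) < \<epsilon>" .
  \<comment> \<open>The factor \<open>(real k)\<^sup>2\<close> is the cost of passing from 1 - a to
    1 - a^k; it is harmless as k is already fixed.\<close>
  have "(\<lambda>m. (real k)\<^sup>2 * (\<integral>\<zeta>. (cmod (1 - J (t m *\<^sub>R \<zeta>)))\<^sup>2 \<partial>\<sigma>)) \<longlonglongrightarrow> (real k)\<^sup>2 * 0"
    unfolding t_def by (intro tendsto_intros integral_one_minus_J_limit)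
  then have e2: "\<forall>\<^sub>F m in sequentially. (real k)\<^sup>2 * (\<integral>\<zeta>. (cmod (1 - J (t m *\<^sub>R \<zeta>)))\<^sup>2 \<partial>\<sigma>) < \<epsilon>"
    using order_tendstoD(2)[of _ 0 sequentially \<epsilon>] assms by simp
  obtain m where m1: "cmod (\<integral>\<eta>. complex_of_real (cmod ((1 + J (t m *\<^sub>R \<eta>)) / 2) ^ k) \<partial>sphere_measure) < \<epsilon>"
    and m2: "(real k)\<^sup>2 * (\<integral>\<zeta>. (cmod (1 - J (t m *\<^sub>R \<zeta>)))\<^sup>2 \<partial>\<sigma>) < \<epsilon>"
    using eventually_happens'[OF sequentially_bot eventually_conj[OF e1 e2]] by blast
  show ?thesis
  proof (rule that[of "1 / t m" "P k m"])
    show "1 < 1 / t m" using t by simp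
    show "line_holomorphic (1 / t m) (P k m)" by (rule lh)
    show "cmod (P k m z) \<le> 1" if "norm z \<le> 1" for z by (rule b[OF that])
    have "(\<integral>\<eta>. complex_of_real (cmod ((1 + J (t m *\<^sub>R \<eta>)) / 2) ^ k) \<partial>sphere_measure) = complex_of_real (\<integral>\<eta>. cmod (P k m \<eta>) \<partial>sphere_measure)"
      unfolding P_def norm_power by (rule integral_complex_of_real)
    then show "(\<integral>\<eta>. cmod (P k m \<eta>) \<partial>sphere_measure) < \<epsilon>"
      using m1 by (simp only: norm_of_real)
    have Jm: "(\<lambda>\<zeta>. J (t m *\<^sub>R \<zeta>)) \<in> borel_measurable \<sigma>" by (rule dilate_measurable[OF hol t \<sigma>D(4)])
    have Jb: "cmod (J (t m *\<^sub>R \<zeta>)) \<le> 1" if "\<zeta> \<in> space \<sigma>" for \<zeta> using that by (intro less_imp_le[OF disc'] t) (simp add: \<sigma>D(1))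
    have sq: "(cmod (1 - w))\<^sup>2 \<le> 4" if "cmod w \<le> 1" for w
    proof -
      have "cmod (1 - w) \<le> 2" using norm_triangle_ineq4[of 1 w] that by simp
      then have "(cmod (1 - w))\<^sup>2 \<le> 2\<^sup>2" by (intro power_mono) auto
      then show ?thesis by simp
    qed
    have "(\<integral>\<zeta>. (cmod (1 - P k m \<zeta>))\<^sup>2 \<partial>\<sigma>) \<le> (\<integral>\<zeta>. (real k)\<^sup>2 * (cmod (1 - J (t m *\<^sub>R \<zeta>)))\<^sup>2 \<partial>\<sigma>)"
    proof (rule integral_mono)
      show "integrable \<sigma> (\<lambda>\<zeta>. (cmod (1 - P k m \<zeta>))\<^sup>2)"
      proof (rule integrable_const_bound[where B = 4])
        show "AE \<zeta> in \<sigma>. norm ((cmod (1 - P k m \<zeta>))\<^sup>2) \<le> 4" using sq[OF b] by (intro AE_I2) (simp add: \<sigma>D(1))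
      qed (use Jm in \<open>simp add: P_def\<close>)
      show "integrable \<sigma> (\<lambda>\<zeta>. (real k)\<^sup>2 * (cmod (1 - J (t m *\<^sub>R \<zeta>)))\<^sup>2)"
      proof (rule integrable_mult_right, rule integrable_const_bound[where B = 4])
        show "AE \<zeta> in \<sigma>. norm ((cmod (1 - J (t m *\<^sub>R \<zeta>)))\<^sup>2) \<le> 4" using sq[OF Jb] by (intro AE_I2) simp
      qed (use Jm in simp)
      fix \<zeta> assume z: "\<zeta> \<in> space \<sigma>"
      have "cmod (1 - P k m \<zeta>) \<le> k * cmod (1 - (1 + J (t m *\<^sub>R \<zeta>)) / 2)"
        unfolding P_def by (rule norm_one_minus_power_le[OF b1[OF Jb[OF z]]])
      also have "1 - (1 + J (t m *\<^sub>R \<zeta>)) / 2 = (1 - J (t m *\<^sub>R \<zeta>)) / 2" by (simp add: field_simps)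
      also have "real k * cmod ((1 - J (t m *\<^sub>R \<zeta>)) / 2) \<le> real k * cmod (1 - J (t m *\<^sub>R \<zeta>))"
        by (intro mult_left_mono) (auto simp: norm_divide)
      finally have "cmod (1 - P k m \<zeta>) \<le> real k * cmod (1 - J (t m *\<^sub>R \<zeta>))" .
      then show "(cmod (1 - P k m \<zeta>))\<^sup>2 \<le> (real k)\<^sup>2 * (cmod (1 - J (t m *\<^sub>R \<zeta>)))\<^sup>2"
        by (metis norm_ge_zero power_mono power_mult_distrib)
    qed
    also have "\<dots> < \<epsilon>" using m2 by simp
    finally show "(\<integral>\<zeta>. (cmod (1 - P k m \<zeta>))\<^sup>2 \<partial>\<sigma>) < \<epsilon>" .
  qed
qed

end

section \<open>Estimates of the Cauchy kernel\<close>

text \<open>The radius must lie between 1 and 1 / |x|, beyond which singularities occur; 2 / (1 +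
  |x|) is such a value that is also meaningful at x = 0.\<close>

lemma line_holomorphic_cauchy_kernel:
  fixes x :: "complex ^ 'n"
  assumes x: "x \<in> ball 0 1"
  shows "line_holomorphic (2 / (1 + norm x)) (\<lambda>z. cauchy_kernel z x)"
proof -
  have ne: "1 - cdot z x \<noteq> 0" if "z \<in> ball 0 (2 / (1 + norm x))" for z
  proof -
    have "cmod (cdot z x) \<le> norm z * norm x" by (rule norm_cdot_le)
    also have "\<dots> \<le> 2 / (1 + norm x) * norm x" using that by (intro mult_right_mono) auto
    also have "\<dots> < 1" using x by (simp add: divide_simps add_nonneg_pos add_pos_nonneg)
    finally show ?thesis by auto
  qed
  show ?thesis
    unfolding line_holomorphic_def cauchy_kernel_def
  proof (intro conjI allI)
    show "continuous_on (ball 0 (2 / (1 + norm x))) (\<lambda>z. 1 / (1 - cdot z x) ^ CARD('n))"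
      using ne by (intro continuous_intros) auto
    fix a v :: "complex ^ 'n"
    have "1 - (cdot a x + t * cdot v x) \<noteq> 0" if "a + t *s v \<in> ball 0 (2 / (1 + norm x))" for t
      using ne[OF that] by (simp add: cdot_add_left cdot_smult_left)
    then show "(\<lambda>t. 1 / (1 - cdot (a + t *s v) x) ^ CARD('n)) holomorphic_on {t. a + t *s v \<in> ball 0 (2 / (1 + norm x))}"
      unfolding cdot_add_left cdot_smult_left by (intro holomorphic_intros) auto
  qed
qed

lemma continuous_on_cauchy_kernel:
  fixes x :: "complex ^ 'n"
  assumes "x \<in> ball 0 1" shows "continuous_on (sphere 0 1) (\<lambda>\<eta>. cauchy_kernel x \<eta>)"
  unfolding cauchy_kernel_def
  using one_minus_cdot_nonzero[of _ x] assms by (intro continuous_intros) auto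

text \<open>The Cauchy formula applied to C(., x) at its own base point x.\<close>

lemma integral_cauchy_kernel_square:
  fixes x :: "complex ^ 'n"
  assumes x: "x \<in> ball 0 1"
  shows "(\<integral>\<eta>. (cmod (cauchy_kernel x \<eta>))\<^sup>2 \<partial>sphere_measure) = 1 / (1 - (norm x)\<^sup>2) ^ CARD('n)"
proof -
  have "1 < 2 / (1 + norm x)" using x by (simp add: less_divide_eq add_pos_nonneg)
  from cauchy_formula_sphere[OF this line_holomorphic_cauchy_kernel[OF x] x]
  have "(\<integral>\<eta>. cauchy_kernel x \<eta> * cauchy_kernel \<eta> x \<partial>sphere_measure) = cauchy_kernel x x" .
  moreover have "cauchy_kernel x \<eta> * cauchy_kernel \<eta> x = complex_of_real ((cmod (cauchy_kernel x \<eta>))\<^sup>2)" for \<eta>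
    by (simp only: complex_norm_square cauchy_kernel_cnj)
  moreover have "cauchy_kernel x x = complex_of_real (1 / (1 - (norm x)\<^sup>2) ^ CARD('n))"
    by (simp add: cauchy_kernel_def cdot_self)
  ultimately show ?thesis by (simp only: integral_complex_of_real of_real_eq_iff)
qed

lemma cauchy_kernel_norm: "cmod (cauchy_kernel x \<eta>) = 1 / cmod (1 - cdot x (\<eta> :: complex ^ 'n)) ^ CARD('n)"
  by (simp add: cauchy_kernel_def norm_divide norm_power)

text \<open>On the dyadic shell where \<open>\<bar>1 - \<langle>x, \<eta>\<rangle>\<bar>\<close> is comparable to \<open>t\<close> the integrand is
  dominated by a multiple of the square of the Cauchy kernel at the point of the ray through
  \<open>x\<close> at distance \<open>t\<close> from the sphere, whose integral is known.\<close>

lemma kernel_estimate: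
  fixes x :: "complex ^ 'n"
  assumes x: "x \<in> ball 0 1" and \<delta>: "0 < \<delta>" "\<delta> \<le> 1"
  shows "(\<integral>\<eta>. (if cmod (1 - cdot x \<eta>) < \<delta> then sqrt (cmod (1 - cdot x \<eta>)) * cmod (cauchy_kernel x \<eta>) else 0) \<partial>sphere_measure)
    \<le> 4 * 8 ^ CARD('n) * sqrt \<delta>"
proof -
  define n where "n = CARD('n)"
  define a where "a \<eta> = cmod (1 - cdot x \<eta>)" for \<eta>
  define f where "f \<eta> = (if a \<eta> < \<delta> then sqrt (a \<eta>) * cmod (cauchy_kernel x \<eta>) else 0)" for \<eta>
  obtain u :: "complex ^ 'n" where u: "norm u = 1" "x = norm x *\<^sub>R u" by (rule unit_direction)
  define t where "t j = \<delta> / 2 ^ j" for j :: nat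
  have t: "0 < t j" "t j \<le> 1" for j
    using \<delta> by (auto simp: t_def divide_le_eq intro: order_trans[OF _ one_le_power])
  define y where "y j = (1 - t j) *\<^sub>R u" for j
  have ny: "norm (y j) = 1 - t j" for j using t[of j] u by (simp add: y_def)
  have yb: "y j \<in> ball 0 1" for j using ny[of j] t[of j] by simp
  \<comment> \<open>On the shell, \<open>f \<eta>\<close> is at most sqrt t (2 / t)^n, while 1 \<le>
    (2 t)^(2n) |C(y, \<eta>)|^2 with t = \<open>t j\<close> and y = \<open>y j\<close>; the powers
    of 2 combine to 8^n.\<close>
  define g where "g j \<eta> = sqrt (t j) * t j ^ n * 8 ^ n * (cmod (cauchy_kernel (y j) \<eta>))\<^sup>2" for j \<eta>
  have gi: "integrable sphere_measure (g j)" for j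
    unfolding g_def by (intro integrable_continuous_sphere continuous_intros continuous_on_cauchy_kernel yb)
  have gI: "(\<integral>\<eta>. g j \<eta> \<partial>sphere_measure) \<le> 8 ^ n * sqrt (t j)" for j
  proof -
    have e: "1 - (1 - t j)\<^sup>2 = t j * (2 - t j)" by (simp add: power2_eq_square algebra_simps)
    have "t j \<le> t j * (2 - t j)" using t[of j] mult_left_mono[of 1 "2 - t j" "t j"] by simp
    then have le: "t j ^ n \<le> (1 - (1 - t j)\<^sup>2) ^ n" unfolding e using t[of j] by (intro power_mono) auto
    have "(\<integral>\<eta>. g j \<eta> \<partial>sphere_measure) = sqrt (t j) * t j ^ n * 8 ^ n * (1 / (1 - (1 - t j)\<^sup>2) ^ n)"
      unfolding g_def using integral_cauchy_kernel_square[OF yb, of j] by (simp add: ny n_def)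
    also have "\<dots> \<le> sqrt (t j) * t j ^ n * 8 ^ n * (1 / t j ^ n)"
      using t[of j] le less_le_trans[OF zero_less_power[OF t(1)[of j]] le]
      by (intro mult_left_mono divide_left_mono mult_pos_pos) auto
    also have "\<dots> = 8 ^ n * sqrt (t j)" using t[of j] by simp
    finally show ?thesis .
  qed
  have a0: "1 - norm x \<le> a \<eta>" if "\<eta> \<in> sphere 0 1" for \<eta>
    unfolding a_def using that by (intro norm_one_minus_cdot_ge) simp
  \<comment> \<open>On the sphere \<open>a \<eta> \<ge> 1 - norm x\<close>, so only finitely many
    shells are nonempty. Their number disappears from the final bound.\<close>
  obtain N where N: "\<delta> / 2 ^ N < 1 - norm x"
  proof -
    have "(\<lambda>N. \<delta> * (1 / 2) ^ N) \<longlonglongrightarrow> \<delta> * 0" by (intro tendsto_intros LIMSEQ_power_zero) auto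
    then have "\<forall>\<^sub>F N in sequentially. \<delta> * (1 / 2) ^ N < 1 - norm x"
      using x by (intro order_tendstoD(2)) auto
    then obtain N where "\<delta> * (1 / 2) ^ N < 1 - norm x" using eventually_happens'[OF sequentially_bot] by blast
    then show ?thesis using that by (simp add: power_one_over)
  qed
  have pt: "f \<eta> \<le> (\<Sum>j<N. g j \<eta>)" if s: "\<eta> \<in> sphere 0 1" for \<eta>
  proof (cases "a \<eta> < \<delta>")
    case False then show ?thesis using t by (simp add: f_def g_def sum_nonneg less_imp_le)
  next
    case True
    have apos: "a \<eta> > 0" using a0[OF s] x by simp
    define m where "m = (LEAST m. t m \<le> a \<eta>)"
    have ex: "t N \<le> a \<eta>" using N a0[OF s] by (simp add: t_def)
    have m: "t m \<le> a \<eta>" "m \<le> N" unfolding m_def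
      using LeastI[of "\<lambda>m. t m \<le> a \<eta>", OF ex] Least_le[of "\<lambda>m. t m \<le> a \<eta>", OF ex] by auto
    have "m \<noteq> 0" using m(1) True by (auto simp: t_def intro: ccontr)
    then obtain j where j: "m = Suc j" using not0_implies_Suc by blast
    have ja: "a \<eta> < t j" using not_less_Least[of j "\<lambda>m. t m \<le> a \<eta>"] j unfolding m_def by auto
    have ja2: "t j / 2 \<le> a \<eta>" using m(1) by (simp add: j t_def)
    have jN: "j < N" using m(2) j by simp
    \<comment> \<open>Since \<open>1 - norm x \<le> a \<eta> < t j\<close>, the point
      \<open>x\<close> lies beyond \<open>y j\<close> on the ray, at distance below
      \<open>t j\<close>; this displacement is added to \<open>a \<eta>\<close>.\<close>
    have "cmod (1 - cdot (y j) \<eta>) \<le> 2 * t j"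
    proof -
      have "1 - cdot (y j) \<eta> = (1 - cdot x \<eta>) + cdot (x - y j) \<eta>" by (simp add: cdot_diff_left)
      then have "cmod (1 - cdot (y j) \<eta>) \<le> a \<eta> + cmod (cdot (x - y j) \<eta>)"
        unfolding a_def by (metis norm_triangle_ineq)
      also have "cmod (cdot (x - y j) \<eta>) \<le> norm (x - y j)" using norm_cdot_le[of "x - y j" \<eta>] s by simp
      also have "x - y j = (norm x - (1 - t j)) *\<^sub>R u" using u(2) by (simp add: y_def scaleR_diff_left)
      also have "norm \<dots> \<le> t j" using a0[OF s] ja x u(1) by simp
      finally show ?thesis using ja by simp
    qed
    then have "1 \<le> (2 * t j) ^ n * cmod (cauchy_kernel (y j) \<eta>)"
    proof -
      assume h: "cmod (1 - cdot (y j) \<eta>) \<le> 2 * t j"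
      have "0 < cmod (1 - cdot (y j) \<eta>) ^ n" using one_minus_cdot_nonzero[of \<eta> "y j"] yb[of j] s by simp
      moreover have "cmod (1 - cdot (y j) \<eta>) ^ n \<le> (2 * t j) ^ n" using h by (intro power_mono) auto
      ultimately show ?thesis by (simp add: cauchy_kernel_norm n_def[symmetric])
    qed
    then have "1\<^sup>2 \<le> ((2 * t j) ^ n * cmod (cauchy_kernel (y j) \<eta>))\<^sup>2" by (intro power_mono) auto
    then have one: "1 \<le> (2 * t j) ^ (2 * n) * (cmod (cauchy_kernel (y j) \<eta>))\<^sup>2"
      by (simp add: power_mult_distrib power_mult[symmetric] mult.commute)
    have "f \<eta> = sqrt (a \<eta>) * (1 / a \<eta> ^ n)" using True by (simp add: f_def cauchy_kernel_norm a_def n_def)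
    also have "\<dots> \<le> sqrt (t j) * (1 / (t j / 2) ^ n)"
      using ja ja2 apos t[of j] by (intro mult_mono divide_left_mono power_mono mult_pos_pos zero_less_power) auto
    also have "\<dots> \<le> sqrt (t j) * (1 / (t j / 2) ^ n) * ((2 * t j) ^ (2 * n) * (cmod (cauchy_kernel (y j) \<eta>))\<^sup>2)"
      using mult_left_mono[OF one, of "sqrt (t j) * (1 / (t j / 2) ^ n)"] t[of j] by simp
    also have "\<dots> = g j \<eta>"
    proof -
      have "(2 * t j) ^ (2 * n) = t j ^ n * t j ^ n * 4 ^ n"
        by (simp add: power_mult_distrib power_mult mult_2[of n] power_add) (simp add: power_mult_distrib[symmetric])
      moreover have "(8::real) ^ n = 4 ^ n * 2 ^ n" by (simp add: power_mult_distrib[symmetric])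
      ultimately show ?thesis using t[of j] by (simp add: g_def power_divide field_simps)
    qed
    also have "\<dots> \<le> (\<Sum>j<N. g j \<eta>)"
      using jN t by (intro member_le_sum) (auto simp: g_def less_imp_le)
    finally show ?thesis .
  qed
  have fm: "f \<in> borel_measurable sphere_measure"
    unfolding f_def a_def by measurable
  have f0: "0 \<le> f \<eta>" for \<eta> by (simp add: f_def a_def)
  have sumi: "integrable sphere_measure (\<lambda>\<eta>. \<Sum>j<N. g j \<eta>)" using gi by simp
  have fi: "integrable sphere_measure f"
    by (rule Bochner_Integration.integrable_bound[OF sumi fm]) (use pt f0 in \<open>auto intro!: AE_I2 intro: order_trans[OF _ abs_ge_self]\<close>)
  have "(\<integral>\<eta>. f \<eta> \<partial>sphere_measure) \<le> (\<integral>\<eta>. (\<Sum>j<N. g j \<eta>) \<partial>sphere_measure)"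
    by (rule integral_mono[OF fi sumi]) (use pt in simp)
  also have "\<dots> = (\<Sum>j<N. \<integral>\<eta>. g j \<eta> \<partial>sphere_measure)" by (rule Bochner_Integration.integral_sum[OF gi])
  \<comment> \<open>The ratio sqrt(1/2) is rounded up to 3/4, whose geometric series sums to 4; this
    is the constant 4 in the claim.\<close>
  also have "\<dots> \<le> (\<Sum>j<N. 8 ^ n * sqrt \<delta> * (3 / 4) ^ j)"
  proof (rule sum_mono)
    fix j
    have "sqrt (1 / 2) \<le> (3 / 4 :: real)" by (rule real_le_lsqrt) (auto simp: power2_eq_square)
    then have "sqrt (1 / 2) ^ j \<le> (3 / 4 :: real) ^ j" by (intro power_mono) auto
    moreover have "sqrt (t j) = sqrt \<delta> * sqrt (1 / 2) ^ j"
      by (simp add: t_def real_sqrt_divide real_sqrt_power power_divide real_sqrt_one)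
    ultimately have "8 ^ n * sqrt (t j) \<le> 8 ^ n * (sqrt \<delta> * (3 / 4) ^ j)"
      using \<delta> by (intro mult_left_mono) auto
    then show "(\<integral>\<eta>. g j \<eta> \<partial>sphere_measure) \<le> 8 ^ n * sqrt \<delta> * (3 / 4) ^ j"
      using gI[of j] unfolding mult.assoc by (rule order_trans[rotated])
  qed
  also have "\<dots> = 8 ^ n * sqrt \<delta> * (\<Sum>j<N. (3 / 4) ^ j)" by (simp add: sum_distrib_left)
  also have "\<dots> \<le> 8 ^ n * sqrt \<delta> * 4"
  proof (rule mult_left_mono)
    have "(\<Sum>j<N. (3 / 4 :: real) ^ j) = 4 * (1 - (3 / 4) ^ N)" by (subst sum_gp_strict) (simp add: field_simps)
    then show "(\<Sum>j<N. (3 / 4 :: real) ^ j) \<le> 4" by simp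
  qed (use \<delta> in auto)
  finally show ?thesis unfolding f_def a_def n_def by (simp only: mult_ac)
qed

text \<open>With a = |1 - \<open>cdot (r *\<^sub>R z) \<eta>\<close>|, expanding the square gives
  |\<eta> - r z|^2 \<le> 2 a, and the radial part satisfies 1 - r \<le> a \<le> sqrt(2 a) because a
  \<le> 2. Together 2 sqrt 2 \<le> 3.\<close>

lemma norm_diff_le_sqrt_kernel:
  fixes z \<eta> :: "complex ^ 'n"
  assumes z: "norm z = 1" and \<eta>: "norm \<eta> = 1" and r: "0 < r" "r < 1"
  shows "norm (\<eta> - z) \<le> 3 * sqrt (cmod (1 - cdot (r *\<^sub>R z) \<eta>))"
proof -
  define a where "a = cmod (1 - cdot (r *\<^sub>R z) \<eta>)"
  have ra: "1 - r \<le> a" using norm_one_minus_cdot_ge[of \<eta> "r *\<^sub>R z"] z \<eta> r by (simp add: a_def)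
  have "cmod (cdot (r *\<^sub>R z) \<eta>) \<le> 1" using norm_cdot_le[of "r *\<^sub>R z" \<eta>] z \<eta> r by simp
  then have a2: "a \<le> 2" unfolding a_def using norm_triangle_ineq4[of 1 "cdot (r *\<^sub>R z) \<eta>"] by simp
  have a0: "0 \<le> a" by (simp add: a_def)
  have "complex_of_real ((norm (\<eta> - r *\<^sub>R z))\<^sup>2) = cdot \<eta> \<eta> - cdot (r *\<^sub>R z) \<eta> - cnj (cdot (r *\<^sub>R z) \<eta>) + cdot (r *\<^sub>R z) (r *\<^sub>R z)"
    unfolding cdot_self[symmetric] by (simp add: cdot_diff_left cdot_diff_right cdot_commute[of \<eta> "r *\<^sub>R z"])
  then have "Re (complex_of_real ((norm (\<eta> - r *\<^sub>R z))\<^sup>2)) = Re (cdot \<eta> \<eta> - cdot (r *\<^sub>R z) \<eta> - cnj (cdot (r *\<^sub>R z) \<eta>) + cdot (r *\<^sub>R z) (r *\<^sub>R z))"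
    by (rule arg_cong)
  then have "(norm (\<eta> - r *\<^sub>R z))\<^sup>2 = 1 - 2 * Re (cdot (r *\<^sub>R z) \<eta>) + r\<^sup>2"
    using z \<eta> r by (simp add: cdot_self del: of_real_power)
  also have "\<dots> \<le> 2 * Re (1 - cdot (r *\<^sub>R z) \<eta>)"
    using r by (simp add: power_le_one)
  also have "\<dots> \<le> 2 * a" unfolding a_def using complex_Re_le_cmod by (simp only: mult_le_cancel_left_pos zero_less_numeral)
  finally have 1: "norm (\<eta> - r *\<^sub>R z) \<le> sqrt (2 * a)" by (rule real_le_rsqrt)
  have "a * a \<le> 2 * a" using a2 a0 by (intro mult_right_mono) auto
  then have 2: "a \<le> sqrt (2 * a)" by (intro real_le_rsqrt) (simp add: power2_eq_square)
  have "norm (\<eta> - z) \<le> norm (\<eta> - r *\<^sub>R z) + norm (r *\<^sub>R z - z)"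
    using norm_triangle_ineq[of "\<eta> - r *\<^sub>R z" "r *\<^sub>R z - z"] by simp
  also have "norm (r *\<^sub>R z - z) = 1 - r"
  proof -
    have "r *\<^sub>R z - z = (r - 1) *\<^sub>R z" by (simp add: scaleR_diff_left)
    then show ?thesis using z r by simp
  qed
  finally have "norm (\<eta> - z) \<le> 2 * sqrt (2 * a)" using 1 2 ra by simp
  also have "2 * sqrt (2 * a) = (2 * sqrt 2) * sqrt a" by (simp add: real_sqrt_mult)
  also have "\<dots> \<le> 3 * sqrt a"
  proof (intro mult_right_mono)
    have "sqrt 2 \<le> (3 / 2 :: real)" by (rule real_le_lsqrt) (auto simp: power2_eq_square)
    then show "2 * sqrt 2 \<le> (3 :: real)" by simp
  qed (use a0 in auto)
  finally show ?thesis by (simp add: a_def)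
qed

text \<open>By the Cauchy formula \<psi>(z) P(r z) is the integral with \<psi>(\<eta>) frozen at
  \<psi>(z), so the difference has kernel C (\<psi>(\<eta>) - \<psi>(z)). Where |1 -
  \<open>cdot (r *\<^sub>R z) \<eta>\<close>| < \<delta>, the Lipschitz bound and |P| \<le> 1 leave
  3 K times the kernel estimate, hence 12 = 3 * 4; elsewhere the kernel is at most \<delta>^(-n) and
  the L^1 norm of P takes over. The bound is uniform in z and r.\<close>

lemma toeplitz_commutator_bound:
  fixes \<psi> P :: "complex ^ 'n \<Rightarrow> complex"
  assumes R: "R > 1" and P: "line_holomorphic R P" and Pb: "\<And>z. norm z \<le> 1 \<Longrightarrow> cmod (P z) \<le> 1"
    and lip: "\<And>\<eta> z. norm \<eta> = 1 \<Longrightarrow> norm z = 1 \<Longrightarrow> cmod (\<psi> \<eta> - \<psi> z) \<le> K * norm (\<eta> - z)"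
    and K: "K \<ge> 0" and B: "\<And>z. norm z = 1 \<Longrightarrow> cmod (\<psi> z) \<le> B"
    and z: "norm z = 1" and r: "0 < r" "r < 1" and \<delta>: "0 < \<delta>" "\<delta> \<le> 1"
  shows "cmod ((\<integral>\<eta>. cauchy_kernel (r *\<^sub>R z) \<eta> * (\<psi> \<eta> * P \<eta>) \<partial>sphere_measure) - \<psi> z * P (r *\<^sub>R z))
    \<le> 12 * K * 8 ^ CARD('n) * sqrt \<delta> + 2 * B / \<delta> ^ CARD('n) * (\<integral>\<eta>. cmod (P \<eta>) \<partial>sphere_measure)"
proof -
  let ?x = "r *\<^sub>R z"
  have x: "?x \<in> ball 0 1" using z r by simp
  have cP: "continuous_on (sphere 0 1) P"
    by (rule continuous_on_subset[OF line_holomorphic_continuous[OF P R]]) auto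
  have "continuous_on (sphere 0 1) \<psi>"
    by (rule lipschitz_on_continuous_on[of K]) (use lip K in \<open>auto simp: lipschitz_on_def dist_norm\<close>)
  note ci = this cP continuous_on_cauchy_kernel[OF x]
  have "\<psi> z * P ?x = (\<integral>\<eta>. \<psi> z * (cauchy_kernel ?x \<eta> * P \<eta>) \<partial>sphere_measure)"
    by (simp add: cauchy_formula_sphere[OF R P x])
  then have "(\<integral>\<eta>. cauchy_kernel ?x \<eta> * (\<psi> \<eta> * P \<eta>) \<partial>sphere_measure) - \<psi> z * P ?x =
    (\<integral>\<eta>. cauchy_kernel ?x \<eta> * (\<psi> \<eta> * P \<eta>) - \<psi> z * (cauchy_kernel ?x \<eta> * P \<eta>) \<partial>sphere_measure)"
    by (subst Bochner_Integration.integral_diff) (auto intro!: integrable_continuous_sphere continuous_intros ci)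
  also have "\<dots> = (\<integral>\<eta>. cauchy_kernel ?x \<eta> * (\<psi> \<eta> - \<psi> z) * P \<eta> \<partial>sphere_measure)"
    by (simp add: algebra_simps)
  finally have eq: "(\<integral>\<eta>. cauchy_kernel ?x \<eta> * (\<psi> \<eta> * P \<eta>) \<partial>sphere_measure) - \<psi> z * P ?x =
    (\<integral>\<eta>. cauchy_kernel ?x \<eta> * (\<psi> \<eta> - \<psi> z) * P \<eta> \<partial>sphere_measure)" .
  define f where "f \<eta> = (if cmod (1 - cdot ?x \<eta>) < \<delta> then sqrt (cmod (1 - cdot ?x \<eta>)) * cmod (cauchy_kernel ?x \<eta>) else 0)" for \<eta>
  have f0: "0 \<le> f \<eta>" for \<eta> by (simp add: f_def)
  have fi: "integrable sphere_measure f"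
  proof (rule finite_measure.integrable_const_bound[OF finite_measure_sphere_measure, where B = "sqrt \<delta> * (1 / (1 - r) ^ CARD('n))"])
    show "f \<in> borel_measurable sphere_measure" unfolding f_def by measurable
    have "f \<eta> \<le> sqrt \<delta> * (1 / (1 - r) ^ CARD('n))" if "norm \<eta> = 1" for \<eta>
    proof -
      have "cmod (cauchy_kernel ?x \<eta>) \<le> 1 / (1 - r) ^ CARD('n)"
        by (rule norm_cauchy_kernel_le) (use that z r in auto)
      then show ?thesis unfolding f_def
        using \<delta> r mult_mono[of "sqrt (cmod (1 - cdot ?x \<eta>))" "sqrt \<delta>" "cmod (cauchy_kernel ?x \<eta>)" "1 / (1 - r) ^ CARD('n)"]
        by auto
    qed
    then show "AE \<eta> in sphere_measure. norm (f \<eta>) \<le> sqrt \<delta> * (1 / (1 - r) ^ CARD('n))"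
      using f0 by (intro AE_I2) simp
  qed
  have Pi: "integrable sphere_measure (\<lambda>\<eta>. cmod (P \<eta>))"
    by (intro integrable_continuous_sphere continuous_intros ci)
  have B0: "0 \<le> B" using B[OF z] norm_ge_zero[of "\<psi> z"] by linarith
  have "cmod (\<integral>\<eta>. cauchy_kernel ?x \<eta> * (\<psi> \<eta> - \<psi> z) * P \<eta> \<partial>sphere_measure) \<le>
    (\<integral>\<eta>. 3 * K * f \<eta> + 2 * B / \<delta> ^ CARD('n) * cmod (P \<eta>) \<partial>sphere_measure)"
  proof (rule norm_lebesgue_integral_le)
    show "integrable sphere_measure (\<lambda>\<eta>. cauchy_kernel ?x \<eta> * (\<psi> \<eta> - \<psi> z) * P \<eta>)"
      by (intro integrable_continuous_sphere continuous_intros ci)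
    show "integrable sphere_measure (\<lambda>\<eta>. 3 * K * f \<eta> + 2 * B / \<delta> ^ CARD('n) * cmod (P \<eta>))"
      using fi Pi by simp
    fix \<eta> :: "complex ^ 'n" assume "\<eta> \<in> space sphere_measure"
    then have e: "norm \<eta> = 1" by simp
    define a where "a = cmod (1 - cdot ?x \<eta>)"
    show "norm (cauchy_kernel ?x \<eta> * (\<psi> \<eta> - \<psi> z) * P \<eta>) \<le> 3 * K * f \<eta> + 2 * B / \<delta> ^ CARD('n) * cmod (P \<eta>)"
    proof (cases "a < \<delta>")
      case True
      have "cmod (\<psi> \<eta> - \<psi> z) \<le> K * (3 * sqrt a)"
        using lip[OF e z] norm_diff_le_sqrt_kernel[OF z e r] K unfolding a_def
        by (meson mult_left_mono order_trans)
      then have "cmod (cauchy_kernel ?x \<eta>) * cmod (\<psi> \<eta> - \<psi> z) * cmod (P \<eta>) \<le> cmod (cauchy_kernel ?x \<eta>) * (K * (3 * sqrt a)) * 1"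
        using Pb[of \<eta>] e K by (intro mult_mono) (auto simp: a_def)
      also have "\<dots> = 3 * K * f \<eta>" using True by (simp add: f_def a_def mult_ac)
      finally show ?thesis using B0 \<delta> by (simp add: norm_mult add_increasing2)
    next
      case False
      have "cmod (\<psi> \<eta> - \<psi> z) \<le> 2 * B" using norm_triangle_ineq4[of "\<psi> \<eta>" "\<psi> z"] B[OF e] B[OF z] by simp
      moreover have "cmod (cauchy_kernel ?x \<eta>) \<le> 1 / \<delta> ^ CARD('n)"
        unfolding cauchy_kernel_norm using False \<delta> unfolding a_def
        by (intro divide_left_mono power_mono mult_pos_pos zero_less_power) auto
      ultimately have "cmod (cauchy_kernel ?x \<eta>) * cmod (\<psi> \<eta> - \<psi> z) * cmod (P \<eta>) \<le> 1 / \<delta> ^ CARD('n) * (2 * B) * cmod (P \<eta>)"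
        using \<delta> B0 by (intro mult_mono) auto
      then show ?thesis using K f0[of \<eta>] by (simp add: norm_mult add_increasing mult_ac)
    qed
  qed
  also have "\<dots> = 3 * K * (\<integral>\<eta>. f \<eta> \<partial>sphere_measure) + 2 * B / \<delta> ^ CARD('n) * (\<integral>\<eta>. cmod (P \<eta>) \<partial>sphere_measure)"
    using fi Pi by simp
  also have "\<dots> \<le> 3 * K * (4 * 8 ^ CARD('n) * sqrt \<delta>) + 2 * B / \<delta> ^ CARD('n) * (\<integral>\<eta>. cmod (P \<eta>) \<partial>sphere_measure)"
    unfolding f_def using K by (intro add_right_mono mult_left_mono kernel_estimate[OF x \<delta>]) auto
  finally show ?thesis unfolding eq by (simp add: mult_ac)
qed

section \<open>From combinations of kernels to Lipschitz functions\<close>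

lemma continuous_on_cauchy_kernel_right:
  fixes \<zeta> :: "complex ^ 'n"
  assumes "norm \<zeta> \<le> 1" shows "continuous_on (ball 0 1) (\<lambda>w. cauchy_kernel \<zeta> w)"
proof -
  have "1 - cdot \<zeta> w \<noteq> 0" if "w \<in> ball 0 1" for w
    using one_minus_cdot_nonzero[OF assms, of w] that by (simp add: cdot_commute[of w \<zeta>])
  then show ?thesis unfolding cauchy_kernel_def by (intro continuous_intros) auto
qed

lemma norm_cauchy_kernel_right_le:
  fixes z \<zeta> :: "complex ^ 'n"
  assumes "norm \<zeta> \<le> 1" "norm w \<le> \<rho>" "\<rho> < 1"
  shows "cmod (cauchy_kernel \<zeta> w) \<le> 1 / (1 - \<rho>) ^ CARD('n)"
  using norm_cauchy_kernel_le[OF assms] by (metis cauchy_kernel_cnj complex_mod_cnj)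

text \<open>Integrals of kernels are limits of finite combinations of kernels, so an estimate for the
  latter passes to the former.\<close>

lemma kernel_superposition:
  fixes \<sigma> \<mu> :: "(complex ^ 'n) measure" and g F :: "complex ^ 'n \<Rightarrow> complex"
  assumes \<sigma>: "finite_measure \<sigma>" "sets \<sigma> = sets (restrict_space borel (sphere 0 1))"
    and \<mu>: "finite_measure \<mu>" "sets \<mu> = sets (restrict_space borel (sphere 0 1))"
    and g: "continuous_on (sphere 0 1) g" "\<And>\<zeta>. norm \<zeta> = 1 \<Longrightarrow> cmod (g \<zeta>) \<le> G"
    and fin: "\<And>A c. finite A \<Longrightarrow> A \<subseteq> ball 0 1 \<Longrightarrow>
      cmod (\<integral>\<zeta>. cnj (\<Sum>w\<in>A. c w * cauchy_kernel \<zeta> w) * g \<zeta> \<partial>\<sigma>)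
        \<le> M * sqrt (\<integral>\<zeta>. (cmod (\<Sum>w\<in>A. c w * cauchy_kernel \<zeta> w))\<^sup>2 \<partial>\<mu>)"
    and F: "continuous_on (sphere 0 1) F" "\<And>\<zeta>. norm \<zeta> = 1 \<Longrightarrow> cmod (F \<zeta>) \<le> B"
    and r: "0 < r" "r < 1"
    and \<phi>: "\<And>\<zeta>. \<phi> \<zeta> = (\<integral>\<eta>. cauchy_kernel (r *\<^sub>R \<zeta>) \<eta> * F \<eta> \<partial>sphere_measure)"
  shows "cmod (\<integral>\<zeta>. cnj (\<phi> \<zeta>) * g \<zeta> \<partial>\<sigma>) \<le> M * sqrt (\<integral>\<zeta>. (cmod (\<phi> \<zeta>))\<^sup>2 \<partial>\<mu>)"
    and "\<phi> \<in> borel_measurable \<sigma>" "\<phi> \<in> borel_measurable \<mu>"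
proof -
  have sp: "space \<sigma> = sphere 0 1" "space \<mu> = sphere 0 1"
    using sets_eq_imp_space_eq[OF \<sigma>(2)] sets_eq_imp_space_eq[OF \<mu>(2)] by (simp_all add: space_restrict_space)
  obtain X :: "nat \<Rightarrow> complex ^ 'n \<Rightarrow> complex ^ 'n"
    where X0: "\<forall>i. simple_function sphere_measure (X i)"
      "\<forall>x\<in>space sphere_measure. (\<lambda>i. X i x) \<longlonglongrightarrow> x"
    using borel_measurable_implies_sequence_metric[OF sphere_id_measurable, of 0] by blast
  then have X: "simple_function sphere_measure (X i)" "x \<in> sphere 0 1 \<Longrightarrow> (\<lambda>i. X i x) \<longlonglongrightarrow> x" for i x
    by simp_all
  \<comment> \<open>The values of \<open>X i\<close> need not lie on the sphere. Normalizing (0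
    stays 0 by the convention for division) and scaling by \<open>r\<close> confines all nodes to a
    compact subset of the ball.\<close>
  define p where "p i \<eta> = r *\<^sub>R (X i \<eta> /\<^sub>R norm (X i \<eta>))" for i \<eta>
  have ps: "simple_function sphere_measure (p i)" for i
    unfolding p_def by (rule simple_function_compose1[OF X(1)])
  have pm: "p i \<in> borel_measurable sphere_measure" for i
    by (rule borel_measurable_simple_function[OF ps])
  have pl: "(\<lambda>i. p i \<eta>) \<longlonglongrightarrow> r *\<^sub>R \<eta>" if "\<eta> \<in> sphere 0 1" for \<eta>
  proof -
    have "(\<lambda>i. p i \<eta>) \<longlonglongrightarrow> r *\<^sub>R (\<eta> /\<^sub>R norm \<eta>)"
      unfolding p_def by (intro tendsto_intros X(2)[OF that]) (use that in auto)
    then show ?thesis using that by simp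
  qed
  have pn: "norm (p i \<eta>) \<le> r" for i \<eta>
    using r by (cases "X i \<eta> = 0") (auto simp: p_def)
  have Fm: "F \<in> borel_measurable sphere_measure" by (rule borel_measurable_sphereI[OF sets_sphere_measure F(1)])
  \<comment> \<open>Weights of a Riemann sum: \<open>c i w\<close> is the integral of
    \<open>F\<close> over the cell on which \<open>p i\<close> equals the node
    \<open>w\<close>.\<close>
  define c where "c i w = (\<integral>\<eta>. (if p i \<eta> = w then F \<eta> else 0) \<partial>sphere_measure)" for i w
  define S where "S i = p i ` sphere 0 1" for i
  define \<Phi> where "\<Phi> i \<zeta> = (\<Sum>w\<in>S i. c i w * cauchy_kernel \<zeta> w)" for i \<zeta>
  have Sf: "finite (S i)" "S i \<subseteq> ball 0 1" for i
    using simple_functionD(1)[OF ps[of i]] pn[of i] r unfolding S_def by (auto intro: le_less_trans[OF pn])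
  have \<Phi>eq: "\<Phi> i \<zeta> = (\<integral>\<eta>. cauchy_kernel \<zeta> (p i \<eta>) * F \<eta> \<partial>sphere_measure)" for i \<zeta>
  proof -
    have int: "integrable sphere_measure (\<lambda>\<eta>. if p i \<eta> = w then F \<eta> else 0)" for w
    proof (rule integrable_bounded_sphere[where B = "\<bar>B\<bar>"])
      show "(\<lambda>\<eta>. if p i \<eta> = w then F \<eta> else 0) \<in> borel_measurable sphere_measure"
        using Fm pm by measurable
    qed (use F(2) in \<open>auto intro: order_trans[OF _ abs_ge_self]\<close>)
    have "\<Phi> i \<zeta> = (\<Sum>w\<in>S i. \<integral>\<eta>. cauchy_kernel \<zeta> w * (if p i \<eta> = w then F \<eta> else 0) \<partial>sphere_measure)"
      unfolding \<Phi>_def c_def by (simp add: mult.commute)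
    also have "\<dots> = (\<integral>\<eta>. (\<Sum>w\<in>S i. cauchy_kernel \<zeta> w * (if p i \<eta> = w then F \<eta> else 0)) \<partial>sphere_measure)"
      by (rule Bochner_Integration.integral_sum[symmetric]) (intro integrable_mult_right int)
    also have "\<dots> = (\<integral>\<eta>. cauchy_kernel \<zeta> (p i \<eta>) * F \<eta> \<partial>sphere_measure)"
    proof (rule Bochner_Integration.integral_cong[OF refl])
      fix \<eta> :: "complex ^ 'n" assume "\<eta> \<in> space sphere_measure"
      then have "p i \<eta> \<in> S i" by (auto simp: S_def)
      moreover have "(\<Sum>w\<in>S i. cauchy_kernel \<zeta> w * (if p i \<eta> = w then F \<eta> else 0)) = (\<Sum>w\<in>S i. if p i \<eta> = w then cauchy_kernel \<zeta> w * F \<eta> else 0)"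
        by (intro sum.cong) auto
      ultimately show "(\<Sum>w\<in>S i. cauchy_kernel \<zeta> w * (if p i \<eta> = w then F \<eta> else 0)) = cauchy_kernel \<zeta> (p i \<eta>) * F \<eta>"
        using Sf(1) by (simp add: sum.delta')
    qed
    finally show ?thesis .
  qed
  define b where "b = 1 / (1 - r) ^ CARD('n) * B"
  have B0: "0 \<le> B" 
  proof -
    have "norm (axis undefined 1 :: complex ^ 'n) = 1" by simp
    from F(2)[OF this] show ?thesis using norm_ge_zero order_trans by blast
  qed
  have bd: "cmod (cauchy_kernel \<zeta> (p i \<eta>) * F \<eta>) \<le> b" if "norm \<zeta> \<le> 1" "norm \<eta> = 1" for i \<zeta> \<eta>
    unfolding b_def norm_mult using norm_cauchy_kernel_right_le[OF that(1) pn[of i \<eta>] r(2)] F(2)[OF that(2)] r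
    by (intro mult_mono) auto
  have \<Phi>b: "cmod (\<Phi> i \<zeta>) \<le> b" if z: "norm \<zeta> \<le> 1" for i \<zeta>
  proof -
    have "(\<lambda>\<eta>. cauchy_kernel \<zeta> (p i \<eta>) * F \<eta>) \<in> borel_measurable sphere_measure"
      using Fm pm by measurable
    then have "cmod (\<Phi> i \<zeta>) \<le> (\<integral>\<eta>. b \<partial>(sphere_measure :: (complex ^ 'n) measure))"
      unfolding \<Phi>eq using bd[OF z] finite_measure.integrable_const[OF finite_measure_sphere_measure]
      by (intro norm_lebesgue_integral_le integrable_bounded_sphere[where B = b]) auto
    then show ?thesis by simp
  qed
  have \<Phi>lim: "(\<lambda>i. \<Phi> i \<zeta>) \<longlonglongrightarrow> \<phi> \<zeta>" if z: "norm \<zeta> \<le> 1" for \<zeta>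
    unfolding \<Phi>eq \<phi>
  proof (rule integral_dominated_convergence[where w = "\<lambda>_. b"])
    show "(\<lambda>\<eta>. cauchy_kernel (r *\<^sub>R \<zeta>) \<eta> * F \<eta>) \<in> borel_measurable sphere_measure"
      using Fm by measurable
    show "(\<lambda>\<eta>. cauchy_kernel \<zeta> (p i \<eta>) * F \<eta>) \<in> borel_measurable sphere_measure" for i
      using Fm pm by measurable
    show "integrable sphere_measure (\<lambda>_::complex ^ 'n. b)"
      by (rule finite_measure.integrable_const[OF finite_measure_sphere_measure])
    show "AE \<eta> in sphere_measure. norm (cauchy_kernel \<zeta> (p i \<eta>) * F \<eta>) \<le> b" for i
      using bd[OF z] by (intro AE_I2) simp
    show "AE \<eta> in sphere_measure. (\<lambda>i. cauchy_kernel \<zeta> (p i \<eta>) * F \<eta>) \<longlonglongrightarrow> cauchy_kernel (r *\<^sub>R \<zeta>) \<eta> * F \<eta>"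
    proof (intro AE_I2 tendsto_intros)
      fix \<eta> :: "complex ^ 'n" assume e: "\<eta> \<in> space sphere_measure"
      show "(\<lambda>i. cauchy_kernel \<zeta> (p i \<eta>)) \<longlonglongrightarrow> cauchy_kernel (r *\<^sub>R \<zeta>) \<eta>"
        unfolding cauchy_kernel_scaleR
        by (rule continuous_on_tendsto_compose[OF continuous_on_cauchy_kernel_right[OF z] pl])
           (use e r pn[of _ \<eta>] in \<open>auto intro!: always_eventually intro: le_less_trans\<close>)
    qed
  qed
  have \<Phi>c: "continuous_on (sphere 0 1) (\<Phi> i)" for i
  proof -
    have "continuous_on (sphere 0 1) (\<lambda>\<zeta>. cauchy_kernel \<zeta> w)" if "w \<in> S i" for w
    proof -
      have "continuous_on (sphere 0 1) (\<lambda>\<zeta>. cnj (cauchy_kernel w \<zeta>))"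
        using that Sf(2)[of i] by (intro continuous_on_cnj continuous_on_cauchy_kernel) auto
      then show ?thesis by (simp add: cauchy_kernel_cnj)
    qed
    then show ?thesis unfolding \<Phi>_def by (intro continuous_intros) auto
  qed
  have \<Phi>m: "\<Phi> i \<in> borel_measurable \<sigma>" "\<Phi> i \<in> borel_measurable \<mu>" for i
    by (rule borel_measurable_sphereI[OF \<sigma>(2) \<Phi>c], rule borel_measurable_sphereI[OF \<mu>(2) \<Phi>c])
  show m1: "\<phi> \<in> borel_measurable \<sigma>"
    by (rule borel_measurable_LIMSEQ_metric[OF \<Phi>m(1) \<Phi>lim]) (simp add: sp)
  show m2: "\<phi> \<in> borel_measurable \<mu>"
    by (rule borel_measurable_LIMSEQ_metric[OF \<Phi>m(2) \<Phi>lim]) (simp add: sp)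
  have gm: "g \<in> borel_measurable \<sigma>" by (rule borel_measurable_sphereI[OF \<sigma>(2) g(1)])
  have "(\<lambda>i. \<integral>\<zeta>. cnj (\<Phi> i \<zeta>) * g \<zeta> \<partial>\<sigma>) \<longlonglongrightarrow> (\<integral>\<zeta>. cnj (\<phi> \<zeta>) * g \<zeta> \<partial>\<sigma>)"
  proof (rule integral_dominated_convergence[where w = "\<lambda>_. b * G"])
    show "AE \<zeta> in \<sigma>. norm (cnj (\<Phi> i \<zeta>) * g \<zeta>) \<le> b * G" for i
    proof (intro AE_I2)
      fix \<zeta> assume "\<zeta> \<in> space \<sigma>"
      then have "norm \<zeta> = 1" by (simp add: sp)
      then show "norm (cnj (\<Phi> i \<zeta>) * g \<zeta>) \<le> b * G"
        unfolding norm_mult using \<Phi>b[of \<zeta> i] g(2)[of \<zeta>] by (intro mult_mono) (auto intro: order_trans[OF norm_ge_zero])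
    qed
    show "AE \<zeta> in \<sigma>. (\<lambda>i. cnj (\<Phi> i \<zeta>) * g \<zeta>) \<longlonglongrightarrow> cnj (\<phi> \<zeta>) * g \<zeta>"
      by (intro AE_I2 tendsto_intros \<Phi>lim) (simp add: sp)
    show "integrable \<sigma> (\<lambda>_. b * G)" by (rule finite_measure.integrable_const[OF \<sigma>(1)])
  qed (use m1 gm \<Phi>m in simp_all)
  then have l1: "(\<lambda>i. cmod (\<integral>\<zeta>. cnj (\<Phi> i \<zeta>) * g \<zeta> \<partial>\<sigma>)) \<longlonglongrightarrow> cmod (\<integral>\<zeta>. cnj (\<phi> \<zeta>) * g \<zeta> \<partial>\<sigma>)"
    by (rule tendsto_norm)
  have "(\<lambda>i. \<integral>\<zeta>. (cmod (\<Phi> i \<zeta>))\<^sup>2 \<partial>\<mu>) \<longlonglongrightarrow> (\<integral>\<zeta>. (cmod (\<phi> \<zeta>))\<^sup>2 \<partial>\<mu>)"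
  proof (rule integral_dominated_convergence[where w = "\<lambda>_. b\<^sup>2"])
    show "AE \<zeta> in \<mu>. norm ((cmod (\<Phi> i \<zeta>))\<^sup>2) \<le> b\<^sup>2" for i
      using \<Phi>b by (intro AE_I2) (simp add: sp power_mono)
    show "AE \<zeta> in \<mu>. (\<lambda>i. (cmod (\<Phi> i \<zeta>))\<^sup>2) \<longlonglongrightarrow> (cmod (\<phi> \<zeta>))\<^sup>2"
      by (intro AE_I2 tendsto_intros \<Phi>lim) (simp add: sp)
    show "integrable \<mu> (\<lambda>_. b\<^sup>2)" by (rule finite_measure.integrable_const[OF \<mu>(1)])
  qed (use m2 \<Phi>m in simp_all)
  then have l2: "(\<lambda>i. M * sqrt (\<integral>\<zeta>. (cmod (\<Phi> i \<zeta>))\<^sup>2 \<partial>\<mu>)) \<longlonglongrightarrow> M * sqrt (\<integral>\<zeta>. (cmod (\<phi> \<zeta>))\<^sup>2 \<partial>\<mu>)"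
    by (intro tendsto_intros)
  show "cmod (\<integral>\<zeta>. cnj (\<phi> \<zeta>) * g \<zeta> \<partial>\<sigma>) \<le> M * sqrt (\<integral>\<zeta>. (cmod (\<phi> \<zeta>))\<^sup>2 \<partial>\<mu>)"
    by (rule LIMSEQ_le[OF l1 l2]) (use fin[OF Sf] in \<open>auto simp: \<Phi>_def\<close>)
qed

context inner_clark
begin

text \<open>The kernel bound is applied to the Cauchy transform \<phi> of \<psi> P. Uniformly
  |\<phi> - \<psi> P| \<le> E e; hence |\<phi>| \<le> |\<psi>| + E e for the \<mu>-side, and on the
  \<sigma>-side \<phi> is close to \<psi> in the mean. All errors are collected in Q e, which tends
  to the claimed bound as e tends to 0.\<close>

lemma lipschitz_estimate:
  fixes \<mu> :: "(complex ^ 'n) measure" and g \<psi> :: "complex ^ 'n \<Rightarrow> complex"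
  assumes \<mu>: "finite_measure \<mu>" "sets \<mu> = sets (restrict_space borel (sphere 0 1))"
    and g: "continuous_on (sphere 0 1) g" "\<And>\<zeta>. norm \<zeta> = 1 \<Longrightarrow> cmod (g \<zeta>) \<le> G" and M: "M \<ge> 0"
    and fin: "\<And>A c. finite A \<Longrightarrow> A \<subseteq> ball 0 1 \<Longrightarrow>
      cmod (\<integral>\<zeta>. cnj (\<Sum>w\<in>A. c w * cauchy_kernel \<zeta> w) * g \<zeta> \<partial>\<sigma>)
        \<le> M * sqrt (\<integral>\<zeta>. (cmod (\<Sum>w\<in>A. c w * cauchy_kernel \<zeta> w))\<^sup>2 \<partial>\<mu>)"
    and lip: "\<And>\<eta> z. norm \<eta> = 1 \<Longrightarrow> norm z = 1 \<Longrightarrow> cmod (\<psi> \<eta> - \<psi> z) \<le> K * norm (\<eta> - z)"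
    and K: "K \<ge> 0" and B: "\<And>z. norm z = 1 \<Longrightarrow> cmod (\<psi> z) \<le> B"
  shows "cmod (\<integral>\<zeta>. cnj (\<psi> \<zeta>) * g \<zeta> \<partial>\<sigma>) \<le> M * sqrt (\<integral>\<zeta>. (cmod (\<psi> \<zeta>))\<^sup>2 \<partial>\<mu>)"
proof -
  define s where "s = measure \<sigma> (sphere 0 1)"
  define m where "m = measure \<mu> (sphere 0 1)"
  have sp: "space \<mu> = sphere 0 1"
    using sets_eq_imp_space_eq[OF \<mu>(2)] by (simp add: space_restrict_space)
  have ex: "norm (axis undefined 1 :: complex ^ 'n) = 1" by simp
  have B0: "0 \<le> B" using B[OF ex] norm_ge_zero order_trans by blast
  have G0: "0 \<le> G" using g(2)[OF ex] norm_ge_zero order_trans by blast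
  have \<psi>c: "continuous_on (sphere 0 1) \<psi>"
    by (rule lipschitz_on_continuous_on[of K]) (use lip K in \<open>auto simp: lipschitz_on_def dist_norm\<close>)
  have \<psi>m: "\<psi> \<in> borel_measurable \<sigma>" "\<psi> \<in> borel_measurable \<mu>" and gm: "g \<in> borel_measurable \<sigma>"
    using borel_measurable_sphereI[OF \<sigma>D(4) \<psi>c] borel_measurable_sphereI[OF \<mu>(2) \<psi>c]
      borel_measurable_sphereI[OF \<sigma>D(4) g(1)] by auto
  have \<psi>i: "integrable \<mu> (\<lambda>\<zeta>. cmod (\<psi> \<zeta>))" "integrable \<mu> (\<lambda>\<zeta>. (cmod (\<psi> \<zeta>))\<^sup>2)"
  proof -
    show "integrable \<mu> (\<lambda>\<zeta>. cmod (\<psi> \<zeta>))"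
      using \<psi>m(2) B by (intro integrable_bounded_finite[OF \<mu>(1), where B = B]) (auto simp: sp)
    show "integrable \<mu> (\<lambda>\<zeta>. (cmod (\<psi> \<zeta>))\<^sup>2)"
      using \<psi>m(2) B by (intro integrable_bounded_finite[OF \<mu>(1), where B = "B\<^sup>2"]) (auto simp: sp intro!: power_mono)
  qed
  \<comment> \<open>\<open>2 * e\<close> for the near and far parts of the commutator,
    \<open>B * e\<close> for replacing P(r z) by P(z).\<close>
  define E where "E e = (2 + B) * e" for e :: real
  define Q where "Q e = M * sqrt ((\<integral>\<zeta>. (cmod (\<psi> \<zeta>))\<^sup>2 \<partial>\<mu>) + 2 * E e * (\<integral>\<zeta>. cmod (\<psi> \<zeta>) \<partial>\<mu>) + (E e)\<^sup>2 * m) + (E e * G * s + B * G * (e * s + e))" for e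
  have main: "cmod (\<integral>\<zeta>. cnj (\<psi> \<zeta>) * g \<zeta> \<partial>\<sigma>) \<le> Q e" if e: "e > 0" for e
  proof -
    define C where "C = 12 * K * 8 ^ CARD('n)"
    have C0: "0 \<le> C" using K by (simp add: C_def)
    \<comment> \<open>Makes the near part at most \<open>e\<close>; the \<open>+ 1\<close> covers
      \<open>C = 0\<close>. Only after \<delta> is fixed can the smallness \<epsilon> of the peak
      function be chosen, and only after P the radius r.\<close>
    define \<delta> where "\<delta> = min 1 ((e / (C + 1))\<^sup>2)"
    have \<delta>: "0 < \<delta>" "\<delta> \<le> 1" using e C0 by (auto simp: \<delta>_def)
    have C\<delta>: "C * sqrt \<delta> \<le> e"
    proof -
      have "sqrt \<delta> \<le> e / (C + 1)" using e C0 by (intro real_le_lsqrt) (auto simp: \<delta>_def)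
      then have "C * sqrt \<delta> \<le> C * (e / (C + 1))" using C0 by (intro mult_left_mono)
      also have "\<dots> \<le> e" using e C0 by (simp add: divide_simps)
      finally show ?thesis .
    qed
    \<comment> \<open>The first bound serves the \<sigma>-integral, which is later divided by
      \<open>e\<close>; the second absorbs the factor \<open>2 * B / \<delta> ^ CARD('n)\<close> of
      the far part.\<close>
    define \<epsilon> where "\<epsilon> = min (e\<^sup>2) (e * \<delta> ^ CARD('n) / (2 * B + 1))"
    have \<epsilon>: "\<epsilon> > 0" using e \<delta> B0 by (simp add: \<epsilon>_def)
    obtain P R where R: "R > 1" and P: "line_holomorphic R P" and Pb: "\<And>z. norm z \<le> 1 \<Longrightarrow> cmod (P z) \<le> 1"
      and P1: "(\<integral>\<eta>. cmod (P \<eta>) \<partial>sphere_measure) < \<epsilon>" and P2: "(\<integral>\<zeta>. (cmod (1 - P \<zeta>))\<^sup>2 \<partial>\<sigma>) < \<epsilon>"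
      using peak_functions[OF \<epsilon>] by metis
    have B\<epsilon>: "2 * B / \<delta> ^ CARD('n) * (\<integral>\<eta>. cmod (P \<eta>) \<partial>sphere_measure) \<le> e"
    proof -
      have "2 * B / \<delta> ^ CARD('n) * (\<integral>\<eta>. cmod (P \<eta>) \<partial>sphere_measure) \<le> 2 * B / \<delta> ^ CARD('n) * (e * \<delta> ^ CARD('n) / (2 * B + 1))"
        using P1 \<delta> B0 by (intro mult_left_mono) (auto simp: \<epsilon>_def)
      also have "\<dots> = e * (2 * B / (2 * B + 1))" using \<delta> by simp
      also have "\<dots> \<le> e" using e B0 by (simp add: divide_simps)
      finally show ?thesis .
    qed
    have cP: "continuous_on (cball 0 1) P" by (rule line_holomorphic_continuous[OF P R])
    then have "uniformly_continuous_on (cball 0 1) P" by (rule compact_uniformly_continuous) simp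
    then obtain d where d: "d > 0" "\<And>x y. norm x \<le> 1 \<Longrightarrow> norm y \<le> 1 \<Longrightarrow> dist x y < d \<Longrightarrow> dist (P x) (P y) < e"
      unfolding uniformly_continuous_on_def using e by (metis mem_cball dist_0_norm)
    define r where "r = 1 - min d 1 / 2"
    have r: "0 < r" "r < 1" "1 - r < d" using d by (auto simp: r_def min_def)
    define F where "F \<eta> = \<psi> \<eta> * P \<eta>" for \<eta>
    define \<phi> where "\<phi> \<zeta> = (\<integral>\<eta>. cauchy_kernel (r *\<^sub>R \<zeta>) \<eta> * F \<eta> \<partial>sphere_measure)" for \<zeta>
    have cPs: "continuous_on (sphere 0 1) P" by (rule continuous_on_subset[OF cP]) auto
    have F: "continuous_on (sphere 0 1) F" unfolding F_def by (intro continuous_intros \<psi>c cPs)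
    have Fb: "cmod (F \<zeta>) \<le> B" if "norm \<zeta> = 1" for \<zeta>
      using mult_mono[OF B[OF that] Pb[of \<zeta>]] that B0 by (simp add: F_def norm_mult)
    note sup = kernel_superposition[OF \<sigma>D(2,4) \<mu> g fin F Fb r(1,2) \<phi>_def]
    have close: "cmod (\<phi> z - \<psi> z * P z) \<le> E e" if z: "norm z = 1" for z
    proof -
      have "cmod (\<phi> z - \<psi> z * P (r *\<^sub>R z)) \<le> C * sqrt \<delta> + 2 * B / \<delta> ^ CARD('n) * (\<integral>\<eta>. cmod (P \<eta>) \<partial>sphere_measure)"
        unfolding \<phi>_def F_def C_def by (rule toeplitz_commutator_bound[OF R P Pb lip K B z r(1,2) \<delta>])
      then have 1: "cmod (\<phi> z - \<psi> z * P (r *\<^sub>R z)) \<le> 2 * e" using C\<delta> B\<epsilon> by linarith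
      have "norm (r *\<^sub>R z - z) = 1 - r"
      proof -
        have "r *\<^sub>R z - z = (r - 1) *\<^sub>R z" by (simp add: scaleR_diff_left)
        then show ?thesis using z r by simp
      qed
      then have "dist (P (r *\<^sub>R z)) (P z) < e" using z r by (intro d(2)) (auto simp: dist_norm)
      then have "cmod (\<psi> z) * cmod (P (r *\<^sub>R z) - P z) \<le> B * e"
        using B[OF z] B0 by (intro mult_mono) (auto simp: dist_norm)
      then have 2: "cmod (\<psi> z * P (r *\<^sub>R z) - \<psi> z * P z) \<le> B * e"
        by (simp add: norm_mult[symmetric] right_diff_distrib)
      show ?thesis using norm_triangle_ineq[of "\<phi> z - \<psi> z * P (r *\<^sub>R z)" "\<psi> z * P (r *\<^sub>R z) - \<psi> z * P z"] 1 2
        by (simp add: E_def algebra_simps)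
    qed
    have \<phi>b: "cmod (\<phi> z) \<le> cmod (\<psi> z) + E e" if z: "norm z = 1" for z
    proof -
      have "cmod (\<psi> z * P z) \<le> cmod (\<psi> z)" using Pb[of z] z by (simp add: norm_mult mult_left_le)
      then show ?thesis using close[OF z] norm_triangle_ineq2[of "\<phi> z" "\<psi> z * P z"] by linarith
    qed
    have E0: "0 \<le> E e" using e B0 by (simp add: E_def)
    have \<phi>bb: "cmod (\<phi> z) \<le> B + E e" if z: "norm z = 1" for z using \<phi>b[OF z] B[OF z] by linarith
    have "(\<integral>\<zeta>. (cmod (\<phi> \<zeta>))\<^sup>2 \<partial>\<mu>) \<le> (\<integral>\<zeta>. (cmod (\<psi> \<zeta>))\<^sup>2 + 2 * E e * cmod (\<psi> \<zeta>) + (E e)\<^sup>2 \<partial>\<mu>)"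
    proof (rule integral_mono)
      show "integrable \<mu> (\<lambda>\<zeta>. (cmod (\<phi> \<zeta>))\<^sup>2)"
        using sup(3) \<phi>bb by (auto intro!: integrable_bounded_finite[OF \<mu>(1), where B = "(B + E e)\<^sup>2"] power_mono simp: sp)
      show "integrable \<mu> (\<lambda>\<zeta>. (cmod (\<psi> \<zeta>))\<^sup>2 + 2 * E e * cmod (\<psi> \<zeta>) + (E e)\<^sup>2)"
        by (intro Bochner_Integration.integrable_add integrable_mult_right \<psi>i finite_measure.integrable_const[OF \<mu>(1)])
      fix \<zeta> assume "\<zeta> \<in> space \<mu>"
      then have "(cmod (\<phi> \<zeta>))\<^sup>2 \<le> (cmod (\<psi> \<zeta>) + E e)\<^sup>2" using \<phi>b[of \<zeta>] by (intro power_mono) (auto simp: sp)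
      then show "(cmod (\<phi> \<zeta>))\<^sup>2 \<le> (cmod (\<psi> \<zeta>))\<^sup>2 + 2 * E e * cmod (\<psi> \<zeta>) + (E e)\<^sup>2"
        by (simp add: power2_eq_square algebra_simps)
    qed
    also have "\<dots> = (\<integral>\<zeta>. (cmod (\<psi> \<zeta>))\<^sup>2 \<partial>\<mu>) + 2 * E e * (\<integral>\<zeta>. cmod (\<psi> \<zeta>) \<partial>\<mu>) + (E e)\<^sup>2 * m"
      by (subst Bochner_Integration.integral_add
          | intro Bochner_Integration.integrable_add integrable_mult_right \<psi>i finite_measure.integrable_const[OF \<mu>(1)])+
         (simp add: sp m_def mult.commute)
    finally have I1: "cmod (\<integral>\<zeta>. cnj (\<phi> \<zeta>) * g \<zeta> \<partial>\<sigma>) \<le> M * sqrt ((\<integral>\<zeta>. (cmod (\<psi> \<zeta>))\<^sup>2 \<partial>\<mu>) + 2 * E e * (\<integral>\<zeta>. cmod (\<psi> \<zeta>) \<partial>\<mu>) + (E e)\<^sup>2 * m)"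
      using sup(1) M by (meson mult_left_mono order_trans real_sqrt_le_mono)
    have Pm: "P \<in> borel_measurable \<sigma>" by (rule borel_measurable_sphereI[OF \<sigma>D(4) cPs])
    have P1i: "integrable \<sigma> (\<lambda>\<zeta>. (cmod (1 - P \<zeta>))\<^sup>2)"
    proof (rule integrable_bounded_finite[OF \<sigma>D(2), where B = 4])
      fix \<zeta> assume "\<zeta> \<in> space \<sigma>"
      then have "cmod (1 - P \<zeta>) \<le> 2" using Pb[of \<zeta>] norm_triangle_ineq4[of 1 "P \<zeta>"] by (simp add: \<sigma>D(1))
      then have "(cmod (1 - P \<zeta>))\<^sup>2 \<le> 2\<^sup>2" by (intro power_mono) auto
      then show "norm ((cmod (1 - P \<zeta>))\<^sup>2) \<le> 4" by simp
    qed (use Pm in measurable)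
    have ig: "integrable \<sigma> (\<lambda>\<zeta>. cnj (\<psi> \<zeta>) * g \<zeta>)" "integrable \<sigma> (\<lambda>\<zeta>. cnj (\<phi> \<zeta>) * g \<zeta>)"
    proof -
      show "integrable \<sigma> (\<lambda>\<zeta>. cnj (\<psi> \<zeta>) * g \<zeta>)"
        using \<psi>m gm B g(2) B0 by (intro integrable_bounded_finite[OF \<sigma>D(2), where B = "B * G"]) (auto simp: norm_mult \<sigma>D(1) intro!: mult_mono)
      show "integrable \<sigma> (\<lambda>\<zeta>. cnj (\<phi> \<zeta>) * g \<zeta>)"
        using sup(2) gm \<phi>bb g(2) B0 E0 by (intro integrable_bounded_finite[OF \<sigma>D(2), where B = "(B + E e) * G"]) (auto simp: norm_mult \<sigma>D(1) intro!: mult_mono)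
    qed
    have "cmod (\<integral>\<zeta>. cnj (\<psi> \<zeta>) * g \<zeta> - cnj (\<phi> \<zeta>) * g \<zeta> \<partial>\<sigma>) \<le> (\<integral>\<zeta>. E e * G + B * G * (e + (cmod (1 - P \<zeta>))\<^sup>2 / e) \<partial>\<sigma>)"
    proof (rule norm_lebesgue_integral_le)
      show "integrable \<sigma> (\<lambda>\<zeta>. cnj (\<psi> \<zeta>) * g \<zeta> - cnj (\<phi> \<zeta>) * g \<zeta>)" using ig by simp
      show "integrable \<sigma> (\<lambda>\<zeta>. E e * G + B * G * (e + (cmod (1 - P \<zeta>))\<^sup>2 / e))"
        by (intro Bochner_Integration.integrable_add integrable_mult_right integrable_divide P1i finite_measure.integrable_const[OF \<sigma>D(2)])
      fix \<zeta> assume "\<zeta> \<in> space \<sigma>"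
      then have z: "norm \<zeta> = 1" by (simp add: \<sigma>D(1))
      \<comment> \<open>Converts smallness of the squared deviation into smallness in the mean
        without roots: split according to whether the deviation exceeds \<open>e\<close>.\<close>
      have "cmod (1 - P \<zeta>) \<le> e + (cmod (1 - P \<zeta>))\<^sup>2 / e"
      proof (cases "cmod (1 - P \<zeta>) \<le> e")
        case True
        have "0 \<le> (cmod (1 - P \<zeta>))\<^sup>2 / e" using e by simp
        then show ?thesis using True by linarith
      next
        case False
        then have "cmod (1 - P \<zeta>) * e \<le> cmod (1 - P \<zeta>) * cmod (1 - P \<zeta>)" by (intro mult_left_mono) auto
        then have "cmod (1 - P \<zeta>) \<le> (cmod (1 - P \<zeta>))\<^sup>2 / e" using e by (simp add: pos_le_divide_eq power2_eq_square)
        then show ?thesis using e by linarith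
      qed
      then have "cmod (\<psi> \<zeta>) * cmod (1 - P \<zeta>) \<le> B * (e + (cmod (1 - P \<zeta>))\<^sup>2 / e)"
        using B[OF z] B0 by (intro mult_mono) auto
      then have "cmod (\<psi> \<zeta> - \<psi> \<zeta> * P \<zeta>) \<le> B * (e + (cmod (1 - P \<zeta>))\<^sup>2 / e)"
        by (simp add: norm_mult[symmetric] right_diff_distrib)
      then have "cmod (\<psi> \<zeta> - \<phi> \<zeta>) \<le> E e + B * (e + (cmod (1 - P \<zeta>))\<^sup>2 / e)"
        using close[OF z] norm_triangle_ineq4[of "\<psi> \<zeta> - \<psi> \<zeta> * P \<zeta>" "\<phi> \<zeta> - \<psi> \<zeta> * P \<zeta>"] by simp
      then have "cmod (\<psi> \<zeta> - \<phi> \<zeta>) * cmod (g \<zeta>) \<le> (E e + B * (e + (cmod (1 - P \<zeta>))\<^sup>2 / e)) * G"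
        using g(2)[OF z] E0 B0 e by (intro mult_mono) auto
      moreover have "cnj (\<psi> \<zeta>) * g \<zeta> - cnj (\<phi> \<zeta>) * g \<zeta> = cnj (\<psi> \<zeta> - \<phi> \<zeta>) * g \<zeta>" by (simp add: algebra_simps)
      ultimately show "norm (cnj (\<psi> \<zeta>) * g \<zeta> - cnj (\<phi> \<zeta>) * g \<zeta>) \<le> E e * G + B * G * (e + (cmod (1 - P \<zeta>))\<^sup>2 / e)"
        by (simp only: norm_mult complex_mod_cnj) (simp add: algebra_simps)
    qed
    also have "\<dots> = E e * G * s + B * G * (e * s + (\<integral>\<zeta>. (cmod (1 - P \<zeta>))\<^sup>2 \<partial>\<sigma>) / e)"
      by (subst Bochner_Integration.integral_add integral_mult_right_zero
          | intro Bochner_Integration.integrable_add integrable_mult_right integrable_divide P1i finite_measure.integrable_const[OF \<sigma>D(2)])+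
         (simp add: \<sigma>D(1) s_def mult_ac)
    also have "\<dots> \<le> E e * G * s + B * G * (e * s + e)"
    proof -
      have "(\<integral>\<zeta>. (cmod (1 - P \<zeta>))\<^sup>2 \<partial>\<sigma>) / e \<le> e" using P2 e by (simp add: \<epsilon>_def pos_divide_le_eq power2_eq_square)
      then show ?thesis using B0 G0 by (intro add_left_mono mult_left_mono) auto
    qed
    finally have I2: "cmod ((\<integral>\<zeta>. cnj (\<psi> \<zeta>) * g \<zeta> \<partial>\<sigma>) - (\<integral>\<zeta>. cnj (\<phi> \<zeta>) * g \<zeta> \<partial>\<sigma>)) \<le> E e * G * s + B * G * (e * s + e)"
      using ig by simp
    show ?thesis unfolding Q_def
      using I1 I2 norm_triangle_sub[of "\<integral>\<zeta>. cnj (\<psi> \<zeta>) * g \<zeta> \<partial>\<sigma>" "\<integral>\<zeta>. cnj (\<phi> \<zeta>) * g \<zeta> \<partial>\<sigma>"] by linarith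
  qed
  have "(\<lambda>k. Q (inverse (real (Suc k)))) \<longlonglongrightarrow> M * sqrt ((\<integral>\<zeta>. (cmod (\<psi> \<zeta>))\<^sup>2 \<partial>\<mu>) + 2 * ((2 + B) * 0) * (\<integral>\<zeta>. cmod (\<psi> \<zeta>) \<partial>\<mu>) + ((2 + B) * 0)\<^sup>2 * m) + ((2 + B) * 0 * G * s + B * G * (0 * s + 0))"
    unfolding Q_def E_def by (intro tendsto_intros LIMSEQ_inverse_real_of_nat)
  then have "(\<lambda>k. Q (inverse (real (Suc k)))) \<longlonglongrightarrow> M * sqrt (\<integral>\<zeta>. (cmod (\<psi> \<zeta>))\<^sup>2 \<partial>\<mu>)" by simp
  then show ?thesis by (rule LIMSEQ_le_const) (use main in auto)
qed

end

section \<open>Absolute continuity from an integral estimate\<close>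

text \<open>Lipschitz functions decreasing to the indicator of a closed set. The empty set is
  treated separately because \<open>infdist\<close> to it is 0 by convention, which would give the
  constant 1.\<close>

definition bump :: "nat \<Rightarrow> 'a :: metric_space set \<Rightarrow> 'a \<Rightarrow> real" where
  "bump m K x = (if K = {} then 0 else max 0 (1 - m * infdist x K))"

lemma bump_bounds: "0 \<le> bump m K x" "bump m K x \<le> 1"
  by (auto simp: bump_def infdist_nonneg)

lemma bump_lipschitz: "\<bar>bump m K x - bump m K y\<bar> \<le> m * dist x y"
proof (cases "K = {}")
  case False
  have "\<bar>infdist x K - infdist y K\<bar> \<le> dist x y"
    using infdist_triangle[of x K y] infdist_triangle[of y K x] by (simp add: dist_commute abs_le_iff)
  then have "\<bar>m * infdist x K - m * infdist y K\<bar> \<le> m * dist x y"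
    by (simp add: right_diff_distrib[symmetric] abs_mult mult_left_mono)
  then show ?thesis using False by (auto simp: bump_def max_def abs_le_iff)
qed (simp add: bump_def)

lemma bump_limit:
  assumes "closed K" shows "(\<lambda>m. bump m K x) \<longlonglongrightarrow> indicator K x"
proof (cases "K = {}")
  case False
  show ?thesis
  proof (cases "x \<in> K")
    case True
    then show ?thesis using False by (simp add: bump_def)
  next
    case out: False
    then have d: "infdist x K > 0"
      using in_closed_iff_infdist_zero[OF assms False, of x] infdist_nonneg[of x K] by simp
    obtain N where N: "1 / infdist x K < real N" using reals_Archimedean2 by blast
    have "bump m K x = 0" if "m \<ge> N" for m
    proof -
      have "1 < real N * infdist x K" using N d by (simp add: divide_less_eq)
      also have "\<dots> \<le> real m * infdist x K" using that d by (intro mult_right_mono) auto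
      finally show ?thesis using False by (simp add: bump_def)
    qed
    then have "\<forall>\<^sub>F m in sequentially. bump m K x = 0" by (auto simp: eventually_sequentially)
    then show ?thesis using out by (simp add: tendsto_eventually)
  qed
qed (simp add: bump_def)

text \<open>Integration against \<sigma> is bounded in the norm of L^2(\<mu>) on nonnegative
  Lipschitz functions; by duality this should produce a density in L^2(\<mu>). The test class is
  enlarged to simple functions, then the density is tested against itself.\<close>

locale l2_dominated =
  fixes \<sigma> \<mu> :: "(complex ^ 'n) measure" and M :: real
  assumes \<sigma>: "finite_measure \<sigma>" "sets \<sigma> = sets (restrict_space borel (sphere 0 1))"
    and \<mu>: "finite_measure \<mu>" "sets \<mu> = sets (restrict_space borel (sphere 0 1))"
    and M: "M \<ge> 0"
    and lip: "\<And>\<theta> K B. K \<ge> 0 \<Longrightarrow> (\<And>x. 0 \<le> \<theta> x) \<Longrightarrow> (\<And>x. \<theta> x \<le> B) \<Longrightarrow>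
      (\<And>x y. \<bar>\<theta> x - \<theta> y\<bar> \<le> K * dist x y) \<Longrightarrow>
      (\<integral>\<zeta>. \<theta> \<zeta> \<partial>\<sigma>) \<le> M * sqrt (\<integral>\<zeta>. (\<theta> \<zeta>)\<^sup>2 \<partial>\<mu>)"
begin

lemma spaces: "space \<sigma> = sphere 0 1" "space \<mu> = sphere 0 1"
  using sets_eq_imp_space_eq[OF \<sigma>(2)] sets_eq_imp_space_eq[OF \<mu>(2)] by (simp_all add: space_restrict_space)

lemma sets_iff: "A \<in> sets \<sigma> \<longleftrightarrow> A \<subseteq> sphere 0 1 \<and> A \<in> sets borel" "sets \<mu> = sets \<sigma>"
  by (auto simp: \<sigma>(2) \<mu>(2) sets_restrict_space_iff)

text \<open>The Lipschitz functions \<Sum> a_i \<open>bump m (K i)\<close> converge boundedly to the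
  simple function, and disjointness makes the square of its sum the sum of the squares.\<close>

lemma estimate_compact:
  assumes I: "finite I" and K: "\<And>i. i \<in> I \<Longrightarrow> compact (K i)" "\<And>i. i \<in> I \<Longrightarrow> K i \<subseteq> sphere 0 1"
    and dis: "disjoint_family_on K I" and a: "\<And>i. i \<in> I \<Longrightarrow> 0 \<le> a i"
  shows "(\<Sum>i\<in>I. a i * measure \<sigma> (K i)) \<le> M * sqrt (\<Sum>i\<in>I. (a i)\<^sup>2 * measure \<mu> (K i))"
proof -
  define \<theta> where "\<theta> m x = (\<Sum>i\<in>I. a i * bump m (K i) x)" for m x
  define \<theta>' where "\<theta>' x = (\<Sum>i\<in>I. a i * indicator (K i) x)" for x :: "complex ^ 'n"
  have Kc: "closed (K i)" "K i \<in> sets \<sigma>" "K i \<in> sets \<mu>" if "i \<in> I" for i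
    using K[OF that] sets_iff borel_compact[OF K(1)[OF that]] by (auto intro: compact_imp_closed)
  have \<theta>b: "0 \<le> \<theta> m x" "\<theta> m x \<le> sum a I" for m x
    unfolding \<theta>_def using a bump_bounds[of m _ x]
    by (auto intro!: sum_nonneg sum_mono mult_left_le)
  have \<theta>l: "\<bar>\<theta> m x - \<theta> m y\<bar> \<le> (sum a I * m) * dist x y" for m x y
  proof -
    have "\<bar>\<theta> m x - \<theta> m y\<bar> \<le> (\<Sum>i\<in>I. \<bar>a i * bump m (K i) x - a i * bump m (K i) y\<bar>)"
      unfolding \<theta>_def sum_subtractf[symmetric] by (rule sum_abs)
    also have "\<dots> \<le> (\<Sum>i\<in>I. a i * (m * dist x y))"
      using a bump_lipschitz by (intro sum_mono) (auto simp: right_diff_distrib[symmetric] abs_mult intro!: mult_left_mono)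
    also have "\<dots> = (sum a I * m) * dist x y" by (simp add: sum_distrib_right mult.assoc)
    finally show ?thesis .
  qed
  have A0: "0 \<le> sum a I" using a by (rule sum_nonneg)
  have lim: "(\<lambda>m. \<theta> m x) \<longlonglongrightarrow> \<theta>' x" for x
    unfolding \<theta>_def \<theta>'_def by (intro tendsto_intros bump_limit Kc)
  have \<theta>c: "continuous_on (sphere 0 1) (\<theta> m)" for m
    by (rule lipschitz_on_continuous_on[of "sum a I * m"]) (use \<theta>l A0 in \<open>auto simp: lipschitz_on_def dist_real_def\<close>)
  have \<theta>m: "\<theta> m \<in> borel_measurable \<sigma>" "\<theta> m \<in> borel_measurable \<mu>" for m
    by (rule borel_measurable_sphereI[OF \<sigma>(2) \<theta>c], rule borel_measurable_sphereI[OF \<mu>(2) \<theta>c])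
  have \<theta>'m: "\<theta>' \<in> borel_measurable \<sigma>" "\<theta>' \<in> borel_measurable \<mu>"
    unfolding \<theta>'_def using Kc by measurable
  have "(\<lambda>m. \<integral>x. \<theta> m x \<partial>\<sigma>) \<longlonglongrightarrow> (\<integral>x. \<theta>' x \<partial>\<sigma>)"
  proof (rule integral_dominated_convergence[where w = "\<lambda>_. sum a I"])
    show "integrable \<sigma> (\<lambda>_. sum a I)" by (rule finite_measure.integrable_const[OF \<sigma>(1)])
  qed (use \<theta>m \<theta>'m lim \<theta>b in auto)
  moreover have "(\<lambda>m. \<integral>x. (\<theta> m x)\<^sup>2 \<partial>\<mu>) \<longlonglongrightarrow> (\<integral>x. (\<theta>' x)\<^sup>2 \<partial>\<mu>)"
  proof (rule integral_dominated_convergence[where w = "\<lambda>_. (sum a I)\<^sup>2"])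
    show "integrable \<mu> (\<lambda>_. (sum a I)\<^sup>2)" by (rule finite_measure.integrable_const[OF \<mu>(1)])
    show "AE x in \<mu>. (\<lambda>m. (\<theta> m x)\<^sup>2) \<longlonglongrightarrow> (\<theta>' x)\<^sup>2" by (intro AE_I2 tendsto_intros lim)
  qed (use \<theta>m \<theta>'m \<theta>b in \<open>auto intro!: power_mono\<close>)
  ultimately have "(\<integral>x. \<theta>' x \<partial>\<sigma>) \<le> M * sqrt (\<integral>x. (\<theta>' x)\<^sup>2 \<partial>\<mu>)"
    by (rule LIMSEQ_le[OF _ tendsto_mult[OF tendsto_const tendsto_real_sqrt]])
       (use lip[of "sum a I * _", OF _ \<theta>b \<theta>l] A0 in auto)
  moreover have "(\<integral>x. \<theta>' x \<partial>\<sigma>) = (\<Sum>i\<in>I. a i * measure \<sigma> (K i))"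
    unfolding \<theta>'_def using Kc finite_measure.emeasure_finite[OF \<sigma>(1)]
    by (subst Bochner_Integration.integral_sum) (auto simp: less_top[symmetric])
  moreover have "(\<theta>' x)\<^sup>2 = (\<Sum>i\<in>I. (a i)\<^sup>2 * indicator (K i) x)" for x
  proof (cases "\<exists>i\<in>I. x \<in> K i")
    case True
    then obtain i where i: "i \<in> I" "x \<in> K i" by blast
    have "x \<notin> K j" if "j \<in> I" "j \<noteq> i" for j using dis i that unfolding disjoint_family_on_def by blast
    then have "(\<Sum>j\<in>I. c j * indicator (K j) x) = c i" for c :: "_ \<Rightarrow> real"
      using i by (subst sum.remove[OF I i(1)]) (auto simp: sum.neutral)
    then show ?thesis by (simp add: \<theta>'_def)
  qed (simp add: \<theta>'_def sum.neutral)
  moreover have "(\<integral>x. (\<Sum>i\<in>I. (a i)\<^sup>2 * indicator (K i) x) \<partial>\<mu>) = (\<Sum>i\<in>I. (a i)\<^sup>2 * measure \<mu> (K i))"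
    using Kc finite_measure.emeasure_finite[OF \<mu>(1)]
    by (subst Bochner_Integration.integral_sum) (auto simp: less_top[symmetric])
  ultimately show ?thesis by simp
qed

text \<open>Inner regularity is available for Borel measures on the whole space, so \<sigma> is
  transported there; compact subsets of A lie on the sphere and keep their measure.\<close>

lemma inner_regular_sphere:
  assumes A: "A \<in> sets \<sigma>" and e: "e > 0"
  obtains K where "compact K" "K \<subseteq> A" "measure \<sigma> A \<le> measure \<sigma> K + e"
proof -
  interpret finite_measure \<sigma> by (rule \<sigma>)
  have id: "(\<lambda>x. x) \<in> borel_measurable \<sigma>"
    by (rule borel_measurable_sphereI[OF \<sigma>(2)]) (intro continuous_intros)
  define N where "N = distr \<sigma> borel (\<lambda>x. x)"
  have N: "emeasure N B = emeasure \<sigma> (B \<inter> sphere 0 1)" if "B \<in> sets borel" for B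
    unfolding N_def using that by (subst emeasure_distr[OF id]) (auto simp: spaces)
  have A': "A \<in> sets borel" "A \<subseteq> sphere 0 1" using A sets_iff by auto
  have "emeasure N A = (SUP K \<in> {K. K \<subseteq> A \<and> compact K}. emeasure N K)"
    by (rule inner_regular) (use A' in \<open>auto simp: N_def emeasure_distr id\<close>)
  moreover have NA: "emeasure N A = ennreal (measure \<sigma> A)"
    using A' by (simp add: N Int_absorb2 emeasure_eq_measure)
  ultimately have S: "(SUP K \<in> {K. K \<subseteq> A \<and> compact K}. emeasure N K) = ennreal (measure \<sigma> A)" by simp
  show ?thesis
  proof (cases "measure \<sigma> A \<le> e")
    case True
    then show ?thesis using that[of "{}"] by simp
  next
    case False
    then have "ennreal (measure \<sigma> A - e) < (SUP K \<in> {K. K \<subseteq> A \<and> compact K}. emeasure N K)"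
      unfolding S using e by (simp add: ennreal_less_iff)
    then obtain K where K: "K \<subseteq> A" "compact K" "ennreal (measure \<sigma> A - e) < emeasure N K"
      unfolding less_SUP_iff by blast
    have "K \<inter> sphere 0 1 = K" using K A' by blast
    then have "emeasure N K = ennreal (measure \<sigma> K)"
      using K N[of K] by (simp add: borel_compact emeasure_eq_measure)
    then have "measure \<sigma> A - e < measure \<sigma> K" using K(3) False by (simp add: ennreal_less_iff)
    then show ?thesis using that[of K] K by simp
  qed
qed

text \<open>Compact subsets cost at most \<open>d\<close> per set on the \<sigma>-side, can only
  decrease the \<mu>-side, and stay disjoint.\<close>

lemma estimate_borel:
  assumes I: "finite I" and A: "\<And>i. i \<in> I \<Longrightarrow> A i \<in> sets \<sigma>"
    and dis: "disjoint_family_on A I" and a: "\<And>i. i \<in> I \<Longrightarrow> 0 \<le> a i"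
  shows "(\<Sum>i\<in>I. a i * measure \<sigma> (A i)) \<le> M * sqrt (\<Sum>i\<in>I. (a i)\<^sup>2 * measure \<mu> (A i))"
proof (rule field_le_epsilon)
  fix e :: real assume e: "e > 0"
  define d where "d = e / (sum a I + 1)"
  have A0: "0 \<le> sum a I" using a by (rule sum_nonneg)
  have d: "d > 0" using e A0 by (simp add: d_def)
  have "\<forall>i\<in>I. \<exists>K. compact K \<and> K \<subseteq> A i \<and> measure \<sigma> (A i) \<le> measure \<sigma> K + d"
    using inner_regular_sphere[OF A d] by metis
  then obtain K where K: "\<And>i. i \<in> I \<Longrightarrow> compact (K i)" "\<And>i. i \<in> I \<Longrightarrow> K i \<subseteq> A i"
    "\<And>i. i \<in> I \<Longrightarrow> measure \<sigma> (A i) \<le> measure \<sigma> (K i) + d" by metis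
  have "(\<Sum>i\<in>I. a i * measure \<sigma> (A i)) \<le> (\<Sum>i\<in>I. a i * measure \<sigma> (K i) + a i * d)"
    using K(3) a by (intro sum_mono) (simp add: distrib_left[symmetric] mult_left_mono)
  also have "\<dots> = (\<Sum>i\<in>I. a i * measure \<sigma> (K i)) + sum a I * d"
    by (simp add: sum.distrib sum_distrib_right)
  also have "sum a I * d \<le> e" using e A0 by (simp add: d_def divide_simps)
  also have "(\<Sum>i\<in>I. a i * measure \<sigma> (K i)) \<le> M * sqrt (\<Sum>i\<in>I. (a i)\<^sup>2 * measure \<mu> (K i))"
  proof (rule estimate_compact[OF I K(1) _ _ a])
    show "K i \<subseteq> sphere 0 1" if "i \<in> I" for i using K(2)[OF that] A[OF that] sets_iff by auto
    show "disjoint_family_on K I" using dis K(2) unfolding disjoint_family_on_def by blast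
  qed
  also have "M * sqrt (\<Sum>i\<in>I. (a i)\<^sup>2 * measure \<mu> (K i)) \<le> M * sqrt (\<Sum>i\<in>I. (a i)\<^sup>2 * measure \<mu> (A i))"
    using K(2) A sets_iff(2)
    by (intro mult_left_mono M real_sqrt_le_mono sum_mono finite_measure.finite_measure_mono[OF \<mu>(1)]) auto
  finally show "(\<Sum>i\<in>I. a i * measure \<sigma> (A i)) \<le> M * sqrt (\<Sum>i\<in>I. (a i)\<^sup>2 * measure \<mu> (A i)) + e" by simp
qed

lemma integral_simple_function:
  fixes f :: "complex ^ 'n \<Rightarrow> real"
  assumes f: "simple_function \<nu> f" and \<nu>: "finite_measure \<nu>"
  shows "(\<integral>x. f x \<partial>\<nu>) = (\<Sum>y\<in>f ` space \<nu>. y * measure \<nu> (f -` {y} \<inter> space \<nu>))"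
proof -
  have "(\<integral>x. f x \<partial>\<nu>) = (\<integral>x. (\<Sum>y\<in>f ` space \<nu>. y * indicator (f -` {y} \<inter> space \<nu>) x) \<partial>\<nu>)"
    by (rule Bochner_Integration.integral_cong[OF refl])
       (simp add: simple_functionD(1)[OF f] indicator_def if_distrib cong: if_cong)
  also have "\<dots> = (\<Sum>y\<in>f ` space \<nu>. y * measure \<nu> (f -` {y} \<inter> space \<nu>))"
    using simple_functionD[OF f] finite_measure.emeasure_finite[OF \<nu>]
    by (subst Bochner_Integration.integral_sum) (auto simp: less_top[symmetric])
  finally show ?thesis .
qed

lemma estimate_simple:
  assumes f: "simple_function \<sigma> f" and nn: "\<And>x. 0 \<le> f x"
  shows "(\<integral>x. f x \<partial>\<sigma>) \<le> M * sqrt (\<integral>x. (f x)\<^sup>2 \<partial>\<mu>)"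
proof -
  have s: "space \<mu> = space \<sigma>" by (simp add: spaces)
  have f': "simple_function \<mu> f" using f by (simp add: simple_function_def s sets_iff(2))
  have "(\<integral>x. f x \<partial>\<sigma>) \<le> M * sqrt (\<Sum>y\<in>f ` space \<sigma>. y\<^sup>2 * measure \<mu> (f -` {y} \<inter> space \<sigma>))"
    unfolding integral_simple_function[OF f \<sigma>(1)]
    by (rule estimate_borel) (use simple_functionD[OF f] nn in \<open>auto simp: disjoint_family_on_def\<close>)
  also have "(\<Sum>y\<in>f ` space \<sigma>. y\<^sup>2 * measure \<mu> (f -` {y} \<inter> space \<sigma>)) = (\<integral>x. (f x)\<^sup>2 \<partial>\<mu>)"
  proof -
    have "(\<integral>x. (f x)\<^sup>2 \<partial>\<mu>) = (\<integral>x. (\<Sum>y\<in>f ` space \<mu>. y\<^sup>2 * indicator (f -` {y} \<inter> space \<mu>) x) \<partial>\<mu>)"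
      by (rule Bochner_Integration.integral_cong[OF refl])
         (simp add: simple_functionD(1)[OF f'] indicator_def if_distrib cong: if_cong)
    also have "\<dots> = (\<Sum>y\<in>f ` space \<mu>. y\<^sup>2 * measure \<mu> (f -` {y} \<inter> space \<mu>))"
      using simple_functionD[OF f'] finite_measure.emeasure_finite[OF \<mu>(1)]
      by (subst Bochner_Integration.integral_sum) (auto simp: less_top[symmetric])
    finally show ?thesis by (simp add: s)
  qed
  finally show ?thesis .
qed

lemma abs_continuous: "absolutely_continuous \<mu> \<sigma>"
  unfolding absolutely_continuous_def
proof
  fix A assume A: "A \<in> null_sets \<mu>"
  then have s: "A \<in> sets \<sigma>" by (auto simp: null_sets_def sets_iff(2))
  have "measure \<mu> A = 0" using A by (simp add: null_sets_def measure_def)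
  then have "measure \<sigma> A \<le> 0"
    using estimate_borel[of "{()}" "\<lambda>_. A" "\<lambda>_. 1"] s by (simp add: disjoint_family_on_def)
  then have "measure \<sigma> A = 0" using measure_nonneg[of \<sigma> A] by linarith
  then show "A \<in> null_sets \<sigma>"
    using s by (simp add: null_sets_def finite_measure.emeasure_eq_measure[OF \<sigma>(1)])
qed

text \<open>For simple f increasing to the density h, the integral of f^2 d\<mu> is at most that of
  f h d\<mu>, which is that of f d\<sigma> and hence at most M times the norm of f. This norm is
  finite because f is simple, so it may be cancelled; monotone convergence concludes with the bound
  M^2.\<close>

lemma density_square_integrable: "(\<integral>\<^sup>+\<zeta>. (RN_deriv \<mu> \<sigma> \<zeta>)\<^sup>2 \<partial>\<mu>) < \<infinity>"
proof -
  interpret \<mu>: finite_measure \<mu> by (rule \<mu>)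
  interpret \<sigma>: finite_measure \<sigma> by (rule \<sigma>)
  define h where "h = RN_deriv \<mu> \<sigma>"
  have hm: "h \<in> borel_measurable \<mu>" unfolding h_def by (rule borel_measurable_RN_deriv)
  have dens: "density \<mu> h = \<sigma>" unfolding h_def
    by (rule \<mu>.density_RN_deriv[OF abs_continuous sets_iff(2)[symmetric]])
  obtain f where f: "\<And>i. simple_function \<mu> (f i)" "incseq f" "\<And>i x. f i x < top" "\<And>x. (SUP i. f i x) = h x"
    using borel_measurable_implies_simple_function_sequence'[OF hm] by metis
  have le: "f i x \<le> h x" for i x unfolding f(4)[symmetric] by (rule SUP_upper) simp
  have fm: "f i \<in> borel_measurable \<mu>" for i by (rule borel_measurable_simple_function[OF f(1)])
  have bound: "(\<integral>\<^sup>+x. (f i x)\<^sup>2 \<partial>\<mu>) \<le> ennreal (M\<^sup>2)" for i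
  proof -
    define v where "v x = enn2real (f i x)" for x
    have vf: "f i x = ennreal (v x)" for x using f(3)[of i x] by (simp add: v_def)
    have vs: "simple_function \<mu> v" unfolding v_def by (rule simple_function_compose1[OF f(1)])
    have v0: "0 \<le> v x" for x by (simp add: v_def)
    have vs': "simple_function \<sigma> v" using vs by (simp add: simple_function_def spaces sets_iff(2))
    have int: "integrable \<nu> u" if "simple_function \<nu> u" "finite_measure \<nu>" for u :: "complex ^ 'n \<Rightarrow> real" and \<nu>
    proof -
      have "finite (u ` space \<nu>)" using simple_functionD(1)[OF that(1)] .
      then obtain B where "\<And>y. y \<in> u ` space \<nu> \<Longrightarrow> norm y \<le> B"
        using finite_imp_bounded bounded_iff by metis
      then show ?thesis
        by (intro integrable_bounded_finite[OF that(2) borel_measurable_simple_function[OF that(1)], of B]) auto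
    qed
    have iv: "integrable \<sigma> v" by (rule int[OF vs' \<sigma>(1)])
    have iv2: "integrable \<mu> (\<lambda>x. (v x)\<^sup>2)" by (rule int[OF simple_function_compose1[OF vs] \<mu>(1)])
    define q where "q = (\<integral>x. (v x)\<^sup>2 \<partial>\<mu>)"
    have q0: "0 \<le> q" by (simp add: q_def)
    have sq: "(\<integral>\<^sup>+x. (f i x)\<^sup>2 \<partial>\<mu>) = ennreal q"
      unfolding vf q_def using v0 by (simp add: ennreal_power nn_integral_eq_integral[OF iv2])
    have "(\<integral>\<^sup>+x. (f i x)\<^sup>2 \<partial>\<mu>) \<le> (\<integral>\<^sup>+x. h x * f i x \<partial>\<mu>)"
      by (intro nn_integral_mono) (simp add: power2_eq_square le mult_right_mono)
    also have "\<dots> = (\<integral>\<^sup>+x. f i x \<partial>\<sigma>)"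
      using nn_integral_density[OF hm fm[of i]] by (simp add: dens)
    also have "\<dots> = ennreal (\<integral>x. v x \<partial>\<sigma>)"
      unfolding vf using v0 by (simp add: nn_integral_eq_integral[OF iv])
    also have "\<dots> \<le> ennreal (M * sqrt q)"
      unfolding q_def by (intro ennreal_leI estimate_simple vs' v0)
    finally have "q \<le> M * sqrt q" unfolding sq using M q0 by (simp add: ennreal_le_iff)
    then have "sqrt q * sqrt q \<le> M * sqrt q" using q0 by simp
    then have "sqrt q \<le> M"
      using q0 M mult_right_le_imp_le[of "sqrt q" "sqrt q" M] by (cases "q = 0") auto
    then have "q \<le> M\<^sup>2" using q0 M by (metis real_sqrt_le_iff real_sqrt_abs abs_of_nonneg)
    then show ?thesis unfolding sq by (rule ennreal_leI)
  qed
  have "(\<integral>\<^sup>+x. (h x)\<^sup>2 \<partial>\<mu>) = (\<integral>\<^sup>+x. (SUP i. (f i x)\<^sup>2) \<partial>\<mu>)"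
  proof (intro nn_integral_cong)
    fix x
    have inc: "incseq (\<lambda>i. f i x)" using f(2) by (auto simp: incseq_def le_fun_def)
    have "(\<lambda>i. f i x) \<longlonglongrightarrow> h x" using LIMSEQ_SUP[OF inc] f(4) by simp
    then have "(\<lambda>i. f i x * f i x) \<longlonglongrightarrow> h x * h x"
      by (intro tendsto_mult_ennreal) auto
    moreover have "incseq (\<lambda>i. f i x * f i x)" using inc by (auto simp: incseq_def intro!: mult_mono)
    ultimately show "(h x)\<^sup>2 = (SUP i. (f i x)\<^sup>2)"
      unfolding power2_eq_square using LIMSEQ_unique[OF LIMSEQ_SUP] by metis
  qed
  also have "\<dots> = (SUP i. \<integral>\<^sup>+x. (f i x)\<^sup>2 \<partial>\<mu>)"
  proof (rule nn_integral_monotone_convergence_SUP)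
    show "incseq (\<lambda>i x. (f i x)\<^sup>2)" using f(2) by (auto simp: incseq_def le_fun_def intro!: power_mono)
  qed (use fm in measurable)
  also have "\<dots> \<le> ennreal (M\<^sup>2)" by (intro SUP_least bound)
  finally show ?thesis unfolding h_def by (simp add: le_less_trans)
qed

end

section \<open>Hilbert function spaces from feature maps\<close>

text \<open>Definiteness is absent so that square integrable functions can be used as functions, not
  as classes modulo null sets. The same toolkit then serves both L^2 and reproducing kernel
  spaces.\<close>

locale semi_hilbert =
  fixes E :: "('b \<Rightarrow> complex) set" and ip :: "('b \<Rightarrow> complex) \<Rightarrow> ('b \<Rightarrow> complex) \<Rightarrow> complex"
  assumes zero_mem: "(\<lambda>z. 0) \<in> E"
    and add_mem: "f \<in> E \<Longrightarrow> g \<in> E \<Longrightarrow> (\<lambda>z. f z + g z) \<in> E"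
    and scale_mem: "f \<in> E \<Longrightarrow> (\<lambda>z. c * f z) \<in> E"
    and ip_add: "f \<in> E \<Longrightarrow> g \<in> E \<Longrightarrow> h \<in> E \<Longrightarrow> ip (\<lambda>z. f z + g z) h = ip f h + ip g h"
    and ip_scale: "f \<in> E \<Longrightarrow> h \<in> E \<Longrightarrow> ip (\<lambda>z. c * f z) h = c * ip f h"
    and ip_cnj: "f \<in> E \<Longrightarrow> g \<in> E \<Longrightarrow> ip g f = cnj (ip f g)"
    and ip_nonneg: "f \<in> E \<Longrightarrow> 0 \<le> Re (ip f f)"
    and complete: "(\<And>i. s i \<in> E) \<Longrightarrow>
          (\<And>\<epsilon>. \<epsilon> > 0 \<Longrightarrow> \<exists>N. \<forall>i\<ge>N. \<forall>j\<ge>N. ip_dist ip (s i) (s j) < \<epsilon>) \<Longrightarrow>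
          \<exists>f\<in>E. (\<lambda>i::nat. ip_dist ip (s i) f) \<longlonglongrightarrow> 0"
begin

section \<open>Geometry of a semi-inner product\<close>

lemma diff_mem: "f \<in> E \<Longrightarrow> g \<in> E \<Longrightarrow> (\<lambda>z. f z - g z) \<in> E"
  using add_mem[OF _ scale_mem[of g "-1"], of f] by simp

lemma ip_diff: "f \<in> E \<Longrightarrow> g \<in> E \<Longrightarrow> h \<in> E \<Longrightarrow> ip (\<lambda>z. f z - g z) h = ip f h - ip g h"
  using ip_add[OF _ scale_mem[of g "-1"], of f h] ip_scale[of g h "-1"] by simp

lemma ip_add_right: "f \<in> E \<Longrightarrow> g \<in> E \<Longrightarrow> h \<in> E \<Longrightarrow> ip h (\<lambda>z. f z + g z) = ip h f + ip h g"
  using ip_cnj[of "\<lambda>z. f z + g z" h] ip_cnj[of f h] ip_cnj[of g h] by (simp add: add_mem ip_add)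

lemma ip_scale_right: "f \<in> E \<Longrightarrow> h \<in> E \<Longrightarrow> ip h (\<lambda>z. c * f z) = cnj c * ip h f"
  using ip_cnj[of "\<lambda>z. c * f z" h] ip_cnj[of f h] by (simp add: scale_mem ip_scale)

lemma ip_diff_right: "f \<in> E \<Longrightarrow> g \<in> E \<Longrightarrow> h \<in> E \<Longrightarrow> ip h (\<lambda>z. f z - g z) = ip h f - ip h g"
  using ip_cnj[of "\<lambda>z. f z - g z" h] ip_cnj[of f h] ip_cnj[of g h] by (simp add: diff_mem ip_diff)

definition nrm2 :: "('b \<Rightarrow> complex) \<Rightarrow> real" where "nrm2 f = Re (ip f f)"

lemma nrm2_nonneg: "f \<in> E \<Longrightarrow> 0 \<le> nrm2 f"
  unfolding nrm2_def by (rule ip_nonneg)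

lemma ip_self: "f \<in> E \<Longrightarrow> ip f f = of_real (nrm2 f)"
  using ip_cnj[of f f] by (simp add: nrm2_def complex_eq_iff)

lemma ip_dist_nrm2: "ip_dist ip f g = sqrt (nrm2 (\<lambda>z. f z - g z))"
  by (simp add: ip_dist_def nrm2_def)

text \<open>Including \<open>ip f g\<close> in the coefficient aligns the phases, so the expansion
  is a real quadratic polynomial in \<open>s\<close>.\<close>

lemma nrm2_diff_scale:
  assumes f: "f \<in> E" and g: "g \<in> E"
  shows "nrm2 (\<lambda>z. f z - (of_real s * ip f g) * g z) = nrm2 f - 2 * s * (cmod (ip f g))\<^sup>2 + s\<^sup>2 * (cmod (ip f g))\<^sup>2 * nrm2 g"
proof -
  define t where "t = of_real s * ip f g"
  have tg: "(\<lambda>z. t * g z) \<in> E" by (rule scale_mem[OF g])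
  have c: "ip f g * cnj (ip f g) = of_real ((cmod (ip f g))\<^sup>2)" by (rule complex_norm_square[symmetric])
  have "ip (\<lambda>z. f z - t * g z) (\<lambda>z. f z - t * g z) = ip f f - cnj t * ip f g - t * cnj (ip f g) + t * cnj t * ip g g"
    using f g tg by (simp add: ip_diff ip_diff_right ip_scale ip_scale_right diff_mem ip_cnj[OF f g] algebra_simps)
  also have "\<dots> = of_real (nrm2 f) - 2 * of_real s * (ip f g * cnj (ip f g)) + of_real (s\<^sup>2) * (ip f g * cnj (ip f g)) * of_real (nrm2 g)"
    unfolding t_def by (simp add: ip_self f g power2_eq_square algebra_simps)
  finally show ?thesis unfolding c nrm2_def[of "\<lambda>z. _ z - _ z"] t_def[symmetric]
    by (simp add: t_def del: of_real_power flip: of_real_mult of_real_add of_real_diff)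
qed

text \<open>With \<open>d = 0\<close> this is the Cauchy--Schwarz inequality; with \<open>d\<close> the squared distance to a
  subspace it says that almost minimizers are almost orthogonal to the subspace.\<close>

lemma almost_orthogonal:
  assumes f: "f \<in> E" and g: "g \<in> E" and d: "\<And>t. d \<le> nrm2 (\<lambda>z. f z - t * g z)"
  shows "(cmod (ip f g))\<^sup>2 \<le> (nrm2 f - d) * nrm2 g"
proof -
  define p where "p = (cmod (ip f g))\<^sup>2"
  have q: "d \<le> nrm2 f - 2 * s * p + s\<^sup>2 * p * nrm2 g" for s
    using d[of "of_real s * ip f g"] unfolding nrm2_diff_scale[OF f g] p_def .
  show ?thesis
  proof (cases "nrm2 g = 0")
    case True
    have "p = 0"
    proof (rule ccontr)
      assume "p \<noteq> 0"
      then have p: "p > 0" by (simp add: p_def)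
      \<comment> \<open>With \<open>nrm2 g = 0\<close> the bound is linear in \<open>s\<close>; this
        value of \<open>s\<close> pushes the right side below \<open>d\<close>.\<close>
      have "d \<le> nrm2 f - 2 * ((nrm2 f - d + 1) / p) * p" using q[of "(nrm2 f - d + 1) / p"] True by simp
      then have "d \<le> nrm2 f - 2 * (nrm2 f - d + 1)" using p by simp
      moreover have "d \<le> nrm2 f" using q[of 0] by simp
      ultimately show False by simp
    qed
    then show ?thesis using True by (simp add: p_def)
  next
    case False
    then have g0: "nrm2 g > 0" using nrm2_nonneg[OF g] by simp
    \<comment> \<open>The minimizer of the quadratic, \<open>s = 1 / nrm2 g\<close>.\<close>
    have "d \<le> nrm2 f - 2 * (1 / nrm2 g) * p + (1 / nrm2 g)\<^sup>2 * p * nrm2 g" by (rule q)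
    also have "\<dots> = nrm2 f - p / nrm2 g" using g0 by (simp add: power2_eq_square)
    finally have "p / nrm2 g \<le> nrm2 f - d" by simp
    then show ?thesis using g0 by (simp add: p_def pos_divide_le_eq)
  qed
qed

lemma cauchy_schwarz: "f \<in> E \<Longrightarrow> g \<in> E \<Longrightarrow> (cmod (ip f g))\<^sup>2 \<le> nrm2 f * nrm2 g"
  using almost_orthogonal[of f g 0] by (simp add: nrm2_nonneg diff_mem scale_mem)

lemma cauchy_schwarz_sqrt: "f \<in> E \<Longrightarrow> g \<in> E \<Longrightarrow> cmod (ip f g) \<le> sqrt (nrm2 f) * sqrt (nrm2 g)"
  using real_le_rsqrt[OF cauchy_schwarz] by (simp add: real_sqrt_mult)

lemma ip_tendsto:
  assumes s: "\<And>i. s i \<in> E" "f \<in> E" "(\<lambda>i. ip_dist ip (s i) f) \<longlonglongrightarrow> 0" and g: "g \<in> E"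
  shows "(\<lambda>i. ip (s i) g) \<longlonglongrightarrow> ip f g"
proof (rule LIM_zero_cancel, rule tendsto_norm_zero_cancel, rule tendsto_sandwich[OF _ _ tendsto_const])
  show "\<forall>\<^sub>F i in sequentially. norm (ip (s i) g - ip f g) \<le> ip_dist ip (s i) f * sqrt (nrm2 g)"
    using cauchy_schwarz_sqrt[OF diff_mem[OF s(1,2)] g] by (simp add: ip_dist_nrm2 ip_diff s g)
  show "(\<lambda>i. ip_dist ip (s i) f * sqrt (nrm2 g)) \<longlonglongrightarrow> 0"
    using tendsto_mult[OF s(3) tendsto_const] by simp
qed simp

lemma parallelogram:
  assumes "f \<in> E" "g \<in> E"
  shows "nrm2 (\<lambda>z. f z - g z) + nrm2 (\<lambda>z. f z + g z) = 2 * nrm2 f + 2 * nrm2 g"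
  using assms unfolding nrm2_def
  by (simp add: ip_diff ip_diff_right ip_add ip_add_right diff_mem add_mem)

text \<open>The parallelogram law, with the midpoint of two approximants still in \<open>N\<close>,
  makes a minimizing sequence Cauchy. Orthogonality is obtained for the approximants up to a
  vanishing error and then passed to the limit. In a semi-inner product the projection need not be
  unique, so only existence is claimed.\<close>

lemma projection:
  fixes N
  assumes N: "N \<subseteq> E" "(\<lambda>z. 0) \<in> N" and add: "\<And>f g. f \<in> N \<Longrightarrow> g \<in> N \<Longrightarrow> (\<lambda>z. f z + g z) \<in> N"
    and scale: "\<And>c f. f \<in> N \<Longrightarrow> (\<lambda>z. c * f z) \<in> N"
    and closed: "\<And>s p. (\<And>i. s i \<in> N) \<Longrightarrow> p \<in> E \<Longrightarrow> (\<lambda>i. ip_dist ip (s i) p) \<longlonglongrightarrow> 0 \<Longrightarrow> p \<in> N"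
    and f: "f \<in> E"
  obtains p where "p \<in> N" "\<And>n. n \<in> N \<Longrightarrow> ip (\<lambda>z. f z - p z) n = 0"
proof -
  define D where "D = (\<lambda>n. nrm2 (\<lambda>z. f z - n z)) ` N"
  define d where "d = Inf D"
  have bdd: "bdd_below D" using N f by (intro bdd_belowI[of _ 0]) (auto simp: D_def intro!: nrm2_nonneg diff_mem)
  have ne: "D \<noteq> {}" using N by (auto simp: D_def)
  have dle: "d \<le> nrm2 (\<lambda>z. f z - n z)" if "n \<in> N" for n
    unfolding d_def using that by (intro cInf_lower bdd) (auto simp: D_def)
  have "\<exists>n\<in>N. nrm2 (\<lambda>z. f z - n z) < d + e" if "e > 0" for e
    using cInf_lessD[OF ne, of "d + e"] that by (auto simp: D_def d_def)
  then have "\<forall>i. \<exists>n. n \<in> N \<and> nrm2 (\<lambda>z. f z - n z) < d + inverse (real (Suc i))" by (auto simp: Bex_def)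
  then obtain s where s: "\<And>i. s i \<in> N" "\<And>i. nrm2 (\<lambda>z. f z - s i z) < d + inverse (real (Suc i))" by metis
  have sE: "s i \<in> E" for i using s(1) N(1) by auto
  have ij: "nrm2 (\<lambda>z. s i z - s j z) \<le> 2 * inverse (real (Suc i)) + 2 * inverse (real (Suc j))" for i j
  proof -
    have "nrm2 (\<lambda>z. (f z - s j z) - (f z - s i z)) + nrm2 (\<lambda>z. (f z - s j z) + (f z - s i z)) = 2 * nrm2 (\<lambda>z. f z - s j z) + 2 * nrm2 (\<lambda>z. f z - s i z)"
      by (rule parallelogram) (intro diff_mem f sE)+
    moreover have "nrm2 (\<lambda>z. (f z - s j z) + (f z - s i z)) = 4 * nrm2 (\<lambda>z. f z - (1/2) * (s i z + s j z))"
    proof -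
      have m: "(\<lambda>z. f z - (1/2) * (s i z + s j z)) \<in> E" by (intro diff_mem f scale_mem add_mem sE)
      have "(\<lambda>z. (f z - s j z) + (f z - s i z)) = (\<lambda>z. 2 * (f z - (1/2) * (s i z + s j z)))" by (simp add: algebra_simps)
      then show ?thesis unfolding nrm2_def by (simp only: ip_scale[OF m scale_mem[OF m]] ip_scale_right[OF m m]) simp
    qed
    moreover have "d \<le> nrm2 (\<lambda>z. f z - (1/2) * (s i z + s j z))" by (intro dle scale add s)
    ultimately show ?thesis using s(2)[of i] s(2)[of j] by simp
  qed
  have "\<exists>p\<in>E. (\<lambda>i. ip_dist ip (s i) p) \<longlonglongrightarrow> 0"
  proof (rule complete[OF sE])
    fix \<epsilon> :: real assume e: "\<epsilon> > 0"
    then obtain N where N: "inverse (real (Suc N)) < \<epsilon>\<^sup>2 / 4" using reals_Archimedean[of "\<epsilon>\<^sup>2 / 4"] by auto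
    have "ip_dist ip (s i) (s j) < \<epsilon>" if "i \<ge> N" "j \<ge> N" for i j
    proof -
      have "inverse (real (Suc i)) \<le> inverse (real (Suc N))" "inverse (real (Suc j)) \<le> inverse (real (Suc N))"
        using that by (auto intro!: le_imp_inverse_le)
      then have "nrm2 (\<lambda>z. s i z - s j z) < \<epsilon>\<^sup>2" using ij[of i j] N by linarith
      then show ?thesis unfolding ip_dist_nrm2 using e by (intro real_less_lsqrt nrm2_nonneg diff_mem sE) auto
    qed
    then show "\<exists>N. \<forall>i\<ge>N. \<forall>j\<ge>N. ip_dist ip (s i) (s j) < \<epsilon>" by blast
  qed
  then obtain p where p: "p \<in> E" "(\<lambda>i. ip_dist ip (s i) p) \<longlonglongrightarrow> 0" by blast
  show ?thesis
  proof (rule that)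
    show "p \<in> N" by (rule closed[OF s(1) p])
    fix n assume n: "n \<in> N"
    then have nE: "n \<in> E" using N by auto
    have b: "(cmod (ip f n - ip (s i) n))\<^sup>2 \<le> inverse (real (Suc i)) * nrm2 n" for i
    proof -
      have "d \<le> nrm2 (\<lambda>z. (f z - s i z) - t * n z)" for t
        using dle[OF add[OF s(1)[of i] scale[OF n, of t]]] by (simp add: diff_diff_eq)
      then have "(cmod (ip (\<lambda>z. f z - s i z) n))\<^sup>2 \<le> (nrm2 (\<lambda>z. f z - s i z) - d) * nrm2 n"
        by (rule almost_orthogonal[OF diff_mem[OF f sE] nE])
      also have "\<dots> \<le> inverse (real (Suc i)) * nrm2 n"
        using s(2)[of i] by (intro mult_right_mono nrm2_nonneg nE) linarith
      finally show ?thesis by (simp only: ip_diff[OF f sE nE])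
    qed
    have "(\<lambda>i. (cmod (ip f n - ip (s i) n))\<^sup>2) \<longlonglongrightarrow> (cmod (ip f n - ip p n))\<^sup>2"
      by (intro tendsto_intros ip_tendsto sE p nE)
    moreover have "(\<lambda>i. inverse (real (Suc i)) * nrm2 n) \<longlonglongrightarrow> 0 * nrm2 n"
      by (intro tendsto_intros LIMSEQ_inverse_real_of_nat)
    ultimately have "(cmod (ip f n - ip p n))\<^sup>2 \<le> 0 * nrm2 n" by (rule LIMSEQ_le) (use b in blast)
    then show "ip (\<lambda>z. f z - p z) n = 0" by (simp add: ip_diff f p nE)
  qed
qed

text \<open>The inner product of two functions is that of their representatives orthogonal to all
  representatives of 0.\<close>

theorem rkhs_of_feature_map:
  assumes e: "\<And>z. z \<in> X \<Longrightarrow> e z \<in> E"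
    and k: "\<And>z w. z \<in> X \<Longrightarrow> w \<in> X \<Longrightarrow> k z w = ip (e w) (e z)"
  shows "\<exists>ipH. reproducing_kernel_hilbert_space X k ((\<lambda>f. cut_off X (\<lambda>z. ip f (e z))) ` E) ipH"
proof -
  define ev where "ev f = cut_off X (\<lambda>z. ip f (e z))" for f
  define N where "N = {f \<in> E. \<forall>z\<in>X. ip f (e z) = 0}"
  \<comment> \<open>Orthogonality to \<open>N\<close> determines a representative up to a vector of
    seminorm 0. Each \<open>e z\<close> lies in \<open>M\<close>, so the inner product of
    representatives reproduces values.\<close>
  define M where "M = {f \<in> E. \<forall>n\<in>N. ip f n = 0}"
  have NE: "n \<in> E" if "n \<in> N" for n using that by (simp add: N_def)
  have ME: "f \<in> E" if "f \<in> M" for f using that by (simp add: M_def)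
  have ev_add: "ev (\<lambda>z. f z + g z) = (\<lambda>z. ev f z + ev g z)" if "f \<in> E" "g \<in> E" for f g
    using that e by (auto simp: ev_def cut_off_def ip_add)
  have ev_scale: "ev (\<lambda>z. c * f z) = (\<lambda>z. c * ev f z)" if "f \<in> E" for f c
    using that e by (auto simp: ev_def cut_off_def ip_scale)
  have ev_diff: "ev (\<lambda>z. f z - g z) = (\<lambda>z. ev f z - ev g z)" if "f \<in> E" "g \<in> E" for f g
    using that e by (auto simp: ev_def cut_off_def ip_diff)
  have ip0: "ip (\<lambda>z. 0) g = 0" if "g \<in> E" for g using ip_scale[OF zero_mem that, of 0] by simp
  have M_add: "(\<lambda>z. f z + g z) \<in> M" if "f \<in> M" "g \<in> M" for f g
    using that by (auto simp: M_def add_mem ip_add NE)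
  have M_scale: "(\<lambda>z. c * f z) \<in> M" if "f \<in> M" for f c
    using that by (auto simp: M_def scale_mem ip_scale NE)
  have M_diff: "(\<lambda>z. f z - g z) \<in> M" if "f \<in> M" "g \<in> M" for f g
    using that by (auto simp: M_def diff_mem ip_diff NE)
  have M_zero: "(\<lambda>z. 0) \<in> M" by (simp add: M_def zero_mem ip0 NE)
  have eM: "e z \<in> M" if "z \<in> X" for z
    using that e ip_cnj[OF NE e] by (auto simp: M_def N_def)
  have surj: "\<exists>f. f \<in> M \<and> ev f = F" if F: "F \<in> ev ` E" for F
  proof -
    obtain f where f: "f \<in> E" "F = ev f" using F by auto
    obtain p where p: "p \<in> N" "\<And>n. n \<in> N \<Longrightarrow> ip (\<lambda>z. f z - p z) n = 0"
    proof (rule projection[of N f])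
      show "N \<subseteq> E" by (auto simp: N_def)
      show "(\<lambda>z. 0) \<in> N" using e by (simp add: N_def zero_mem ip0)
      show "(\<lambda>z. f z + g z) \<in> N" if "f \<in> N" "g \<in> N" for f g
        using that e by (simp add: N_def add_mem ip_add)
      show "(\<lambda>z. c * f z) \<in> N" if "f \<in> N" for c f
        using that e by (simp add: N_def scale_mem ip_scale)
      show "p \<in> N" if s: "\<And>i. s i \<in> N" "p \<in> E" "(\<lambda>i. ip_dist ip (s i) p) \<longlonglongrightarrow> 0" for s p
      proof -
        have "ip p (e z) = 0" if z: "z \<in> X" for z
        proof -
          have "(\<lambda>i. ip (s i) (e z)) \<longlonglongrightarrow> ip p (e z)"
            by (rule ip_tendsto[OF NE[OF s(1)] s(2,3) e[OF z]])
          moreover have "ip (s i) (e z) = 0" for i using s(1)[of i] z by (simp add: N_def)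
          ultimately show ?thesis by (simp add: LIMSEQ_const_iff)
        qed
        then show ?thesis using s(2) by (simp add: N_def)
      qed
    qed (use f in auto)
    have "(\<lambda>z. f z - p z) \<in> M" using p(2) diff_mem[OF f(1) NE[OF p(1)]] by (simp add: M_def)
    moreover have "ev (\<lambda>z. f z - p z) = F"
      using p(1) f NE[OF p(1)] by (auto simp: ev_def cut_off_def ip_diff e N_def)
    ultimately show ?thesis by blast
  qed
  define rep where "rep F = (SOME f. f \<in> M \<and> ev f = F)" for F
  have rep: "rep F \<in> M" "ev (rep F) = F" if "F \<in> ev ` E" for F
    using someI_ex[OF surj[OF that]] unfolding rep_def by auto
  define ipH where "ipH F G = ip (rep F) (rep G)" for F G
  \<comment> \<open>Two such representatives differ by an element of both \<open>M\<close> and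
    \<open>N\<close>, which is orthogonal to itself; Cauchy--Schwarz then makes it invisible to the
    inner product. Hence the choice made by \<open>rep\<close> is immaterial.\<close>
  have null: "ip f g = ip f' g" if f: "f \<in> M" "f' \<in> M" "ev f = ev f'" and g: "g \<in> E" for f f' g
  proof -
    have d: "(\<lambda>z. f z - f' z) \<in> M" by (rule M_diff[OF f(1,2)])
    have "ip (\<lambda>z. f z - f' z) (e z) = 0" if "z \<in> X" for z
      using fun_cong[OF f(3), of z] that by (simp add: ev_def cut_off_def ip_diff ME f e)
    then have "(\<lambda>z. f z - f' z) \<in> N" using ME[OF d] by (simp add: N_def)
    then have "ip (\<lambda>z. f z - f' z) (\<lambda>z. f z - f' z) = 0" using d by (simp add: M_def)
    then have "ip (\<lambda>z. f z - f' z) g = 0"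
      using cauchy_schwarz[OF ME[OF d] g] by (simp add: nrm2_def)
    then show ?thesis by (simp add: ip_diff ME f g)
  qed
  have key: "ipH (ev f) (ev g) = ip f g" if f: "f \<in> M" and g: "g \<in> M" for f g
  proof -
    have r: "rep (ev f) \<in> M" "ev (rep (ev f)) = ev f" "rep (ev g) \<in> M" "ev (rep (ev g)) = ev g"
      using rep[of "ev f"] rep[of "ev g"] ME f g by auto
    have "ip (rep (ev f)) (rep (ev g)) = ip f (rep (ev g))" by (rule null[OF r(1) f r(2) ME[OF r(3)]])
    also have "\<dots> = cnj (ip (rep (ev g)) f)" by (rule ip_cnj[OF ME[OF r(3)] ME[OF f]])
    also have "\<dots> = cnj (ip g f)" by (simp only: null[OF r(3) g r(4) ME[OF f]])
    also have "\<dots> = ip f g" by (rule ip_cnj[OF ME[OF g] ME[OF f], symmetric])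
    finally show ?thesis by (simp add: ipH_def)
  qed
  have kernel: "cut_off X (\<lambda>z. k z w) = ev (e w)" if "w \<in> X" for w
    using that k by (auto simp: ev_def cut_off_def)
  have img: "ev f \<in> ev ` E" if "f \<in> M" for f using ME[OF that] by auto
  have "reproducing_kernel_hilbert_space X k (ev ` E) ipH"
  proof
    show "f z = 0" if "f \<in> ev ` E" "z \<notin> X" for f z using that by (auto simp: ev_def cut_off_def)
    have "ev (\<lambda>z. 0) = (\<lambda>z. 0)" using e by (auto simp: ev_def cut_off_def ip0)
    then show "(\<lambda>z. 0) \<in> ev ` E" using zero_mem by (metis imageI)
    show "(\<lambda>z. f z + g z) \<in> ev ` E" if fg: "f \<in> ev ` E" "g \<in> ev ` E" for f g
      using fg ev_add add_mem by (auto simp: image_iff) metis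
    show "(\<lambda>z. c * f z) \<in> ev ` E" if "f \<in> ev ` E" for c f
      using that ev_scale scale_mem by (auto simp: image_iff) metis
    show "ipH (\<lambda>z. f z + g z) h = ipH f h + ipH g h" if fgh: "f \<in> ev ` E" "g \<in> ev ` E" "h \<in> ev ` E" for f g h
    proof -
      obtain f' g' h' where m: "f' \<in> M" "g' \<in> M" "h' \<in> M" and eq: "f = ev f'" "g = ev g'" "h = ev h'"
        using surj[OF fgh(1)] surj[OF fgh(2)] surj[OF fgh(3)] by auto
      show ?thesis unfolding eq ev_add[OF ME[OF m(1)] ME[OF m(2)], symmetric]
        by (simp add: key M_add m ip_add ME)
    qed
    show "ipH (\<lambda>z. c * f z) h = c * ipH f h" if fh: "f \<in> ev ` E" "h \<in> ev ` E" for c f h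
    proof -
      obtain f' h' where m: "f' \<in> M" "h' \<in> M" and eq: "f = ev f'" "h = ev h'"
        using surj[OF fh(1)] surj[OF fh(2)] by auto
      show ?thesis unfolding eq ev_scale[OF ME[OF m(1)], symmetric]
        by (simp add: key M_scale m ip_scale ME)
    qed
    show "ipH g f = cnj (ipH f g)" if "f \<in> ev ` E" "g \<in> ev ` E" for f g
      unfolding ipH_def using rep that by (intro ip_cnj ME) auto
    show "0 \<le> Re (ipH f f)" if "f \<in> ev ` E" for f
      unfolding ipH_def using rep that by (intro ip_nonneg ME) auto
    show "f = (\<lambda>z. 0)" if f: "f \<in> ev ` E" "ipH f f = 0" for f
    proof -
      have r: "rep f \<in> E" using rep f ME by auto
      have "ip (rep f) (e z) = 0" if "z \<in> X" for z
        using cauchy_schwarz[OF r e[OF that]] f(2) by (simp add: ipH_def nrm2_def)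
      then have "ev (rep f) = (\<lambda>z. 0)" by (auto simp: ev_def cut_off_def)
      then show ?thesis using rep(2)[OF f(1)] by simp
    qed
    show "cut_off X (\<lambda>z. k z w) \<in> ev ` E" if "w \<in> X" for w
      unfolding kernel[OF that] using e[OF that] by simp
    show "ipH f (cut_off X (\<lambda>z. k z w)) = f w" if f: "f \<in> ev ` E" and w: "w \<in> X" for f w
    proof -
      obtain f' where m: "f' \<in> M" "f = ev f'" using surj[OF f] by auto
      show ?thesis unfolding kernel[OF w] m(2) key[OF m(1) eM[OF w]] using w by (simp add: ev_def cut_off_def)
    qed
    show "\<exists>f\<in>ev ` E. (\<lambda>i. ip_dist ipH (s i) f) \<longlonglongrightarrow> 0"
      if s: "\<And>i. s i \<in> ev ` E" and cau: "\<And>\<epsilon>. \<epsilon> > 0 \<Longrightarrow> \<exists>N. \<forall>i\<ge>N. \<forall>j\<ge>N. ip_dist ipH (s i) (s j) < \<epsilon>" for s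
    proof -
      define t where "t i = rep (s i)" for i
      have t: "t i \<in> M" "s i = ev (t i)" for i using rep[OF s] by (auto simp: t_def)
      have dist: "ip_dist ipH (ev f) (ev g) = ip_dist ip f g" if "f \<in> M" "g \<in> M" for f g
        unfolding ip_dist_def ev_diff[OF ME[OF that(1)] ME[OF that(2)], symmetric]
        by (simp add: key M_diff that)
      have "\<exists>f\<in>E. (\<lambda>i. ip_dist ip (t i) f) \<longlonglongrightarrow> 0"
        by (rule complete[OF ME[OF t(1)]]) (use cau in \<open>simp add: t(2) dist[OF t(1) t(1)]\<close>)
      then obtain f where f: "f \<in> E" "(\<lambda>i. ip_dist ip (t i) f) \<longlonglongrightarrow> 0" by blast
      have "ip f n = 0" if n: "n \<in> N" for n
      proof -
        have "(\<lambda>i. ip (t i) n) \<longlonglongrightarrow> ip f n" by (rule ip_tendsto[OF ME[OF t(1)] f NE[OF n]])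
        moreover have "ip (t i) n = 0" for i using t(1)[of i] n by (simp add: M_def)
        ultimately show ?thesis by (simp add: LIMSEQ_const_iff)
      qed
      then have "f \<in> M" using f by (simp add: M_def)
      then show ?thesis using f(2) img by (intro bexI[of _ "ev f"]) (simp_all add: t(2) dist[OF t(1)])
    qed
  qed
  then show ?thesis unfolding ev_def[abs_def] by blast
qed

end

section \<open>Square integrable functions\<close>

definition l2 :: "'a measure \<Rightarrow> ('a \<Rightarrow> complex) set" where
  "l2 M = {f \<in> borel_measurable M. integrable M (\<lambda>x. (cmod (f x))\<^sup>2)}"

definition l2_ip :: "'a measure \<Rightarrow> ('a \<Rightarrow> complex) \<Rightarrow> ('a \<Rightarrow> complex) \<Rightarrow> complex" where
  "l2_ip M f g = (\<integral>x. f x * cnj (g x) \<partial>M)"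

lemma l2_add: 
  assumes f: "f \<in> l2 M" and g: "g \<in> l2 M" shows "(\<lambda>x. f x + g x) \<in> l2 M"
proof -
  have [measurable]: "f \<in> borel_measurable M" "g \<in> borel_measurable M" using f g by (auto simp: l2_def)
  have "integrable M (\<lambda>x. (cmod (f x + g x))\<^sup>2)"
  proof (rule Bochner_Integration.integrable_bound)
    show "integrable M (\<lambda>x. 2 * (cmod (f x))\<^sup>2 + 2 * (cmod (g x))\<^sup>2)" using f g by (simp add: l2_def)
    show "AE x in M. norm ((cmod (f x + g x))\<^sup>2) \<le> norm (2 * (cmod (f x))\<^sup>2 + 2 * (cmod (g x))\<^sup>2)"
    proof (intro AE_I2)
      fix x
      have "(cmod (f x + g x))\<^sup>2 \<le> (cmod (f x) + cmod (g x))\<^sup>2" by (intro power_mono norm_triangle_ineq) simp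
      also have "\<dots> \<le> 2 * (cmod (f x))\<^sup>2 + 2 * (cmod (g x))\<^sup>2"
        using zero_le_power2[of "cmod (f x) - cmod (g x)"] by (simp add: power2_eq_square algebra_simps)
      finally show "norm ((cmod (f x + g x))\<^sup>2) \<le> norm (2 * (cmod (f x))\<^sup>2 + 2 * (cmod (g x))\<^sup>2)" by simp
    qed
  qed measurable
  then show ?thesis by (simp add: l2_def)
qed

lemma l2_scale: "f \<in> l2 M \<Longrightarrow> (\<lambda>x. c * f x) \<in> l2 M"
  by (auto simp: l2_def norm_mult power_mult_distrib)

lemma l2_diff: "f \<in> l2 M \<Longrightarrow> g \<in> l2 M \<Longrightarrow> (\<lambda>x. f x - g x) \<in> l2 M"
  using l2_add[OF _ l2_scale[of g M "-1"], of f] by simp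

lemma l2_ip_integrable:
  assumes f: "f \<in> l2 M" and g: "g \<in> l2 M" shows "integrable M (\<lambda>x. f x * cnj (g x))"
proof (rule Bochner_Integration.integrable_bound)
  have [measurable]: "f \<in> borel_measurable M" "g \<in> borel_measurable M" using f g by (auto simp: l2_def)
  show "(\<lambda>x. f x * cnj (g x)) \<in> borel_measurable M" by measurable
  show "integrable M (\<lambda>x. (cmod (f x))\<^sup>2 + (cmod (g x))\<^sup>2)" using f g by (simp add: l2_def)
  show "AE x in M. norm (f x * cnj (g x)) \<le> norm ((cmod (f x))\<^sup>2 + (cmod (g x))\<^sup>2)"
  proof (intro AE_I2)
    fix x
    have "2 * (cmod (f x) * cmod (g x)) \<le> (cmod (f x))\<^sup>2 + (cmod (g x))\<^sup>2"
      using zero_le_power2[of "cmod (f x) - cmod (g x)"] by (simp add: power2_eq_square algebra_simps)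
    moreover have "0 \<le> cmod (f x) * cmod (g x)" by simp
    ultimately have "cmod (f x) * cmod (g x) \<le> (cmod (f x))\<^sup>2 + (cmod (g x))\<^sup>2" by linarith
    then show "norm (f x * cnj (g x)) \<le> norm ((cmod (f x))\<^sup>2 + (cmod (g x))\<^sup>2)"
      by (simp add: norm_mult)
  qed
qed

lemma l2_ip_self: "l2_ip M f f = complex_of_real (\<integral>x. (cmod (f x))\<^sup>2 \<partial>M)"
  unfolding l2_ip_def complex_norm_square[symmetric] by (rule integral_complex_of_real)

lemma l2_dist: "ip_dist (l2_ip M) f g = sqrt (\<integral>x. (cmod (f x - g x))\<^sup>2 \<partial>M)"
  by (simp add: ip_dist_def l2_ip_self)

text \<open>The Riesz--Fischer argument: a rapidly converging subsequence converges almost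
  everywhere, and Fatou's lemma transfers the Cauchy estimate to the limit.\<close>

lemma l2_complete:
  assumes s: "\<And>i. s i \<in> l2 M"
    and cau: "\<And>\<epsilon>. \<epsilon> > 0 \<Longrightarrow> \<exists>N. \<forall>i\<ge>N. \<forall>j\<ge>N. ip_dist (l2_ip M) (s i) (s j) < \<epsilon>"
  shows "\<exists>f\<in>l2 M. (\<lambda>i::nat. ip_dist (l2_ip M) (s i) f) \<longlonglongrightarrow> 0"
proof -
  have sm [measurable]: "s i \<in> borel_measurable M" for i using s[of i] by (simp add: l2_def)
  have dI: "integrable M (\<lambda>x. (cmod (s i x - s j x))\<^sup>2)" for i j
    using l2_diff[OF s s, of i j] by (simp add: l2_def)
  have nn: "(\<integral>\<^sup>+x. ennreal ((cmod (s i x - s j x))\<^sup>2) \<partial>M) = ennreal (\<integral>x. (cmod (s i x - s j x))\<^sup>2 \<partial>M)" for i j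
    by (rule nn_integral_eq_integral[OF dI]) simp
  have sq: "\<exists>N. \<forall>i\<ge>N. \<forall>j\<ge>N. (\<integral>x. (cmod (s i x - s j x))\<^sup>2 \<partial>M) < \<epsilon>" if "\<epsilon> > 0" for \<epsilon>
    using cau[of "sqrt \<epsilon>"] that by (simp add: l2_dist)
  have "\<forall>k. \<exists>N. \<forall>i\<ge>N. \<forall>j\<ge>N. (\<integral>x. (cmod (s i x - s j x))\<^sup>2 \<partial>M) < (1/4) ^ k"
    using sq by simp
  then obtain N where N: "\<And>k i j. i \<ge> N k \<Longrightarrow> j \<ge> N k \<Longrightarrow> (\<integral>x. (cmod (s i x - s j x))\<^sup>2 \<partial>M) < (1/4) ^ k"
    by metis
  \<comment> \<open>The maximum ensures that \<open>r k\<close> and \<open>r (Suc k)\<close> both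
    exceed \<open>N k\<close>, so consecutive terms are within 4^(-k) in squared distance; the
    summand \<open>k\<close> makes the indices tend to infinity.\<close>
  define r where "r k = Max (N ` {..k}) + k" for k
  have rN: "N k \<le> r k" for k unfolding r_def by (rule trans_le_add1) (auto intro!: Max_ge)
  have rS: "N k \<le> r (Suc k)" for k unfolding r_def by (rule trans_le_add1) (auto intro!: Max_ge)
  have rk: "k \<le> r k" for k by (simp add: r_def)
  have r_lim: "filterlim r at_top sequentially"
    by (rule filterlim_at_top_mono[OF filterlim_ident]) (simp add: rk)
  \<comment> \<open>The weight 2^k against the rate 4^(-k) leaves the summable 2^(-k).\<close>
  define u where "u k x = 2 ^ k * (cmod (s (r (Suc k)) x - s (r k) x))\<^sup>2" for k x
  have um [measurable]: "u k \<in> borel_measurable M" for k unfolding u_def by measurable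
  have "(\<integral>\<^sup>+x. (\<Sum>k. ennreal (u k x)) \<partial>M) = (\<Sum>k. \<integral>\<^sup>+x. ennreal (u k x) \<partial>M)"
    by (rule nn_integral_suminf) simp
  also have "\<dots> \<le> (\<Sum>k. ennreal ((1/2) ^ k))"
  proof (intro suminf_le summableI)
    fix k
    have "(\<integral>\<^sup>+x. ennreal (u k x) \<partial>M) = ennreal (2 ^ k * (\<integral>x. (cmod (s (r (Suc k)) x - s (r k) x))\<^sup>2 \<partial>M))"
      unfolding u_def using nn_integral_eq_integral[OF integrable_mult_right[OF dI[of "r (Suc k)" "r k"], of "2 ^ k"]] by simp
    also have "\<dots> \<le> ennreal (2 ^ k * (1/4) ^ k)"
      using N[OF rS rN, of k] by (intro ennreal_leI mult_left_mono) auto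
    also have "(2::real) ^ k * (1/4) ^ k = (1/2) ^ k" by (simp add: power_mult_distrib[symmetric])
    finally show "(\<integral>\<^sup>+x. ennreal (u k x) \<partial>M) \<le> ennreal ((1/2) ^ k)" .
  qed
  also have "\<dots> = ennreal (\<Sum>k. (1/2) ^ k)" by (rule suminf_ennreal2) (auto intro: summable_geometric)
  finally have "(\<integral>\<^sup>+x. (\<Sum>k. ennreal (u k x)) \<partial>M) \<noteq> \<infinity>" by (auto simp: top_unique)
  then have AEfin: "AE x in M. (\<Sum>k. ennreal (u k x)) \<noteq> \<infinity>"
    by (intro nn_integral_noteq_infinite) simp_all
  define f where "f x = lim (\<lambda>k. s (r k) x)" for x
  have fm [measurable]: "f \<in> borel_measurable M"
    unfolding f_def[abs_def] by (rule borel_measurable_lim_metric) simp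
  have conv: "AE x in M. (\<lambda>k. s (r k) x) \<longlonglongrightarrow> f x"
    using AEfin
  proof eventually_elim
    case (elim x)
    have su: "summable (\<lambda>k. u k x)"
      by (rule summable_suminf_not_top) (use elim in \<open>auto simp: u_def\<close>)
    have "summable (\<lambda>k. (1/2) ^ k + u k x)" by (intro summable_add su summable_geometric) simp
    then have "summable (\<lambda>k. s (r (Suc k)) x - s (r k) x)"
    proof (rule summable_comparison_test')
      fix k
      define d where "d = cmod (s (r (Suc k)) x - s (r k) x)"
      \<comment> \<open>Passes from weighted squares to absolute values: if d exceeds 2^(-k), then
        2^k d > 1.\<close>
      have "d \<le> (1/2) ^ k + 2 ^ k * d\<^sup>2"
      proof (cases "d \<le> (1/2) ^ k")
        case True then show ?thesis by (simp add: add_increasing2)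
      next
        case False
        have "1 = 2 ^ k * (1/2 :: real) ^ k" by (simp add: power_mult_distrib[symmetric])
        also have "\<dots> \<le> 2 ^ k * d" using False by (intro mult_left_mono) auto
        finally have "1 * d \<le> 2 ^ k * d * d" using False by (intro mult_right_mono) (auto simp: d_def)
        then show ?thesis by (simp add: power2_eq_square mult.assoc add_increasing)
      qed
      then show "norm (s (r (Suc k)) x - s (r k) x) \<le> (1/2) ^ k + u k x" by (simp add: u_def d_def)
    qed
    then have "convergent (\<lambda>n. \<Sum>k<n. s (r (Suc k)) x - s (r k) x)"
      by (simp add: summable_iff_convergent)
    then have "convergent (\<lambda>n. s (r n) x - s (r 0) x)" by (simp add: sum_lessThan_telescope[of "\<lambda>k. s (r k) x"])
    then have "convergent (\<lambda>n. (s (r n) x - s (r 0) x) + s (r 0) x)" by (intro convergent_add convergent_const)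
    then show ?case unfolding f_def by (simp add: convergent_LIMSEQ_iff)
  qed
  have fatou: "(\<integral>\<^sup>+x. ennreal ((cmod (s i x - f x))\<^sup>2) \<partial>M) \<le> ennreal \<epsilon>"
    if i: "\<And>j. j \<ge> n \<Longrightarrow> (\<integral>x. (cmod (s i x - s j x))\<^sup>2 \<partial>M) \<le> \<epsilon>" for i n \<epsilon>
  proof -
    have "(\<integral>\<^sup>+x. ennreal ((cmod (s i x - f x))\<^sup>2) \<partial>M) = (\<integral>\<^sup>+x. liminf (\<lambda>k. ennreal ((cmod (s i x - s (r k) x))\<^sup>2)) \<partial>M)"
    proof (rule nn_integral_cong_AE)
      show "AE x in M. ennreal ((cmod (s i x - f x))\<^sup>2) = liminf (\<lambda>k. ennreal ((cmod (s i x - s (r k) x))\<^sup>2))"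
        using conv
      proof eventually_elim
        case (elim x)
        have "(\<lambda>k. ennreal ((cmod (s i x - s (r k) x))\<^sup>2)) \<longlonglongrightarrow> ennreal ((cmod (s i x - f x))\<^sup>2)"
          by (intro tendsto_ennrealI tendsto_intros elim)
        from lim_imp_Liminf[OF sequentially_bot this] show ?case by simp
      qed
    qed
    also have "\<dots> \<le> liminf (\<lambda>k. \<integral>\<^sup>+x. ennreal ((cmod (s i x - s (r k) x))\<^sup>2) \<partial>M)"
      by (rule nn_integral_liminf) simp
    also have "\<dots> \<le> ennreal \<epsilon>"
    proof (rule Liminf_le)
      show "\<forall>\<^sub>F k in sequentially. (\<integral>\<^sup>+x. ennreal ((cmod (s i x - s (r k) x))\<^sup>2) \<partial>M) \<le> ennreal \<epsilon>"
        using eventually_ge_at_top[of n]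
      proof eventually_elim
        case (elim k)
        then have "n \<le> r k" using rk[of k] by simp
        then show ?case unfolding nn by (intro ennreal_leI i)
      qed
    qed simp
    finally show ?thesis .
  qed
  have close: "integrable M (\<lambda>x. (cmod (s i x - f x))\<^sup>2) \<and> (\<integral>x. (cmod (s i x - f x))\<^sup>2 \<partial>M) \<le> \<epsilon>"
    if "\<And>j. j \<ge> n \<Longrightarrow> (\<integral>x. (cmod (s i x - s j x))\<^sup>2 \<partial>M) \<le> \<epsilon>" "0 \<le> \<epsilon>" for i n \<epsilon>
  proof -
    note fa = fatou[of n i \<epsilon>, OF that(1)]
    have int: "integrable M (\<lambda>x. (cmod (s i x - f x))\<^sup>2)"
      by (rule integrableI_nonneg) (use fa in \<open>auto simp: le_less_trans\<close>)
    have "ennreal (\<integral>x. (cmod (s i x - f x))\<^sup>2 \<partial>M) \<le> ennreal \<epsilon>"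
      using fa nn_integral_eq_integral[OF int] by simp
    then show ?thesis using int that(2) by (simp add: ennreal_le_iff)
  qed
  have "f \<in> l2 M"
  proof -
    obtain n where n: "\<And>i j. i \<ge> n \<Longrightarrow> j \<ge> n \<Longrightarrow> (\<integral>x. (cmod (s i x - s j x))\<^sup>2 \<partial>M) < 1" using sq[of 1] by auto
    have "integrable M (\<lambda>x. (cmod (s n x - f x))\<^sup>2)"
      using close[of n n 1] n by (auto intro: less_imp_le)
    then have "(\<lambda>x. s n x - f x) \<in> l2 M" by (simp add: l2_def)
    from l2_diff[OF s[of n] this] show ?thesis by simp
  qed
  moreover have "(\<lambda>i. ip_dist (l2_ip M) (s i) f) \<longlonglongrightarrow> 0"
    unfolding LIMSEQ_iff
  proof (intro allI impI)
    fix e :: real assume e: "e > 0"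
    then obtain n where n: "\<And>i j. i \<ge> n \<Longrightarrow> j \<ge> n \<Longrightarrow> (\<integral>x. (cmod (s i x - s j x))\<^sup>2 \<partial>M) < (e/2)\<^sup>2"
      using sq[of "(e/2)\<^sup>2"] by auto
    have "norm (ip_dist (l2_ip M) (s i) f - 0) < e" if "i \<ge> n" for i
    proof -
      have "(\<integral>x. (cmod (s i x - f x))\<^sup>2 \<partial>M) \<le> (e/2)\<^sup>2"
        using close[of n i "(e/2)\<^sup>2"] n[OF that] by (auto intro: less_imp_le)
      then have "sqrt (\<integral>x. (cmod (s i x - f x))\<^sup>2 \<partial>M) \<le> e / 2" using e by (intro real_le_lsqrt) auto
      then show ?thesis using e by (simp add: l2_dist)
    qed
    then show "\<exists>no. \<forall>n\<ge>no. norm (ip_dist (l2_ip M) (s n) f - 0) < e" by blast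
  qed
  ultimately show ?thesis by blast
qed

lemma semi_hilbert_l2: "semi_hilbert (l2 M) (l2_ip M)"
proof
  show "(\<lambda>z. 0) \<in> l2 M" by (simp add: l2_def)
  show "l2_ip M (\<lambda>z. f z + g z) h = l2_ip M f h + l2_ip M g h" if "f \<in> l2 M" "g \<in> l2 M" "h \<in> l2 M" for f g h
    using that by (simp add: l2_ip_def distrib_right l2_ip_integrable)
  show "l2_ip M (\<lambda>z. c * f z) h = c * l2_ip M f h" for f h c
    by (simp add: l2_ip_def mult.assoc)
  show "l2_ip M g f = cnj (l2_ip M f g)" for f g
    unfolding l2_ip_def by (subst Bochner_Integration.integral_cnj[symmetric]) (simp add: mult.commute)
  show "0 \<le> Re (l2_ip M f f)" for f by (simp add: l2_ip_self)
qed (fact l2_add l2_scale l2_complete)+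

section \<open>Clark measures and de Branges--Rovnyak spaces\<close>

lemma l2_bounded:
  assumes "finite_measure M" "f \<in> borel_measurable M" "\<And>x. x \<in> space M \<Longrightarrow> cmod (f x) \<le> B"
  shows "f \<in> l2 M"
proof -
  have "integrable M (\<lambda>x. (cmod (f x))\<^sup>2)"
    using assms(2,3) by (intro integrable_bounded_finite[OF assms(1), of _ "B\<^sup>2"]) (auto intro!: power_mono)
  then show ?thesis using assms(2) by (simp add: l2_def)
qed

lemma semi_hilbert_rkhs:
  assumes "reproducing_kernel_hilbert_space X k H ip"
  shows "semi_hilbert H ip"
proof -
  interpret reproducing_kernel_hilbert_space X k H ip by fact
  show ?thesis
    by unfold_locales (fact zero_mem add_mem scale_mem ip_add ip_scale ip_cnj ip_nonneg complete)+
qed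

lemma continuous_on_cauchy_kernel_left:
  fixes w :: "complex ^ 'n"
  assumes "w \<in> ball 0 1" shows "continuous_on (sphere 0 1) (\<lambda>\<zeta>. cauchy_kernel \<zeta> w)"
proof -
  have "continuous_on (sphere 0 1) (\<lambda>\<zeta>. cnj (cauchy_kernel w \<zeta>))"
    by (intro continuous_on_cnj continuous_on_cauchy_kernel assms)
  then show ?thesis by (simp add: cauchy_kernel_cnj)
qed

text \<open>On the sphere \<open>cdot \<zeta> w\<close> stays in the disc of radius |w| < 1, where
  the derivative of (1 - x)^(-n) is bounded. This makes \<theta> C(., w) an admissible Lipschitz
  function.\<close>

lemma cauchy_kernel_lipschitz:
  fixes w :: "complex ^ 'n"
  assumes w: "w \<in> ball 0 1" and "norm \<eta> = 1" "norm z = 1"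
  shows "cmod (cauchy_kernel \<eta> w - cauchy_kernel z w) \<le> (CARD('n) / (1 - norm w) ^ (CARD('n) + 1)) * norm (\<eta> - z)"
proof -
  have w1: "norm w < 1" using w by simp
  have n1: "x \<noteq> 1" if "x \<in> cball 0 (norm w)" for x :: complex using that w1 by auto
  have "cmod (1 / (1 - cdot \<eta> w) ^ CARD('n) - 1 / (1 - cdot z w) ^ CARD('n)) \<le> CARD('n) / (1 - norm w) ^ (CARD('n) + 1) * cmod (cdot \<eta> w - cdot z w)"
  proof (rule field_differentiable_bound[of "cball 0 (norm w)" "\<lambda>x. 1 / (1 - x) ^ CARD('n)" "\<lambda>x. of_nat CARD('n) / (1 - x) ^ (CARD('n) + 1)"])
    fix x :: complex assume x: "x \<in> cball 0 (norm w)"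
    show "((\<lambda>x. 1 / (1 - x) ^ CARD('n)) has_field_derivative of_nat CARD('n) / (1 - x) ^ (CARD('n) + 1)) (at x within cball 0 (norm w))"
      by (rule has_field_derivative_at_within[OF has_field_derivative_inverse_power[OF n1[OF x]]])
    have "1 - norm w \<le> cmod (1 - x)" using x norm_triangle_ineq2[of 1 x] by simp
    then show "cmod (of_nat CARD('n) / (1 - x) ^ (CARD('n) + 1)) \<le> CARD('n) / (1 - norm w) ^ (CARD('n) + 1)"
      unfolding norm_divide norm_power using w1 by (intro frac_le power_mono) auto
  qed (use norm_cdot_le[of \<eta> w] norm_cdot_le[of z w] assms in auto)
  also have "cmod (cdot \<eta> w - cdot z w) \<le> norm (\<eta> - z) * norm w"
    unfolding cdot_diff_left[symmetric] by (rule norm_cdot_le)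
  also have "\<dots> \<le> norm (\<eta> - z)" using w1 by (simp add: mult_left_le)
  finally show ?thesis
    using w1 unfolding cauchy_kernel_def by (simp add: mult_left_mono divide_right_mono)
qed

lemma de_branges_rovnyak_cong:
  assumes "f \<in> de_branges_rovnyak b" "\<And>z. z \<in> ball 0 1 \<Longrightarrow> f z = g z"
  shows "g \<in> de_branges_rovnyak b"
proof -
  have "cut_off (ball 0 1) f = cut_off (ball 0 1) g" using assms(2) by (auto simp: cut_off_def)
  then show ?thesis using assms(1) by (simp add: de_branges_rovnyak_def)
qed

lemma clark_factor_nonzero:
  assumes "holomorphic_to_disc b" "cmod \<alpha> = 1" "z \<in> ball 0 1"
  shows "1 - cnj \<alpha> * b z \<noteq> 0" "1 - \<alpha> * cnj (b z) \<noteq> 0"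
  using assms one_minus_unimodular_mult_nonzero[of "cnj \<alpha>" "b z"]
    one_minus_unimodular_mult_nonzero[of \<alpha> "cnj (b z)"]
  unfolding holomorphic_to_disc_def by (metis complex_mod_cnj)+

text \<open>By the Clark identity the vectors \<open>e z\<close> in L^2(\<mu>) have Gram kernel
  \<open>dbr_kernel b\<close>, so the functions \<open>l2_ip \<mu> f (e z)\<close> of z form a model
  of the de Branges--Rovnyak space. This model witnesses the existential quantifier in its
  definition.\<close>

lemma cauchy_integral_in_de_branges_rovnyak:
  fixes b :: "complex ^ 'n \<Rightarrow> complex"
  assumes b: "holomorphic_to_disc b" and \<alpha>: "cmod \<alpha> = 1" and \<mu>: "clark_measure b \<alpha> \<mu>" and f: "f \<in> l2 \<mu>"
  shows "(\<lambda>z. (1 - cnj \<alpha> * b z) * (\<integral>\<zeta>. cauchy_kernel z \<zeta> * f \<zeta> \<partial>\<mu>)) \<in> de_branges_rovnyak b"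
proof -
  note D = clark_measureD[OF \<mu>]
  define X where "X = ball (0 :: complex ^ 'n) 1"
  define e where "e z \<zeta> = (1 - \<alpha> * cnj (b z)) * cauchy_kernel \<zeta> z" for z \<zeta>
  interpret semi_hilbert "l2 \<mu>" "l2_ip \<mu>" by (rule semi_hilbert_l2)
  have eE: "e z \<in> l2 \<mu>" if "z \<in> X" for z
  proof -
    have "(\<lambda>\<zeta>. cauchy_kernel \<zeta> z) \<in> l2 \<mu>"
      by (rule l2_bounded[OF D(2) borel_measurable_sphereI[OF D(4) continuous_on_cauchy_kernel_left], where B = "1 / (1 - norm z) ^ CARD('n)"])
         (use that in \<open>auto simp: X_def D(1) intro!: norm_cauchy_kernel_right_le\<close>)
    then show ?thesis unfolding e_def by (rule l2_scale)
  qed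
  have ip: "l2_ip \<mu> g (e z) = (1 - cnj \<alpha> * b z) * (\<integral>\<zeta>. cauchy_kernel z \<zeta> * g \<zeta> \<partial>\<mu>)" for g z
    unfolding l2_ip_def e_def by (subst integral_mult_right_zero[symmetric]) (simp add: cauchy_kernel_cnj mult_ac)
  have "dbr_kernel b z w = l2_ip \<mu> (e w) (e z)" if "z \<in> X" "w \<in> X" for z w
  proof -
    have zw: "z \<in> ball 0 1" "w \<in> ball 0 1" using that by (auto simp: X_def)
    have n: "1 - cnj \<alpha> * b z \<noteq> 0" "1 - \<alpha> * cnj (b w) \<noteq> 0"
      by (rule clark_factor_nonzero[OF b \<alpha> zw(1)], rule clark_factor_nonzero[OF b \<alpha> zw(2)])
    have "l2_ip \<mu> (e w) (e z) = (1 - cnj \<alpha> * b z) * ((1 - \<alpha> * cnj (b w)) * (\<integral>\<zeta>. cauchy_kernel z \<zeta> * cauchy_kernel \<zeta> w \<partial>\<mu>))"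
      unfolding ip by (subst integral_mult_right_zero[symmetric]) (simp add: e_def mult_ac)
    then show ?thesis unfolding clark_identity[OF b \<alpha> \<mu> zw] using n by simp
  qed
  from rkhs_of_feature_map[of X e, OF eE this]
  obtain ipH where H: "reproducing_kernel_hilbert_space X (dbr_kernel b) ((\<lambda>f. cut_off X (\<lambda>z. l2_ip \<mu> f (e z))) ` l2 \<mu>) ipH"
    by blast
  have hol: "holomorphic_on_ball g" if g: "g \<in> (\<lambda>f. cut_off X (\<lambda>z. l2_ip \<mu> f (e z))) ` l2 \<mu>" for g
  proof -
    obtain h where h: "h \<in> l2 \<mu>" "g = cut_off X (\<lambda>z. l2_ip \<mu> h (e z))" using g by blast
    have "(\<lambda>_. 1) \<in> l2 \<mu>" by (rule l2_bounded[OF D(2), of _ 1]) auto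
    from l2_ip_integrable[OF h(1) this] have "integrable \<mu> h" by simp
    then have "holomorphic_on_ball (\<lambda>z. \<integral>\<zeta>. cauchy_kernel z \<zeta> * h \<zeta> \<partial>\<mu>)"
      by (intro holomorphic_on_ball_cauchy_integral D(3)) (auto simp: D(1))
    moreover have "holomorphic_on_ball (\<lambda>z. 1 + (- cnj \<alpha>) * b z)"
      using b by (intro holomorphic_on_ball_linear) (simp add: holomorphic_to_disc_def)
    ultimately have "holomorphic_on_ball (\<lambda>z. (1 + (- cnj \<alpha>) * b z) * (\<integral>\<zeta>. cauchy_kernel z \<zeta> * h \<zeta> \<partial>\<mu>))"
      by (rule holomorphic_on_ball_mult[rotated])
    then show ?thesis unfolding h(2) X_def ip by (intro holomorphic_on_ball_cut_off) simp
  qed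
  show ?thesis
    unfolding de_branges_rovnyak_def
    using H hol f unfolding X_def[symmetric] ip[symmetric] by blast
qed

lemma quotient_kernel_eq:
  fixes I b :: "complex ^ 'n \<Rightarrow> complex"
  assumes I: "holomorphic_to_disc I" and \<alpha>: "cmod \<alpha> = 1" and \<sigma>: "clark_measure I \<alpha> \<sigma>"
    and z: "z \<in> ball 0 1" and w: "w \<in> ball 0 1"
  shows "(\<alpha> - b z) / (\<alpha> - I z) * dbr_kernel I z w =
    (1 - \<alpha> * cnj (I w)) * ((1 - cnj \<alpha> * b z) * (\<integral>\<zeta>. cauchy_kernel z \<zeta> * cauchy_kernel \<zeta> w \<partial>\<sigma>))"
proof -
  have n: "1 - cnj \<alpha> * I z \<noteq> 0" "1 - \<alpha> * cnj (I w) \<noteq> 0"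
    by (rule clark_factor_nonzero[OF I \<alpha> z], rule clark_factor_nonzero[OF I \<alpha> w])
  have a: "\<alpha> * cnj \<alpha> = 1" using \<alpha> complex_norm_square[of \<alpha>] by simp
  have f: "\<alpha> - x = \<alpha> * (1 - cnj \<alpha> * x)" for x using a by (simp add: right_diff_distrib mult.assoc[symmetric])
  have "\<alpha> \<noteq> 0" using \<alpha> by auto
  then have "(\<alpha> - b z) / (\<alpha> - I z) = (1 - cnj \<alpha> * b z) / (1 - cnj \<alpha> * I z)"
    unfolding f by simp
  then show ?thesis unfolding clark_identity[OF I \<alpha> \<sigma> z w] using n by simp
qed

text \<open>The function F is tested against a combination of reproducing kernels. Two uses of the
  Clark identity turn the inner product into the \<sigma>-integral, up to the factor \<kappa>, and
  the squared norm of the combination into the \<mu>-integral. Cauchy--Schwarz gives M = |F| /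
  |\<kappa>|. Only the reproducing property is used, so any witness space \<open>H\<close> will
  do.\<close>

lemma clark_l2_estimate:
  fixes I b :: "complex ^ 'n \<Rightarrow> complex"
  assumes I: "holomorphic_to_disc I" and b: "holomorphic_to_disc b" and \<alpha>: "cmod \<alpha> = 1"
    and \<sigma>: "clark_measure I \<alpha> \<sigma>" and \<mu>: "clark_measure b \<alpha> \<mu>" and w0: "w0 \<in> ball 0 1"
    and mem: "(\<lambda>z. (\<alpha> - b z) / (\<alpha> - I z) * dbr_kernel I z w0) \<in> de_branges_rovnyak b"
  shows "\<exists>M\<ge>0. \<forall>A c. finite A \<longrightarrow> A \<subseteq> ball 0 1 \<longrightarrow>
      cmod (\<integral>\<zeta>. cnj (\<Sum>w\<in>A. c w * cauchy_kernel \<zeta> w) * cauchy_kernel \<zeta> w0 \<partial>\<sigma>)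
        \<le> M * sqrt (\<integral>\<zeta>. (cmod (\<Sum>w\<in>A. c w * cauchy_kernel \<zeta> w))\<^sup>2 \<partial>\<mu>)"
proof -
  define X where "X = ball (0 :: complex ^ 'n) 1"
  define F where "F = cut_off X (\<lambda>z. (\<alpha> - b z) / (\<alpha> - I z) * dbr_kernel I z w0)"
  define \<kappa> where "\<kappa> = 1 - \<alpha> * cnj (I w0)"
  obtain H ip where H: "reproducing_kernel_hilbert_space X (dbr_kernel b) H ip" and F: "F \<in> H"
    using mem unfolding de_branges_rovnyak_def F_def X_def by blast
  interpret R: reproducing_kernel_hilbert_space X "dbr_kernel b" H ip by fact
  interpret S: semi_hilbert H ip by (rule semi_hilbert_rkhs[OF H])
  note \<sigma>D = clark_measureD[OF \<sigma>] and \<mu>D = clark_measureD[OF \<mu>]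
  have \<kappa>: "\<kappa> \<noteq> 0" unfolding \<kappa>_def by (rule clark_factor_nonzero[OF I \<alpha> w0])
  have nb: "1 - cnj \<alpha> * b w \<noteq> 0" "1 - \<alpha> * cnj (b w) \<noteq> 0" if "w \<in> X" for w
    using clark_factor_nonzero[OF b \<alpha>] that unfolding X_def by blast+
  show ?thesis
  proof (intro exI[of _ "sqrt (S.nrm2 F) / cmod \<kappa>"] conjI allI impI)
    show "0 \<le> sqrt (S.nrm2 F) / cmod \<kappa>" using S.nrm2_nonneg[OF F] by simp
    fix A :: "(complex ^ 'n) set" and c :: "complex ^ 'n \<Rightarrow> complex" assume A: "finite A" "A \<subseteq> ball 0 1"
    define \<phi> where "\<phi> \<zeta> = (\<Sum>w\<in>A. c w * cauchy_kernel \<zeta> w)" for \<zeta>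
    \<comment> \<open>The division compensates the factor in the Clark identity, so that the
      combination of \<open>k w\<close> corresponds to \<phi> in L^2(\<mu>).\<close>
    define d where "d w = c w / (1 - \<alpha> * cnj (b w))" for w
    define k where "k w = cut_off X (\<lambda>z. dbr_kernel b z w)" for w
    have kH: "k w \<in> H" if "w \<in> X" for w unfolding k_def by (rule R.kernel_mem[OF that])
    have AX: "w \<in> X" if "w \<in> A" for w using A(2) that by (auto simp: X_def)
    have sums: "(\<lambda>z. \<Sum>w\<in>B. a w * k w z) \<in> H \<and> (\<forall>g\<in>H. ip g (\<lambda>z. \<Sum>w\<in>B. a w * k w z) = (\<Sum>w\<in>B. cnj (a w) * g w))"
      if "finite B" "B \<subseteq> A" for a B
      using that
    proof (induction B rule: finite_induct)
      case empty
      have "ip g (\<lambda>z. 0) = 0" if "g \<in> H" for g using S.ip_scale_right[OF R.zero_mem that, of 0] by simp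
      then show ?case using R.zero_mem by simp
    next
      case (insert v B)
      have vX: "v \<in> X" using AX insert by auto
      have vH: "(\<lambda>z. a v * k v z) \<in> H" by (rule R.scale_mem[OF kH[OF vX]])
      have IH: "(\<lambda>z. \<Sum>w\<in>B. a w * k w z) \<in> H" "\<And>g. g \<in> H \<Longrightarrow> ip g (\<lambda>z. \<Sum>w\<in>B. a w * k w z) = (\<Sum>w\<in>B. cnj (a w) * g w)"
        using insert by auto
      have "ip g (k v) = g v" if "g \<in> H" for g unfolding k_def by (rule R.reproducing[OF that vX])
      then show ?case using insert(1,2) R.add_mem[OF vH IH(1)]
        by (simp add: S.ip_add_right[OF vH IH(1)] S.ip_scale_right[OF kH[OF vX]] IH(2))
    qed
    define g where "g z = (\<Sum>w\<in>A. d w * k w z)" for z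
    have gH: "g \<in> H" and ipg: "\<And>h. h \<in> H \<Longrightarrow> ip h g = (\<Sum>w\<in>A. cnj (d w) * h w)"
      using sums[OF A(1) subset_refl, of d] unfolding g_def[abs_def] by auto
    have "ip F g = (\<Sum>w\<in>A. \<kappa> * (cnj (c w) * (\<integral>\<zeta>. cauchy_kernel w \<zeta> * cauchy_kernel \<zeta> w0 \<partial>\<sigma>)))"
      unfolding ipg[OF F]
    proof (rule sum.cong[OF refl])
      fix w assume w: "w \<in> A"
      then have wX: "w \<in> X" by (rule AX)
      have "F w = \<kappa> * ((1 - cnj \<alpha> * b w) * (\<integral>\<zeta>. cauchy_kernel w \<zeta> * cauchy_kernel \<zeta> w0 \<partial>\<sigma>))"
        using wX quotient_kernel_eq[OF I \<alpha> \<sigma> _ w0, of w b] by (simp add: F_def cut_off_def \<kappa>_def X_def)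
      moreover have "cnj (d w) = cnj (c w) / (1 - cnj \<alpha> * b w)" by (simp add: d_def)
      ultimately show "cnj (d w) * F w = \<kappa> * (cnj (c w) * (\<integral>\<zeta>. cauchy_kernel w \<zeta> * cauchy_kernel \<zeta> w0 \<partial>\<sigma>))"
        using nb[OF wX] by simp
    qed
    also have "\<dots> = \<kappa> * (\<integral>\<zeta>. cnj (\<phi> \<zeta>) * cauchy_kernel \<zeta> w0 \<partial>\<sigma>)"
    proof -
      have int: "integrable \<sigma> (\<lambda>\<zeta>. cnj (c w) * (cauchy_kernel w \<zeta> * cauchy_kernel \<zeta> w0))" if "w \<in> A" for w
      proof -
        have cw: "continuous_on (sphere 0 1) (\<lambda>\<zeta>. cauchy_kernel w \<zeta> * cauchy_kernel \<zeta> w0)"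
          using A(2) that w0 by (intro continuous_intros continuous_on_cauchy_kernel continuous_on_cauchy_kernel_left) auto
        show ?thesis
          by (intro integrable_mult_right integrable_continuous_on_sphere[OF \<sigma>D(2,4) cw])
      qed
      have "(\<integral>\<zeta>. cnj (\<phi> \<zeta>) * cauchy_kernel \<zeta> w0 \<partial>\<sigma>) = (\<integral>\<zeta>. (\<Sum>w\<in>A. cnj (c w) * (cauchy_kernel w \<zeta> * cauchy_kernel \<zeta> w0)) \<partial>\<sigma>)"
        unfolding \<phi>_def by (simp add: sum_distrib_right cauchy_kernel_cnj mult.assoc)
      also have "\<dots> = (\<Sum>w\<in>A. cnj (c w) * (\<integral>\<zeta>. cauchy_kernel w \<zeta> * cauchy_kernel \<zeta> w0 \<partial>\<sigma>))"
        by (subst Bochner_Integration.integral_sum[OF int]) simp_all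
      finally show ?thesis by (simp add: sum_distrib_left)
    qed
    finally have ipF: "ip F g = \<kappa> * (\<integral>\<zeta>. cnj (\<phi> \<zeta>) * cauchy_kernel \<zeta> w0 \<partial>\<sigma>)" .
    have "complex_of_real (S.nrm2 g) = ip g g" by (rule S.ip_self[OF gH, symmetric])
    also have "\<dots> = (\<Sum>v\<in>A. \<Sum>w\<in>A. c w * cnj (c v) * (\<integral>\<zeta>. cauchy_kernel v \<zeta> * cauchy_kernel \<zeta> w \<partial>\<mu>))"
      unfolding ipg[OF gH]
    proof (rule sum.cong[OF refl])
      fix v assume v: "v \<in> A"
      have "cnj (d v) * (d w * k w v) = c w * cnj (c v) * (\<integral>\<zeta>. cauchy_kernel v \<zeta> * cauchy_kernel \<zeta> w \<partial>\<mu>)" if w: "w \<in> A" for w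
      proof -
        have "v \<in> ball 0 1" "w \<in> ball 0 1" using A(2) v w by auto
        from clark_identity[OF b \<alpha> \<mu> this] show ?thesis
          using AX[OF v] by (simp add: k_def cut_off_def d_def)
      qed
      then show "cnj (d v) * g v = (\<Sum>w\<in>A. c w * cnj (c v) * (\<integral>\<zeta>. cauchy_kernel v \<zeta> * cauchy_kernel \<zeta> w \<partial>\<mu>))"
        unfolding g_def sum_distrib_left by (intro sum.cong refl) auto
    qed
    also have "\<dots> = complex_of_real (\<integral>\<zeta>. (cmod (\<phi> \<zeta>))\<^sup>2 \<partial>\<mu>)"
    proof -
      have int: "integrable \<mu> (\<lambda>\<zeta>. c w * cnj (c v) * (cauchy_kernel v \<zeta> * cauchy_kernel \<zeta> w))" if "v \<in> A" "w \<in> A" for v w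
      proof -
        have cw: "continuous_on (sphere 0 1) (\<lambda>\<zeta>. cauchy_kernel v \<zeta> * cauchy_kernel \<zeta> w)"
          using A(2) that by (intro continuous_intros continuous_on_cauchy_kernel continuous_on_cauchy_kernel_left) auto
        show ?thesis
          by (intro integrable_mult_right integrable_continuous_on_sphere[OF \<mu>D(2,4) cw])
      qed
      have "complex_of_real ((cmod (\<phi> \<zeta>))\<^sup>2) = (\<Sum>v\<in>A. \<Sum>w\<in>A. c w * cnj (c v) * (cauchy_kernel v \<zeta> * cauchy_kernel \<zeta> w))" for \<zeta>
        unfolding complex_norm_square \<phi>_def cnj_sum sum_distrib_left sum_distrib_right
        by (simp add: cauchy_kernel_cnj mult_ac)
      then have "complex_of_real (\<integral>\<zeta>. (cmod (\<phi> \<zeta>))\<^sup>2 \<partial>\<mu>) = (\<integral>\<zeta>. (\<Sum>v\<in>A. \<Sum>w\<in>A. c w * cnj (c v) * (cauchy_kernel v \<zeta> * cauchy_kernel \<zeta> w)) \<partial>\<mu>)"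
        unfolding integral_complex_of_real[symmetric] by simp
      also have "\<dots> = (\<Sum>v\<in>A. \<integral>\<zeta>. (\<Sum>w\<in>A. c w * cnj (c v) * (cauchy_kernel v \<zeta> * cauchy_kernel \<zeta> w)) \<partial>\<mu>)"
        by (rule Bochner_Integration.integral_sum) (intro Bochner_Integration.integrable_sum int)
      also have "\<dots> = (\<Sum>v\<in>A. \<Sum>w\<in>A. c w * cnj (c v) * (\<integral>\<zeta>. cauchy_kernel v \<zeta> * cauchy_kernel \<zeta> w \<partial>\<mu>))"
        by (intro sum.cong refl, subst Bochner_Integration.integral_sum[OF int]) simp_all
      finally show ?thesis ..
    qed
    finally have nrm: "S.nrm2 g = (\<integral>\<zeta>. (cmod (\<phi> \<zeta>))\<^sup>2 \<partial>\<mu>)" by (simp only: of_real_eq_iff)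
    have "cmod \<kappa> * cmod (\<integral>\<zeta>. cnj (\<phi> \<zeta>) * cauchy_kernel \<zeta> w0 \<partial>\<sigma>) \<le> sqrt (S.nrm2 F) * sqrt (S.nrm2 g)"
      using S.cauchy_schwarz_sqrt[OF F gH] unfolding ipF norm_mult .
    then show "cmod (\<integral>\<zeta>. cnj (\<Sum>w\<in>A. c w * cauchy_kernel \<zeta> w) * cauchy_kernel \<zeta> w0 \<partial>\<sigma>)
        \<le> sqrt (S.nrm2 F) / cmod \<kappa> * sqrt (\<integral>\<zeta>. (cmod (\<Sum>w\<in>A. c w * cauchy_kernel \<zeta> w))\<^sup>2 \<partial>\<mu>)"
      using \<kappa> unfolding nrm \<phi>_def[symmetric] by (simp add: field_simps)
  qed
qed

lemma inner_clark_rotate: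
  fixes I :: "complex ^ 'n \<Rightarrow> complex"
  assumes I: "inner_function I" and \<alpha>: "cmod \<alpha> = 1" and \<sigma>: "clark_measure I \<alpha> \<sigma>"
  shows "inner_clark (\<lambda>z. cnj \<alpha> * I z) \<sigma>"
proof
  have a: "\<alpha> * cnj \<alpha> = 1" using \<alpha> complex_norm_square[of \<alpha>] by simp
  have "holomorphic_to_disc (\<lambda>z. cnj \<alpha> * I z)"
    using I holomorphic_on_ball_linear[of I 0 "cnj \<alpha>"] \<alpha>
    by (simp add: inner_function_def holomorphic_to_disc_def norm_mult)
  moreover have "AE \<zeta> in sphere_measure. \<exists>l. ((\<lambda>r. cnj \<alpha> * I (r *\<^sub>R \<zeta>)) \<longlongrightarrow> l) (at_left 1) \<and> cmod l = 1"
    using conjunct2[OF I[unfolded inner_function_def]]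
  proof eventually_elim
    case (elim \<zeta>)
    then obtain l where "((\<lambda>r. I (r *\<^sub>R \<zeta>)) \<longlongrightarrow> l) (at_left 1)" "cmod l = 1" by blast
    then show ?case using \<alpha> by (intro exI[of _ "cnj \<alpha> * l"]) (auto intro!: tendsto_intros simp: norm_mult)
  qed
  ultimately show "inner_function (\<lambda>z. cnj \<alpha> * I z)" by (simp add: inner_function_def)
  have "cmod (1 - cnj \<alpha> * I z) = cmod (\<alpha> - I z)" for z
  proof -
    have "\<alpha> - I z = \<alpha> * (1 - cnj \<alpha> * I z)" using a by (simp add: right_diff_distrib mult.assoc[symmetric])
    then show ?thesis using \<alpha> by (simp add: norm_mult)
  qed
  then show "clark_measure (\<lambda>z. cnj \<alpha> * I z) 1 \<sigma>"
    using \<sigma> \<alpha> unfolding clark_measure_def by (simp add: norm_mult)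
qed

text \<open>The Lipschitz estimate still carries the weight g = C(., w0). It is removed by choosing
  test functions that contain g themselves.\<close>

lemma clark_density_of_membership:
  fixes I b :: "complex ^ 'n \<Rightarrow> complex"
  assumes I: "inner_function I" and b: "holomorphic_to_disc b" and \<alpha>: "cmod \<alpha> = 1"
    and \<sigma>: "clark_measure I \<alpha> \<sigma>" and \<mu>: "clark_measure b \<alpha> \<mu>" and w0: "w0 \<in> ball 0 1"
    and mem: "(\<lambda>z. (\<alpha> - b z) / (\<alpha> - I z) * dbr_kernel I z w0) \<in> de_branges_rovnyak b"
  shows "absolutely_continuous \<mu> \<sigma> \<and> (\<integral>\<^sup>+\<zeta>. (RN_deriv \<mu> \<sigma> \<zeta>)\<^sup>2 \<partial>\<mu>) < \<infinity>"
proof -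
  interpret inner_clark "\<lambda>z. cnj \<alpha> * I z" \<sigma> by (rule inner_clark_rotate[OF I \<alpha> \<sigma>])
  have Id: "holomorphic_to_disc I" using I by (simp add: inner_function_def)
  obtain M where M: "M \<ge> 0" and fin: "\<And>A c. finite A \<Longrightarrow> A \<subseteq> ball 0 1 \<Longrightarrow>
      cmod (\<integral>\<zeta>. cnj (\<Sum>w\<in>A. c w * cauchy_kernel \<zeta> w) * cauchy_kernel \<zeta> w0 \<partial>\<sigma>)
        \<le> M * sqrt (\<integral>\<zeta>. (cmod (\<Sum>w\<in>A. c w * cauchy_kernel \<zeta> w))\<^sup>2 \<partial>\<mu>)"
    using clark_l2_estimate[OF Id b \<alpha> \<sigma> \<mu> w0 mem] by blast
  note \<mu>D = clark_measureD[OF \<mu>]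
  define g where "g \<zeta> = cauchy_kernel \<zeta> w0" for \<zeta>
  define G where "G = 1 / (1 - norm w0) ^ CARD('n)"
  define Kg where "Kg = CARD('n) / (1 - norm w0) ^ (CARD('n) + 1)"
  define c where "c = (1 / 2 ^ CARD('n) :: real)"
  have c0: "c > 0" by (simp add: c_def)
  have G0: "0 \<le> G" "0 \<le> Kg" using w0 by (auto simp: G_def Kg_def)
  have gG: "cmod (g \<zeta>) \<le> G" if "norm \<zeta> = 1" for \<zeta>
    unfolding g_def G_def by (rule norm_cauchy_kernel_right_le) (use w0 that in auto)
  have gc: "c \<le> cmod (g \<zeta>)" if "norm \<zeta> = 1" for \<zeta>
    using norm_cauchy_kernel_ge[of \<zeta> w0] w0 that unfolding g_def c_def
    by (simp add: cauchy_kernel_cnj[of w0 \<zeta>, symmetric])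
  have gl: "cmod (g \<eta> - g z) \<le> Kg * norm (\<eta> - z)" if "norm \<eta> = 1" "norm z = 1" for \<eta> z
    unfolding g_def Kg_def by (rule cauchy_kernel_lipschitz[OF w0 that])
  have gcont: "continuous_on (sphere 0 1) g"
    unfolding g_def[abs_def] by (rule continuous_on_cauchy_kernel_left[OF w0])
  \<comment> \<open>The square of the lower bound \<open>c\<close> comes from |g|^2 on the
    \<sigma>-side, the upper bound \<open>G\<close> from |g| in the norm on the \<mu>-side.\<close>
  interpret l2_dominated \<sigma> \<mu> "M * G / c\<^sup>2"
  proof (rule l2_dominated.intro)
    show "finite_measure \<sigma>" "sets \<sigma> = sets (restrict_space borel (sphere 0 1))"
      "finite_measure \<mu>" "sets \<mu> = sets (restrict_space borel (sphere 0 1))"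
      by (rule \<sigma>D \<mu>D)+
    show "0 \<le> M * G / c\<^sup>2" using M G0 by simp
    fix \<theta> :: "complex ^ 'n \<Rightarrow> real" and K B
    assume K: "K \<ge> 0" and \<theta>0: "\<And>x. 0 \<le> \<theta> x" and \<theta>B: "\<And>x. \<theta> x \<le> B"
      and \<theta>l: "\<And>x y. \<bar>\<theta> x - \<theta> y\<bar> \<le> K * dist x y"
    have B0: "0 \<le> B" using \<theta>0[of 0] \<theta>B[of 0] by simp
    \<comment> \<open>Then \<open>cnj (\<psi> x) * g x\<close> is \<theta> |g|^2, so nothing cancels
      in the integral.\<close>
    define \<psi> where "\<psi> x = complex_of_real (\<theta> x) * g x" for x
    have \<theta>c: "continuous_on (sphere 0 1) \<theta>"
      by (rule lipschitz_on_continuous_on[of K]) (use \<theta>l K in \<open>auto simp: lipschitz_on_def dist_real_def\<close>)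
    have \<theta>m: "\<theta> \<in> borel_measurable \<sigma>" "\<theta> \<in> borel_measurable \<mu>" and gm: "g \<in> borel_measurable \<sigma>" "g \<in> borel_measurable \<mu>"
      by (rule borel_measurable_sphereI[OF \<sigma>D(4) \<theta>c], rule borel_measurable_sphereI[OF \<mu>D(4) \<theta>c],
          rule borel_measurable_sphereI[OF \<sigma>D(4) gcont], rule borel_measurable_sphereI[OF \<mu>D(4) gcont])
    have est: "cmod (\<integral>\<zeta>. cnj (\<psi> \<zeta>) * g \<zeta> \<partial>\<sigma>) \<le> M * sqrt (\<integral>\<zeta>. (cmod (\<psi> \<zeta>))\<^sup>2 \<partial>\<mu>)"
    proof (rule lipschitz_estimate[OF \<mu>D(2,4) gcont gG M])
      show "cmod (\<integral>\<zeta>. cnj (\<Sum>w\<in>A. c w * cauchy_kernel \<zeta> w) * g \<zeta> \<partial>\<sigma>) \<le> M * sqrt (\<integral>\<zeta>. (cmod (\<Sum>w\<in>A. c w * cauchy_kernel \<zeta> w))\<^sup>2 \<partial>\<mu>)"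
        if "finite A" "A \<subseteq> ball 0 1" for A c
        unfolding g_def by (rule fin[OF that])
      show "cmod (\<psi> \<eta> - \<psi> z) \<le> (B * Kg + K * G) * norm (\<eta> - z)" if "norm \<eta> = 1" "norm z = 1" for \<eta> z
      proof -
        have "\<psi> \<eta> - \<psi> z = complex_of_real (\<theta> \<eta>) * (g \<eta> - g z) + complex_of_real (\<theta> \<eta> - \<theta> z) * g z"
          by (simp add: \<psi>_def algebra_simps)
        then have "cmod (\<psi> \<eta> - \<psi> z) \<le> \<bar>\<theta> \<eta>\<bar> * cmod (g \<eta> - g z) + \<bar>\<theta> \<eta> - \<theta> z\<bar> * cmod (g z)"
          by (metis norm_mult norm_of_real norm_triangle_ineq)
        also have "\<dots> \<le> B * (Kg * norm (\<eta> - z)) + (K * norm (\<eta> - z)) * G"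
          using \<theta>0 \<theta>B \<theta>l[of \<eta> z] gl[OF that] gG[OF that(2)] B0 K
          by (intro add_mono mult_mono) (auto simp: dist_norm)
        finally show ?thesis by (simp add: algebra_simps)
      qed
      show "cmod (\<psi> z) \<le> B * G" if "norm z = 1" for z
        unfolding \<psi>_def norm_mult using \<theta>0 \<theta>B gG[OF that] B0 by (intro mult_mono) auto
    qed (use B0 K G0 in auto)
    have i\<theta>: "integrable \<sigma> \<theta>"
      by (rule integrable_bounded_finite[OF \<sigma>D(2) \<theta>m(1), of B]) (use \<theta>0 \<theta>B in auto)
    have i\<theta>g: "integrable \<sigma> (\<lambda>\<zeta>. \<theta> \<zeta> * (cmod (g \<zeta>))\<^sup>2)"
      by (rule integrable_bounded_finite[OF \<sigma>D(2), of _ "B * G\<^sup>2"])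
         (use \<theta>m gm \<theta>0 \<theta>B gG B0 in \<open>auto simp: \<sigma>D(1) abs_mult intro!: mult_mono power_mono\<close>)
    have i\<theta>2: "integrable \<mu> (\<lambda>\<zeta>. (\<theta> \<zeta>)\<^sup>2)"
      by (rule integrable_bounded_finite[OF \<mu>D(2), of _ "B\<^sup>2"]) (use \<theta>m \<theta>0 \<theta>B in \<open>auto intro!: power_mono\<close>)
    have i\<psi>2: "integrable \<mu> (\<lambda>\<zeta>. (cmod (\<psi> \<zeta>))\<^sup>2)"
      unfolding \<psi>_def
      by (rule integrable_bounded_finite[OF \<mu>D(2), of _ "(B * G)\<^sup>2"])
         (use \<theta>m gm \<theta>0 \<theta>B gG B0 in \<open>auto simp: \<mu>D(1) norm_mult intro!: power_mono mult_mono\<close>)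
    have "c\<^sup>2 * (\<integral>\<zeta>. \<theta> \<zeta> \<partial>\<sigma>) = (\<integral>\<zeta>. \<theta> \<zeta> * c\<^sup>2 \<partial>\<sigma>)" by simp
    also have "\<dots> \<le> (\<integral>\<zeta>. \<theta> \<zeta> * (cmod (g \<zeta>))\<^sup>2 \<partial>\<sigma>)"
      using i\<theta> i\<theta>g c0 \<theta>0 gc by (intro integral_mono mult_left_mono power_mono) (auto simp: \<sigma>D(1))
    also have "\<dots> \<le> cmod (complex_of_real (\<integral>\<zeta>. \<theta> \<zeta> * (cmod (g \<zeta>))\<^sup>2 \<partial>\<sigma>))" by (simp only: norm_of_real abs_ge_self)
    also have "complex_of_real (\<integral>\<zeta>. \<theta> \<zeta> * (cmod (g \<zeta>))\<^sup>2 \<partial>\<sigma>) = (\<integral>\<zeta>. cnj (\<psi> \<zeta>) * g \<zeta> \<partial>\<sigma>)"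
      unfolding integral_complex_of_real[symmetric] \<psi>_def of_real_mult complex_norm_square
      by (simp add: mult_ac)
    also have "cmod (\<integral>\<zeta>. cnj (\<psi> \<zeta>) * g \<zeta> \<partial>\<sigma>) \<le> M * sqrt (\<integral>\<zeta>. (cmod (\<psi> \<zeta>))\<^sup>2 \<partial>\<mu>)" by (rule est)
    also have "\<dots> \<le> M * sqrt (\<integral>\<zeta>. (\<theta> \<zeta>)\<^sup>2 * G\<^sup>2 \<partial>\<mu>)"
    proof (intro mult_left_mono M real_sqrt_le_mono integral_mono i\<psi>2)
      show "integrable \<mu> (\<lambda>\<zeta>. (\<theta> \<zeta>)\<^sup>2 * G\<^sup>2)" using i\<theta>2 by simp
      fix \<zeta> assume "\<zeta> \<in> space \<mu>"
      then have "(cmod (g \<zeta>))\<^sup>2 \<le> G\<^sup>2" using gG by (intro power_mono) (auto simp: \<mu>D(1))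
      then show "(cmod (\<psi> \<zeta>))\<^sup>2 \<le> (\<theta> \<zeta>)\<^sup>2 * G\<^sup>2"
        by (simp add: \<psi>_def norm_mult power_mult_distrib mult_left_mono)
    qed
    also have "\<dots> = M * G * sqrt (\<integral>\<zeta>. (\<theta> \<zeta>)\<^sup>2 \<partial>\<mu>)" using G0 by (simp add: real_sqrt_mult)
    finally show "(\<integral>\<zeta>. \<theta> \<zeta> \<partial>\<sigma>) \<le> M * G / c\<^sup>2 * sqrt (\<integral>\<zeta>. (\<theta> \<zeta>)\<^sup>2 \<partial>\<mu>)"
      using c0 by (simp add: field_simps)
  qed
  show ?thesis using abs_continuous density_square_integrable by blast
qed

text \<open>With h the density of \<sigma>, the Cauchy integral of C(., w) \<sigma> is that of C(.,
  w) h \<mu>; as C(., w) is bounded on the sphere, C(., w) h lies in L^2(\<mu>) together with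
  h.\<close>

lemma membership_of_clark_density:
  fixes I b :: "complex ^ 'n \<Rightarrow> complex"
  assumes I: "holomorphic_to_disc I" and b: "holomorphic_to_disc b" and \<alpha>: "cmod \<alpha> = 1"
    and \<sigma>: "clark_measure I \<alpha> \<sigma>" and \<mu>: "clark_measure b \<alpha> \<mu>"
    and ac: "absolutely_continuous \<mu> \<sigma>" and L2: "(\<integral>\<^sup>+\<zeta>. (RN_deriv \<mu> \<sigma> \<zeta>)\<^sup>2 \<partial>\<mu>) < \<infinity>"
    and w: "w \<in> ball 0 1"
  shows "(\<lambda>z. (\<alpha> - b z) / (\<alpha> - I z) * dbr_kernel I z w) \<in> de_branges_rovnyak b"
proof -
  note \<sigma>D = clark_measureD[OF \<sigma>] and \<mu>D = clark_measureD[OF \<mu>]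
  interpret \<mu>: finite_measure \<mu> by (rule \<mu>D)
  note [measurable] = \<mu>D(3)
  define R where "R = RN_deriv \<mu> \<sigma>"
  define h where "h \<zeta> = enn2real (R \<zeta>)" for \<zeta>
  have Rm [measurable]: "R \<in> borel_measurable \<mu>" unfolding R_def by (rule borel_measurable_RN_deriv)
  have hm [measurable]: "h \<in> borel_measurable \<mu>" unfolding h_def by measurable
  \<comment> \<open>\<open>RN_deriv\<close> takes extended real values; square integrability makes
    it finite almost everywhere, so a real density \<open>h\<close> can replace it.\<close>
  have "AE \<zeta> in \<mu>. (R \<zeta>)\<^sup>2 \<noteq> \<infinity>"
    by (rule nn_integral_PInf_AE) (use L2 in \<open>auto simp: R_def\<close>)
  then have Rh: "AE \<zeta> in \<mu>. R \<zeta> = ennreal (h \<zeta>)"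
    by eventually_elim (auto simp: h_def power2_eq_square ennreal_mult_eq_top_iff less_top)
  have "density \<mu> R = \<sigma>" unfolding R_def
    by (rule \<mu>.density_RN_deriv[OF ac]) (simp add: \<sigma>D(4) \<mu>D(4))
  then have dens: "density \<mu> (\<lambda>\<zeta>. ennreal (h \<zeta>)) = \<sigma>"
    using density_cong[of R \<mu> "\<lambda>\<zeta>. ennreal (h \<zeta>)"] Rh by simp
  have h0: "0 \<le> h \<zeta>" for \<zeta> by (simp add: h_def)
  have h2: "integrable \<mu> (\<lambda>\<zeta>. (h \<zeta>)\<^sup>2)"
  proof (rule integrableI_nonneg)
    have "(\<integral>\<^sup>+\<zeta>. ennreal ((h \<zeta>)\<^sup>2) \<partial>\<mu>) = (\<integral>\<^sup>+\<zeta>. (R \<zeta>)\<^sup>2 \<partial>\<mu>)"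
      by (rule nn_integral_cong_AE) (use Rh in \<open>eventually_elim, simp add: ennreal_power h0\<close>)
    then show "(\<integral>\<^sup>+\<zeta>. ennreal ((h \<zeta>)\<^sup>2) \<partial>\<mu>) < \<infinity>" using L2 by (simp add: R_def)
  qed auto
  define G where "G = 1 / (1 - norm w) ^ CARD('n)"
  define f where "f \<zeta> = cauchy_kernel \<zeta> w * complex_of_real (h \<zeta>)" for \<zeta>
  have f: "f \<in> l2 \<mu>"
  proof -
    have fm: "f \<in> borel_measurable \<mu>" unfolding f_def by measurable
    have "integrable \<mu> (\<lambda>\<zeta>. (cmod (f \<zeta>))\<^sup>2)"
    proof (rule Bochner_Integration.integrable_bound)
      show "integrable \<mu> (\<lambda>\<zeta>. G\<^sup>2 * (h \<zeta>)\<^sup>2)" using h2 by simp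
      show "AE \<zeta> in \<mu>. norm ((cmod (f \<zeta>))\<^sup>2) \<le> norm (G\<^sup>2 * (h \<zeta>)\<^sup>2)"
      proof (intro AE_I2)
        fix \<zeta> assume "\<zeta> \<in> space \<mu>"
        then have "cmod (cauchy_kernel \<zeta> w) \<le> G"
          unfolding G_def by (intro norm_cauchy_kernel_right_le) (use w in \<open>auto simp: \<mu>D(1)\<close>)
        then have "(cmod (cauchy_kernel \<zeta> w))\<^sup>2 \<le> G\<^sup>2" by (intro power_mono) auto
        then show "norm ((cmod (f \<zeta>))\<^sup>2) \<le> norm (G\<^sup>2 * (h \<zeta>)\<^sup>2)"
          by (simp add: f_def norm_mult power_mult_distrib mult_right_mono)
      qed
    qed (use fm in measurable)
    then show ?thesis using fm by (simp add: l2_def)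
  qed
  have eq: "(\<integral>\<zeta>. cauchy_kernel z \<zeta> * cauchy_kernel \<zeta> w \<partial>\<sigma>) = (\<integral>\<zeta>. cauchy_kernel z \<zeta> * f \<zeta> \<partial>\<mu>)" for z
  proof -
    have "(\<integral>\<zeta>. cauchy_kernel z \<zeta> * cauchy_kernel \<zeta> w \<partial>(density \<mu> (\<lambda>\<zeta>. ennreal (h \<zeta>)))) = (\<integral>\<zeta>. h \<zeta> *\<^sub>R (cauchy_kernel z \<zeta> * cauchy_kernel \<zeta> w) \<partial>\<mu>)"
      by (rule integral_density) (use h0 in auto)
    then show ?thesis by (simp add: dens f_def scaleR_conv_of_real mult_ac)
  qed
  define \<kappa> where "\<kappa> = 1 - \<alpha> * cnj (I w)"
  show ?thesis
  proof (rule de_branges_rovnyak_cong)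
    show "(\<lambda>z. (1 - cnj \<alpha> * b z) * (\<integral>\<zeta>. cauchy_kernel z \<zeta> * (\<kappa> * f \<zeta>) \<partial>\<mu>)) \<in> de_branges_rovnyak b"
      by (rule cauchy_integral_in_de_branges_rovnyak[OF b \<alpha> \<mu> l2_scale[OF f]])
    fix z :: "complex ^ 'n" assume z: "z \<in> ball 0 1"
    have "(\<integral>\<zeta>. cauchy_kernel z \<zeta> * (\<kappa> * f \<zeta>) \<partial>\<mu>) = \<kappa> * (\<integral>\<zeta>. cauchy_kernel z \<zeta> * f \<zeta> \<partial>\<mu>)"
      by (subst integral_mult_right_zero[symmetric]) (simp add: mult_ac)
    then show "(1 - cnj \<alpha> * b z) * (\<integral>\<zeta>. cauchy_kernel z \<zeta> * (\<kappa> * f \<zeta>) \<partial>\<mu>) = (\<alpha> - b z) / (\<alpha> - I z) * dbr_kernel I z w"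
      using quotient_kernel_eq[OF I \<alpha> \<sigma> z w, of b] by (simp add: eq \<kappa>_def)
  qed
qed

text \<open>Condition (i) is phrased through \<open>RN_deriv\<close>, which under absolute
  continuity is the nonnegative density, determined up to null sets; membership in L^2(\<mu>) is
  then finiteness of the integral of its square. The equivalences are closed by the cycle (i), (ii),
  (iii), (i).\<close>

theorem theorem1p2:
  fixes I b :: "complex ^ 'n \<Rightarrow> complex"
    and \<alpha> :: complex
    and \<sigma> \<mu> :: "(complex ^ 'n) measure"
  assumes "CARD('n) \<ge> 2"
    and "inner_function I"
    and "holomorphic_to_disc b"
    and "\<not> b constant_on ball 0 1"
    and "cmod \<alpha> = 1"
    and "clark_measure I \<alpha> \<sigma>"
    and "clark_measure b \<alpha> \<mu>"
  shows "((absolutely_continuous \<mu> \<sigma> \<and> (\<integral>\<^sup>+\<zeta>. (RN_deriv \<mu> \<sigma> \<zeta>)\<^sup>2 \<partial>\<mu>) < \<infinity>)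
            \<longleftrightarrow> (\<forall>w\<in>ball 0 1.
                  (\<lambda>z. (\<alpha> - b z) / (\<alpha> - I z) * dbr_kernel I z w) \<in> de_branges_rovnyak b))
       \<and> ((\<forall>w\<in>ball 0 1.
                  (\<lambda>z. (\<alpha> - b z) / (\<alpha> - I z) * dbr_kernel I z w) \<in> de_branges_rovnyak b)
            \<longleftrightarrow> (\<exists>w\<in>ball 0 1.
                  (\<lambda>z. (\<alpha> - b z) / (\<alpha> - I z) * dbr_kernel I z w) \<in> de_branges_rovnyak b))"
proof -
  have I: "holomorphic_to_disc I" using assms(2) by (simp add: inner_function_def)
  have i_ii: "\<forall>w\<in>ball 0 1. (\<lambda>z. (\<alpha> - b z) / (\<alpha> - I z) * dbr_kernel I z w) \<in> de_branges_rovnyak b"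
    if "absolutely_continuous \<mu> \<sigma> \<and> (\<integral>\<^sup>+\<zeta>. (RN_deriv \<mu> \<sigma> \<zeta>)\<^sup>2 \<partial>\<mu>) < \<infinity>"
    using membership_of_clark_density[OF I assms(3,5,6,7)] that by blast
  have iii_i: "absolutely_continuous \<mu> \<sigma> \<and> (\<integral>\<^sup>+\<zeta>. (RN_deriv \<mu> \<sigma> \<zeta>)\<^sup>2 \<partial>\<mu>) < \<infinity>"
    if "\<exists>w\<in>ball 0 1. (\<lambda>z. (\<alpha> - b z) / (\<alpha> - I z) * dbr_kernel I z w) \<in> de_branges_rovnyak b"
    using clark_density_of_membership[OF assms(2,3,5,6,7)] that by blast
  have "0 \<in> ball (0 :: complex ^ 'n) 1" by simp
  then show ?thesis using i_ii iii_i by blast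
qed

end
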